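(* Let $\Gamma$ be a discrete group and let $L(\Gamma)$ be its group von Neumann algebra, equipped with its canonical faithful normal trace $\tau$. The following conditions are equivalent. (1) The group $\Gamma$ has the weak Haagerup property. (2) The von Neumann algebra $L(\Gamma)$ has the weak Haagerup property. More precisely, $\Lambda_{\mathrm{WH}}(\Gamma)=\Lambda_{\mathrm{WH}}(L(\Gamma))$.
   Context: Groups: a function $u:\Gamma\to\mathbb{C}$ on a discrete group is a Herz-Schur multiplier if for every bounded operator $[a_{xy}]_{x,y\in \Gamma}$ on $\ell^2(\Gamma)$ the matrix $[u(y^{-1}x)a_{xy}]$ represents a bounded operator on $\ell^2(\Gamma)$; $B_2(\Gamma)$ is the set of these and $\|u\|_{B_2}$ is the norm of the operator $[a_{xy}]\mapsto[u(y^{-1}x)a_{xy}]$ on $B(\ell^2(\Gamma))$. $\Gamma$ has the weak Haagerup property if there are $C>0$ and a net $(u_\alpha)$ in $B_2(\Gamma)\cap C_0(\Gamma)$ with $\|u_\alpha\|_{B_2}\le C$ for all $\alpha$ and $u_\alpha\to1$ pointwise (equivalently, uniformly on compact, i.e. finite, subsets). $\Lambda_{\mathrm{WH}}(\Gamma)$ is the infimum of such $C$ ($\infty$ if none exists). Von Neumann algebras: a trace means a tracial state. Let $M$ be a von Neumann algebra with a faithful normal trace $\tau$, $\langle x,y\rangle_\tau=\tau(y^*x)$, and $L^2(M,\tau)$ the completion of $M$ for this inner product. $(M,\tau)$ has the weak Haagerup property if there are $C>0$ and a net $(T_\alpha)$ of normal, completely bounded maps on $M$ such that (1) $\|T_\alpha\|_{\mathrm{cb}}\le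 C$ for every $\alpha$; (2) $\langle T_\alpha x,y\rangle_\tau=\langle x,T_\alpha y\rangle_\tau$ for all $x,y\in M$; (3) each $T_\alpha$ extends to a compact operator on $L^2(M,\tau)$; (4) $T_\alpha x\to x$ ultraweakly for every $x\in M$. $\Lambda_{\mathrm{WH}}(M)=\Lambda_{\mathrm{WH}}(M,\tau)$ is the infimum of such $C$ ($\infty$ if none exists). $L(\Gamma)$ is the von Neumann algebra generated by the left regular representation of $\Gamma$ on $\ell^2(\Gamma)$, with canonical trace $\tau(x)=\langle x\delta_e,\delta_e\rangle$. *)

theory Defs
  imports "HOL-Analysis.Analysis"
begin

section \<open>Complex Hilbert spaces\<close>

text \<open>
  The library has only real inner products. A complex Hilbert space is a real one whose real inner
  product is the real part of a sesquilinear form, linear in the first argument.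
\<close>

class complex_hilbert = real_inner + complete_space +
  fixes scaleC :: "complex \<Rightarrow> 'a \<Rightarrow> 'a"  (infixr \<open>*\<^sub>C\<close> 75)
    and cinner :: "'a \<Rightarrow> 'a \<Rightarrow> complex"
  assumes scaleC_add_right: "c *\<^sub>C (x + y) = c *\<^sub>C x + c *\<^sub>C y"
    and scaleC_add_left: "(c + d) *\<^sub>C x = c *\<^sub>C x + d *\<^sub>C x"
    and scaleC_scaleC: "c *\<^sub>C (d *\<^sub>C x) = (c * d) *\<^sub>C x"
    and scaleC_of_real: "complex_of_real r *\<^sub>C x = r *\<^sub>R x"
    and cinner_add_left: "cinner (x + y) z = cinner x z + cinner y z"
    and cinner_scaleC_left: "cinner (c *\<^sub>C x) y = c * cinner x y"
    and cinner_commute: "cinner y x = cnj (cinner x y)"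
    and Re_cinner: "Re (cinner x y) = inner x y"

subsection \<open>The space of square-summable functions\<close>

typedef 'a ell2 = "{f :: 'a \<Rightarrow> complex. (\<lambda>i. (cmod (f i))\<^sup>2) summable_on UNIV}"
  morphisms coord Abs_ell2
  by (rule exI[of _ "\<lambda>_. 0"]) simp

setup_lifting type_definition_ell2

lemma ell2_scale_summable:
  fixes f :: "'a \<Rightarrow> complex"
  assumes "(\<lambda>i. (cmod (f i))\<^sup>2) summable_on UNIV"
  shows "(\<lambda>i. (cmod (c * f i))\<^sup>2) summable_on UNIV"
  using summable_on_cmult_right[OF assms, of "(cmod c)\<^sup>2"] by (simp add: norm_mult power_mult_distrib)

lemma ell2_add_summable:
  fixes f g :: "'a \<Rightarrow> complex"
  assumes "(\<lambda>i. (cmod (f i))\<^sup>2) summable_on UNIV" "(\<lambda>i. (cmod (g i))\<^sup>2) summable_on UNIV"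
  shows "(\<lambda>i. (cmod (f i + g i))\<^sup>2) summable_on UNIV"
proof (rule summable_on_comparison_test)
  show "(\<lambda>i. 2 * ((cmod (f i))\<^sup>2 + (cmod (g i))\<^sup>2)) summable_on UNIV"
    by (intro summable_on_cmult_right summable_on_add assms)
  fix i
  have "(cmod (f i + g i))\<^sup>2 \<le> (cmod (f i) + cmod (g i))\<^sup>2"
    by (intro power_mono norm_triangle_ineq) auto
  also have "\<dots> \<le> 2 * ((cmod (f i))\<^sup>2 + (cmod (g i))\<^sup>2)"
    using sum_squares_bound[of "cmod (f i)" "cmod (g i)"] by (simp add: power2_sum)
  finally show "(cmod (f i + g i))\<^sup>2 \<le> 2 * ((cmod (f i))\<^sup>2 + (cmod (g i))\<^sup>2)" .
qed auto

lemma ell2_mult_summable: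
  fixes f g :: "'a \<Rightarrow> complex"
  assumes "(\<lambda>i. (cmod (f i))\<^sup>2) summable_on UNIV" "(\<lambda>i. (cmod (g i))\<^sup>2) summable_on UNIV"
  shows "(\<lambda>i. f i * cnj (g i)) summable_on UNIV"
proof (rule abs_summable_summable, rule summable_on_comparison_test)
  show "(\<lambda>i. (cmod (f i))\<^sup>2 + (cmod (g i))\<^sup>2) summable_on UNIV"
    by (intro summable_on_add assms)
  fix i
  show "cmod (f i * cnj (g i)) \<le> (cmod (f i))\<^sup>2 + (cmod (g i))\<^sup>2"
    using sum_squares_bound[of "cmod (f i)" "cmod (g i)"]
      mult_nonneg_nonneg[OF norm_ge_zero[of "f i"] norm_ge_zero[of "g i"]]
    unfolding norm_mult complex_mod_cnj by linarith
qed auto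

instantiation ell2 :: (type) real_vector
begin

lift_definition zero_ell2 :: "'a ell2" is "\<lambda>_. 0" by simp
lift_definition plus_ell2 :: "'a ell2 \<Rightarrow> 'a ell2 \<Rightarrow> 'a ell2" is "\<lambda>f g i. f i + g i"
  by (simp add: ell2_add_summable)
lift_definition uminus_ell2 :: "'a ell2 \<Rightarrow> 'a ell2" is "\<lambda>f i. - f i" by simp
lift_definition minus_ell2 :: "'a ell2 \<Rightarrow> 'a ell2 \<Rightarrow> 'a ell2" is "\<lambda>f g i. f i - g i"
  using ell2_add_summable[where g = "\<lambda>i. - g i" for g] by simp
lift_definition scaleR_ell2 :: "real \<Rightarrow> 'a ell2 \<Rightarrow> 'a ell2" is "\<lambda>r f i. complex_of_real r * f i"
  by (simp only: mem_Collect_eq ell2_scale_summable)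

instance
  by standard (transfer; auto simp: algebra_simps)+

end

lift_definition ell2_scale :: "complex \<Rightarrow> 'a ell2 \<Rightarrow> 'a ell2" is "\<lambda>c f i. c * f i"
  by (simp only: mem_Collect_eq ell2_scale_summable)

lift_definition ell2_inner :: "'a ell2 \<Rightarrow> 'a ell2 \<Rightarrow> complex"
  is "\<lambda>f g. \<Sum>\<^sub>\<infinity>i. f i * cnj (g i)" .

lemma ell2_inner_add_left: "ell2_inner (x + y) z = ell2_inner x z + ell2_inner y z"
  by transfer (simp add: distrib_right infsum_add ell2_mult_summable)

lemma ell2_inner_scale_left: "ell2_inner (ell2_scale c x) y = c * ell2_inner x y"
  by transfer (simp add: mult.assoc infsum_cmult_right')

lemma ell2_inner_commute: "ell2_inner y x = cnj (ell2_inner x y)"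
  by transfer (simp add: mult.commute flip: infsum_cnj)

lemma ell2_scale_of_real: "ell2_scale (complex_of_real r) x = r *\<^sub>R x"
  by transfer simp

lemma coord_summable: "(\<lambda>i. (cmod (coord x i))\<^sup>2) summable_on UNIV"
  using coord[of x] by simp

lemma ell2_inner_self: "ell2_inner x x = complex_of_real (\<Sum>\<^sub>\<infinity>i. (cmod (coord x i))\<^sup>2)"
proof -
  have "(\<Sum>\<^sub>\<infinity>i. coord x i * cnj (coord x i)) = (\<Sum>\<^sub>\<infinity>i. complex_of_real ((cmod (coord x i))\<^sup>2))"
    by (simp add: complex_norm_square[symmetric])
  then show ?thesis
    using has_sum_of_real[OF has_sum_infsum[OF coord_summable[of x]], where 'a = complex]
    by (simp add: ell2_inner.rep_eq infsumI)
qed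

lemma coord_zero: "coord 0 i = 0" and coord_minus: "coord (x - y) i = coord x i - coord y i"
  by (transfer; simp)+

instantiation ell2 :: (type) real_inner
begin

definition inner_ell2 :: "'a ell2 \<Rightarrow> 'a ell2 \<Rightarrow> real" where
  "inner_ell2 x y = Re (ell2_inner x y)"
definition norm_ell2 :: "'a ell2 \<Rightarrow> real" where
  "norm_ell2 x = sqrt (inner x x)"
definition dist_ell2 :: "'a ell2 \<Rightarrow> 'a ell2 \<Rightarrow> real" where
  "dist_ell2 x y = norm (x - y)"
definition sgn_ell2 :: "'a ell2 \<Rightarrow> 'a ell2" where
  "sgn_ell2 x = x /\<^sub>R norm x"
definition uniformity_ell2 :: "('a ell2 \<times> 'a ell2) filter" where
  "uniformity_ell2 = (INF e\<in>{0<..}. principal {(x, y). dist x y < e})"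
definition open_ell2 :: "'a ell2 set \<Rightarrow> bool" where
  "open_ell2 U \<longleftrightarrow> (\<forall>x\<in>U. \<forall>\<^sub>F (x', y) in uniformity. x' = x \<longrightarrow> y \<in> U)"

instance
proof
  fix x y z :: "'a ell2" and r :: real
  show "inner x y = inner y x"
    unfolding inner_ell2_def by (subst ell2_inner_commute) simp
  show "inner (x + y) z = inner x z + inner y z"
    by (simp add: inner_ell2_def ell2_inner_add_left)
  show "inner (r *\<^sub>R x) y = r * inner x y"
    by (simp add: inner_ell2_def ell2_inner_scale_left flip: ell2_scale_of_real)
  show "0 \<le> inner x x"
    by (simp add: inner_ell2_def ell2_inner_self infsum_nonneg)
  show "inner x x = 0 \<longleftrightarrow> x = 0"
  proof
    assume "inner x x = 0"
    then have "(\<Sum>\<^sub>\<infinity>i. (cmod (coord x i))\<^sup>2) = 0"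
      by (simp add: inner_ell2_def ell2_inner_self)
    then have "(cmod (coord x i))\<^sup>2 = 0" for i
      using nonneg_infsum_le_0D[OF _ coord_summable[of x], of i] by simp
    then have "coord x = coord 0"
      by (simp add: fun_eq_iff coord_zero)
    then show "x = 0"
      by (simp add: coord_inject)
  next
    assume "x = 0"
    then show "inner x x = 0"
      by (simp add: inner_ell2_def ell2_inner_self coord_zero)
  qed
qed (simp_all add: norm_ell2_def dist_ell2_def sgn_ell2_def uniformity_ell2_def open_ell2_def)

end

lemma norm_ell2_sq: "(norm (x :: 'a ell2))\<^sup>2 = (\<Sum>\<^sub>\<infinity>i. (cmod (coord x i))\<^sup>2)"
  by (simp add: power2_norm_eq_inner inner_ell2_def ell2_inner_self)

lemma sum_coord_le: "finite A \<Longrightarrow> (\<Sum>i\<in>A. (cmod (coord x i))\<^sup>2) \<le> (norm x)\<^sup>2"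
  by (simp add: norm_ell2_sq finite_sum_le_infsum coord_summable)

lemma cmod_coord_le: "cmod (coord x i) \<le> norm x"
  using sum_coord_le[of "{i}" x] by (simp add: power2_le_iff_abs_le)

instance ell2 :: (type) complete_space
proof
  fix X :: "nat \<Rightarrow> 'a ell2"
  assume X: "Cauchy X"
  have "Cauchy (\<lambda>n. coord (X n) i)" for i
    unfolding Cauchy_def
  proof (intro allI impI)
    fix e :: real assume "e > 0"
    then obtain N where "\<forall>m\<ge>N. \<forall>n\<ge>N. norm (X m - X n) < e"
      using X by (auto simp: Cauchy_def dist_norm)
    then show "\<exists>N. \<forall>m\<ge>N. \<forall>n\<ge>N. dist (coord (X m) i) (coord (X n) i) < e"
      using le_less_trans[OF cmod_coord_le[of "X m - X n" i for m n]]
      unfolding dist_norm coord_minus by blast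
  qed
  then have "\<forall>i. \<exists>l. (\<lambda>n. coord (X n) i) \<longlonglongrightarrow> l"
    by (simp add: Cauchy_convergent_iff convergent_def)
  then obtain f where f: "\<And>i. (\<lambda>n. coord (X n) i) \<longlonglongrightarrow> f i"
    by metis
  have tail: "(\<Sum>i\<in>A. (cmod (coord (X n) i - f i))\<^sup>2) \<le> e\<^sup>2"
    if "finite A" and e: "\<forall>m\<ge>N. norm (X n - X m) \<le> e" for A n N e
  proof (rule tendsto_upperbound)
    show "(\<lambda>m. \<Sum>i\<in>A. (cmod (coord (X n) i - coord (X m) i))\<^sup>2)
            \<longlonglongrightarrow> (\<Sum>i\<in>A. (cmod (coord (X n) i - f i))\<^sup>2)"
      by (intro tendsto_intros f)
    show "\<forall>\<^sub>F m in sequentially. (\<Sum>i\<in>A. (cmod (coord (X n) i - coord (X m) i))\<^sup>2) \<le> e\<^sup>2"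
      using eventually_ge_at_top[of N]
    proof eventually_elim
      case (elim m)
      have "(\<Sum>i\<in>A. (cmod (coord (X n) i - coord (X m) i))\<^sup>2) \<le> (norm (X n - X m))\<^sup>2"
        using sum_coord_le[OF \<open>finite A\<close>, of "X n - X m"] by (simp add: coord_minus)
      also have "\<dots> \<le> e\<^sup>2"
        using e elim by (intro power_mono) auto
      finally show ?case .
    qed
  qed simp
  have diff: "(\<lambda>i. (cmod (coord (X n) i - f i))\<^sup>2) summable_on UNIV"
    if "\<forall>m\<ge>N. norm (X n - X m) \<le> e" for n N e
  proof (rule nonneg_bdd_above_summable_on)
    show "bdd_above (sum (\<lambda>i. (cmod (coord (X n) i - f i))\<^sup>2) ` {F. F \<subseteq> UNIV \<and> finite F})"
      using tail[OF _ that] by (intro bdd_aboveI[of _ "e\<^sup>2"]) auto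
  qed simp
  have bound: "\<exists>N. \<forall>n\<ge>N. \<forall>m\<ge>N. norm (X n - X m) \<le> e" if "e > 0" for e
    using X that unfolding Cauchy_def dist_norm by (meson less_imp_le)
  obtain N where "\<forall>m\<ge>N. norm (X N - X m) \<le> 1"
    using bound[of 1] by auto
  from diff[OF this] have "(\<lambda>i. (cmod (f i - coord (X N) i))\<^sup>2) summable_on UNIV"
    by (simp add: norm_minus_commute)
  from ell2_add_summable[OF this coord_summable[of "X N"]]
  have "(\<lambda>i. (cmod (f i))\<^sup>2) summable_on UNIV"
    by simp
  then have cf: "coord (Abs_ell2 f) = f"
    by (simp add: Abs_ell2_inverse)
  have "X \<longlonglongrightarrow> Abs_ell2 f"
  proof (rule LIMSEQ_I)
    fix e :: real assume "e > 0"
    then obtain N where N: "\<forall>n\<ge>N. \<forall>m\<ge>N. norm (X n - X m) \<le> e / 2"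
      using bound[of "e / 2"] by auto
    have "norm (X n - Abs_ell2 f) < e" if "n \<ge> N" for n
    proof -
      have n: "\<forall>m\<ge>N. norm (X n - X m) \<le> e / 2"
        using N that by auto
      have "(norm (X n - Abs_ell2 f))\<^sup>2 = (\<Sum>\<^sub>\<infinity>i. (cmod (coord (X n) i - f i))\<^sup>2)"
        by (simp add: norm_ell2_sq coord_minus cf)
      also have "\<dots> \<le> (e / 2)\<^sup>2"
        using diff[OF n] tail[OF _ n] by (intro infsum_le_finite_sums) auto
      finally have "norm (X n - Abs_ell2 f) \<le> e / 2"
        using \<open>e > 0\<close> by (simp add: power2_le_iff_abs_le)
      then show ?thesis
        using \<open>e > 0\<close> by simp
    qed
    then show "\<exists>N. \<forall>n\<ge>N. norm (X n - Abs_ell2 f) < e"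
      by blast
  qed
  then show "convergent X"
    by (rule convergentI)
qed

instantiation ell2 :: (type) complex_hilbert
begin

definition scaleC_ell2 :: "complex \<Rightarrow> 'a ell2 \<Rightarrow> 'a ell2" where
  "scaleC_ell2 = ell2_scale"
definition cinner_ell2 :: "'a ell2 \<Rightarrow> 'a ell2 \<Rightarrow> complex" where
  "cinner_ell2 = ell2_inner"

instance
proof
  fix x y z :: "'a ell2" and c d :: complex and r :: real
  show "c *\<^sub>C (x + y) = c *\<^sub>C x + c *\<^sub>C y"
    unfolding scaleC_ell2_def by transfer (simp add: distrib_left)
  show "(c + d) *\<^sub>C x = c *\<^sub>C x + d *\<^sub>C x"
    unfolding scaleC_ell2_def by transfer (simp add: distrib_right)
  show "c *\<^sub>C (d *\<^sub>C x) = (c * d) *\<^sub>C x"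
    unfolding scaleC_ell2_def by transfer (simp add: mult.assoc)
  show "complex_of_real r *\<^sub>C x = r *\<^sub>R x"
    by (simp add: scaleC_ell2_def ell2_scale_of_real)
  show "cinner (x + y) z = cinner x z + cinner y z"
    by (simp add: cinner_ell2_def ell2_inner_add_left)
  show "cinner (c *\<^sub>C x) y = c * cinner x y"
    by (simp add: cinner_ell2_def scaleC_ell2_def ell2_inner_scale_left)
  show "cinner y x = cnj (cinner x y)"
    unfolding cinner_ell2_def by (rule ell2_inner_commute)
  show "Re (cinner x y) = inner x y"
    by (simp add: cinner_ell2_def inner_ell2_def)
qed

end

lift_definition delta :: "'a \<Rightarrow> 'a ell2" is "\<lambda>j i. if i = j then 1 else 0"
proof -
  fix j :: 'a
  have "(\<lambda>i. (cmod (if i = j then 1 else 0))\<^sup>2) summable_on UNIV \<longleftrightarrow>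
        (\<lambda>i. (cmod (if i = j then 1 else 0))\<^sup>2) summable_on {j}"
    by (rule summable_on_cong_neutral) auto
  then show "(\<lambda>i. (cmod (if i = j then 1 else 0))\<^sup>2) summable_on UNIV"
    by simp
qed


section \<open>Von Neumann algebras\<close>

type_synonym 'h oper = "'h \<Rightarrow> 'h"

definition bounded_ops :: "'h::complex_hilbert oper set" where
  "bounded_ops = {x. bounded_linear x \<and> (\<forall>c \<xi>. x (c *\<^sub>C \<xi>) = c *\<^sub>C x \<xi>)}"

abbreviation op_add :: "'h::complex_hilbert oper \<Rightarrow> 'h oper \<Rightarrow> 'h oper" where
  "op_add x y \<equiv> (\<lambda>\<xi>. x \<xi> + y \<xi>)"

abbreviation op_scale :: "complex \<Rightarrow> 'h::complex_hilbert oper \<Rightarrow> 'h oper" where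
  "op_scale c x \<equiv> (\<lambda>\<xi>. c *\<^sub>C x \<xi>)"

definition commutant :: "'h::complex_hilbert oper set \<Rightarrow> 'h oper set" where
  "commutant S = {y \<in> bounded_ops. \<forall>x\<in>S. x \<circ> y = y \<circ> x}"

text \<open>
  A double commutant is automatically a unital subalgebra. On complex-linear operators the library's
  \<open>adjoint\<close>, taken for the real inner product, agrees with the adjoint for \<open>cinner\<close>.
\<close>

definition von_neumann_algebra :: "'h::complex_hilbert oper set \<Rightarrow> bool" where
  "von_neumann_algebra M \<longleftrightarrow>
     M \<subseteq> bounded_ops \<and> (\<forall>x\<in>M. adjoint x \<in> M) \<and> commutant (commutant M) = M"

definition generated_vna :: "'h::complex_hilbert oper set \<Rightarrow> 'h oper set" where
  "generated_vna S = \<Inter>{M. von_neumann_algebra M \<and> S \<subseteq> M}"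

definition square_summable :: "(nat \<Rightarrow> 'h::real_normed_vector) \<Rightarrow> bool" where
  "square_summable \<xi> \<longleftrightarrow> summable (\<lambda>n. (norm (\<xi> n))\<^sup>2)"

definition ultraweak :: "'h::complex_hilbert oper topology" where
  "ultraweak = topology_generated_by
     {{x \<in> bounded_ops. (\<Sum>n. cinner (x (\<xi> n)) (\<eta> n)) \<in> U} | \<xi> \<eta> U.
        square_summable \<xi> \<and> square_summable \<eta> \<and> open U}"

definition linear_map_on ::
    "'h::complex_hilbert oper set \<Rightarrow> ('h oper \<Rightarrow> 'k::complex_hilbert oper) \<Rightarrow> bool" where
  "linear_map_on M T \<longleftrightarrow>
     (\<forall>x\<in>M. \<forall>y\<in>M. T (op_add x y) = op_add (T x) (T y)) \<and>
     (\<forall>c. \<forall>x\<in>M. T (op_scale c x) = op_scale c (T x))"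

definition normal_map_on :: "'h::complex_hilbert oper set \<Rightarrow> ('h oper \<Rightarrow> 'h oper) \<Rightarrow> bool" where
  "normal_map_on M T \<longleftrightarrow>
     continuous_map (subtopology ultraweak M) (subtopology ultraweak M) T"

text \<open>The norm of an \<open>n \<times> n\<close> matrix of operators acting on the \<open>n\<close>-fold direct sum of \<open>'h\<close>.\<close>

definition matrix_norm :: "nat \<Rightarrow> (nat \<Rightarrow> nat \<Rightarrow> 'h::complex_hilbert oper) \<Rightarrow> real" where
  "matrix_norm n a =
     (SUP \<xi>\<in>{\<xi> :: nat \<Rightarrow> 'h. L2_set (\<lambda>j. norm (\<xi> j)) {..<n} \<le> 1}.
        L2_set (\<lambda>i. norm (\<Sum>j<n. a i j (\<xi> j))) {..<n})"

text \<open>This is \<open>\<infinity>\<close> precisely when \<open>T\<close> is not completely bounded.\<close>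

definition cb_norm :: "'h::complex_hilbert oper set \<Rightarrow> ('h oper \<Rightarrow> 'h oper) \<Rightarrow> ereal" where
  "cb_norm M T =
     (SUP n. SUP a\<in>{a. (\<forall>i<n. \<forall>j<n. a i j \<in> M) \<and> matrix_norm n a \<le> 1}.
        ereal (matrix_norm n (\<lambda>i j. T (a i j))))"


section \<open>The weak Haagerup property for von Neumann algebras\<close>

definition trace_inner :: "('h::complex_hilbert oper \<Rightarrow> complex) \<Rightarrow> 'h oper \<Rightarrow> 'h oper \<Rightarrow> complex" where
  "trace_inner \<tau> x y = \<tau> (adjoint y \<circ> x)"

text \<open>
  An isometric linear map of \<open>(M, trace_inner \<tau>)\<close> into a Hilbert space \<open>'k\<close>; the closure of its
  range is then a completion, that is, a model of \<open>L\<^sup>2(M, \<tau>)\<close>.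
\<close>

definition L2_embedding ::
    "'h::complex_hilbert oper set \<Rightarrow> ('h oper \<Rightarrow> complex) \<Rightarrow> ('h oper \<Rightarrow> 'k::complex_hilbert) \<Rightarrow> bool" where
  "L2_embedding M \<tau> J \<longleftrightarrow>
     (\<forall>x\<in>M. \<forall>y\<in>M. J (op_add x y) = J x + J y) \<and>
     (\<forall>c. \<forall>x\<in>M. J (op_scale c x) = c *\<^sub>C J x) \<and>
     (\<forall>x\<in>M. \<forall>y\<in>M. cinner (J x) (J y) = trace_inner \<tau> x y)"

definition compact_operator_on :: "'k::complex_hilbert set \<Rightarrow> ('k \<Rightarrow> 'k) \<Rightarrow> bool" where
  "compact_operator_on V S \<longleftrightarrow>
     S ` V \<subseteq> V \<and>
     (\<forall>v\<in>V. \<forall>w\<in>V. S (v + w) = S v + S w) \<and>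
     (\<forall>c. \<forall>v\<in>V. S (c *\<^sub>C v) = c *\<^sub>C S v) \<and>
     compact (closure (S ` (V \<inter> cball 0 1)))"

text \<open>
  The type \<open>'h oper ell2\<close> is large enough to contain \<open>L\<^sup>2(M, \<tau>)\<close>, whose Hilbert dimension is at
  most the cardinality of \<open>M\<close>. Completions being unique up to a unitary fixing \<open>M\<close>, it does not
  matter which \<open>J\<close> is used.
\<close>

definition extends_to_compact_on_L2 ::
    "'h::complex_hilbert oper set \<Rightarrow> ('h oper \<Rightarrow> complex) \<Rightarrow> ('h oper \<Rightarrow> 'h oper) \<Rightarrow> bool" where
  "extends_to_compact_on_L2 M \<tau> T \<longleftrightarrow>
     (\<exists>(J :: 'h oper \<Rightarrow> 'h oper ell2) S. L2_embedding M \<tau> J \<and>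
        compact_operator_on (closure (J ` M)) S \<and> (\<forall>x\<in>M. S (J x) = J (T x)))"

text \<open>
  Nets in a set \<open>A\<close> are rendered by proper filters \<open>F \<le> principal A\<close>. Nothing is lost or gained:
  every net in \<open>A\<close>, over an index set of any type, has such a filter of tails, and conversely every
  such \<open>F\<close> is the filter of tails of a net in \<open>A\<close>. See
  \<open>filter_of_net\<close> and \<open>net_of_filter\<close>.
\<close>

definition directed_by :: "'i set \<Rightarrow> ('i \<Rightarrow> 'i \<Rightarrow> bool) \<Rightarrow> bool" where
  "directed_by I le \<longleftrightarrow> I \<noteq> {} \<and> (\<forall>i\<in>I. le i i) \<and>
     (\<forall>i\<in>I. \<forall>j\<in>I. \<forall>k\<in>I. le i j \<longrightarrow> le j k \<longrightarrow> le i k) \<and>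
     (\<forall>i\<in>I. \<forall>j\<in>I. \<exists>k\<in>I. le i k \<and> le j k)"

definition tails :: "'i set \<Rightarrow> ('i \<Rightarrow> 'i \<Rightarrow> bool) \<Rightarrow> 'i filter" where
  "tails I le = (INF i\<in>I. principal {j\<in>I. le i j})"

lemma eventually_tails:
  assumes "directed_by I le"
  shows "eventually P (tails I le) \<longleftrightarrow> (\<exists>i\<in>I. \<forall>j\<in>I. le i j \<longrightarrow> P j)"
proof -
  have trans: "le i l" if "i \<in> I" "k \<in> I" "l \<in> I" "le i k" "le k l" for i k l
    using assms that unfolding directed_by_def by blast
  have "eventually P (tails I le) \<longleftrightarrow> (\<exists>i\<in>I. eventually P (principal {j\<in>I. le i j}))"
    unfolding tails_def
  proof (rule eventually_INF_base)
    show "I \<noteq> {}"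
      using assms by (simp add: directed_by_def)
    fix i j assume ij: "i \<in> I" "j \<in> I"
    with assms obtain k where k: "k \<in> I" "le i k" "le j k"
      unfolding directed_by_def by blast
    then have "{l\<in>I. le k l} \<subseteq> {l\<in>I. le i l} \<inter> {l\<in>I. le j l}"
      using trans ij by blast
    with k(1) show "\<exists>k\<in>I. principal {l\<in>I. le k l} \<le>
        inf (principal {l\<in>I. le i l}) (principal {l\<in>I. le j l})"
      by (intro bexI[of _ k]) (simp_all only: inf_principal principal_le_iff)
  qed
  then show ?thesis
    by (auto simp: eventually_principal)
qed

lemma filter_of_net:
  assumes "directed_by I le" and "\<forall>i\<in>I. u i \<in> A"
  shows "filtermap u (tails I le) \<noteq> bot" and "filtermap u (tails I le) \<le> principal A"
proof -
  have "\<not> eventually (\<lambda>_. False) (tails I le)"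
    unfolding eventually_tails[OF assms(1)] using assms(1) unfolding directed_by_def by blast
  then show "filtermap u (tails I le) \<noteq> bot"
    by (simp add: trivial_limit_def eventually_filtermap)
  have "eventually (\<lambda>i. u i \<in> A) (tails I le)"
    unfolding eventually_tails[OF assms(1)] using assms unfolding directed_by_def by blast
  then show "filtermap u (tails I le) \<le> principal A"
    by (simp only: le_principal eventually_filtermap)
qed

lemma net_of_filter:
  fixes F :: "'a filter"
  assumes "F \<noteq> bot" and "F \<le> principal A"
  obtains I :: "('a set \<times> 'a) set" and le u
    where "directed_by I le" and "\<forall>i\<in>I. u i \<in> A" and "filtermap u (tails I le) = F"
proof -
  define I where "I = {i. eventually (\<lambda>x. x \<in> fst i) F \<and> snd i \<in> fst i \<and> fst i \<subseteq> A}"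
  define le :: "('a set \<times> 'a) \<Rightarrow> ('a set \<times> 'a) \<Rightarrow> bool" where "le = (\<lambda>i j. fst j \<subseteq> fst i)"
  have A: "eventually (\<lambda>x. x \<in> A) F"
    using assms(2) by (simp add: le_principal)
  have ex: "\<exists>b. (B, b) \<in> I" if "eventually (\<lambda>x. x \<in> B) F" "B \<subseteq> A" for B
  proof -
    have "B \<noteq> {}"
      using that(1) assms(1) unfolding trivial_limit_def by (metis empty_iff eventually_mono)
    then show ?thesis
      using that unfolding I_def by auto
  qed
  have dir: "directed_by I le"
    unfolding directed_by_def
  proof (intro conjI ballI impI)
    show "I \<noteq> {}"
      using ex[OF A] by auto
  next
    fix i j assume "i \<in> I" "j \<in> I"
    then have "eventually (\<lambda>x. x \<in> fst i \<inter> fst j) F" "fst i \<inter> fst j \<subseteq> A"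
      by (auto simp: I_def eventually_conj_iff)
    from ex[OF this] obtain b where "(fst i \<inter> fst j, b) \<in> I" ..
    moreover have "le i (fst i \<inter> fst j, b) \<and> le j (fst i \<inter> fst j, b)"
      by (simp add: le_def)
    ultimately show "\<exists>k\<in>I. le i k \<and> le j k"
      by blast
  qed (auto simp: le_def)
  have "\<forall>i\<in>I. snd i \<in> A"
    by (auto simp: I_def)
  have "(\<exists>i\<in>I. \<forall>j\<in>I. le i j \<longrightarrow> P (snd j)) \<longleftrightarrow> eventually P F" for P
  proof
    assume "\<exists>i\<in>I. \<forall>j\<in>I. le i j \<longrightarrow> P (snd j)"
    then obtain i where i: "i \<in> I" "\<forall>j\<in>I. le i j \<longrightarrow> P (snd j)"
      by blast
    have "P x" if "x \<in> fst i" for x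
    proof -
      have "(fst i, x) \<in> I" "le i (fst i, x)"
        using i(1) that by (simp_all add: I_def le_def)
      with i(2) show ?thesis
        by fastforce
    qed
    then show "eventually P F"
      using i(1) unfolding I_def by (auto elim: eventually_mono)
  next
    assume "eventually P F"
    then have "eventually (\<lambda>x. x \<in> {x\<in>A. P x}) F"
      using A by (simp add: eventually_conj_iff)
    then obtain b where "({x\<in>A. P x}, b) \<in> I"
      using ex[of "{x\<in>A. P x}"] by blast
    moreover have "P (snd j)" if "j \<in> I" "le ({x\<in>A. P x}, b) j" for j
      using that by (auto simp: I_def le_def)
    ultimately show "\<exists>i\<in>I. \<forall>j\<in>I. le i j \<longrightarrow> P (snd j)"
      by blast
  qed
  then have "filtermap snd (tails I le) = F"
    by (simp only: filter_eq_iff eventually_filtermap eventually_tails[OF dir] simp_thms)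
  with dir \<open>\<forall>i\<in>I. snd i \<in> A\<close> show ?thesis
    by (rule that)
qed

text \<open>
  In the following definitions \<open>M\<close> is meant to be a von Neumann algebra and \<open>\<tau>\<close> a faithful normal
  tracial state on it. Only the values of \<open>T\<close> and \<open>\<tau>\<close> on \<open>M\<close> matter.
\<close>

definition WH_map ::
    "'h::complex_hilbert oper set \<Rightarrow> ('h oper \<Rightarrow> complex) \<Rightarrow> real \<Rightarrow> ('h oper \<Rightarrow> 'h oper) \<Rightarrow> bool" where
  "WH_map M \<tau> C T \<longleftrightarrow>
     linear_map_on M T \<and> normal_map_on M T \<and>
     cb_norm M T \<le> ereal C \<and>
     (\<forall>x\<in>M. \<forall>y\<in>M. trace_inner \<tau> (T x) y = trace_inner \<tau> x (T y)) \<and>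
     extends_to_compact_on_L2 M \<tau> T"

definition WH_vna_bound :: "'h::complex_hilbert oper set \<Rightarrow> ('h oper \<Rightarrow> complex) \<Rightarrow> real \<Rightarrow> bool" where
  "WH_vna_bound M \<tau> C \<longleftrightarrow>
     C > 0 \<and>
     (\<exists>F :: ('h oper \<Rightarrow> 'h oper) filter.
        F \<noteq> bot \<and> F \<le> principal {T. WH_map M \<tau> C T} \<and>
        (\<forall>x\<in>M. limitin ultraweak (\<lambda>T. T x) x F))"

definition weak_Haagerup_vna :: "'h::complex_hilbert oper set \<Rightarrow> ('h oper \<Rightarrow> complex) \<Rightarrow> bool" where
  "weak_Haagerup_vna M \<tau> \<longleftrightarrow> (\<exists>C. WH_vna_bound M \<tau> C)"

text \<open>The infimum of the empty set of extended reals is \<open>\<infinity>\<close>.\<close>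

definition Lambda_WH_vna :: "'h::complex_hilbert oper set \<Rightarrow> ('h oper \<Rightarrow> complex) \<Rightarrow> ereal" where
  "Lambda_WH_vna M \<tau> = Inf {ereal C | C. WH_vna_bound M \<tau> C}"


section \<open>The weak Haagerup property for groups\<close>

text \<open>
  A discrete group is a type of class \<open>group_add\<close>; it need not be abelian, but is written
  additively, so that \<open>- y + x\<close> is \<open>y\<^sup>-\<^sup>1 x\<close> and \<open>0\<close> is the neutral element.
\<close>

definition entry :: "'a ell2 oper \<Rightarrow> 'a \<Rightarrow> 'a \<Rightarrow> complex" where
  "entry A x y = cinner (A (delta y)) (delta x)"

definition multiplier_rel ::
    "('g::group_add \<Rightarrow> complex) \<Rightarrow> 'g ell2 oper \<Rightarrow> 'g ell2 oper \<Rightarrow> bool" where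
  "multiplier_rel u A B \<longleftrightarrow>
     B \<in> bounded_ops \<and> (\<forall>x y. entry B x y = u (- y + x) * entry A x y)"

definition herz_schur :: "('g::group_add \<Rightarrow> complex) set" where
  "herz_schur = {u. \<forall>A\<in>bounded_ops. \<exists>B. multiplier_rel u A B}"

text \<open>
  A bounded operator is determined by its entries, so \<open>schur_map u\<close> is well defined for
  \<open>u \<in> herz_schur\<close>. Norms are compared only for such \<open>u\<close>.
\<close>

definition schur_map :: "('g::group_add \<Rightarrow> complex) \<Rightarrow> 'g ell2 oper \<Rightarrow> 'g ell2 oper" where
  "schur_map u A = (THE B. multiplier_rel u A B)"

definition herz_schur_norm :: "('g::group_add \<Rightarrow> complex) \<Rightarrow> ereal" where
  "herz_schur_norm u = (SUP A\<in>{A \<in> bounded_ops. onorm A \<le> 1}. ereal (onorm (schur_map u A)))"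

text \<open>The complements of the compact subsets of a discrete space generate the filter \<open>cofinite\<close>.\<close>

definition vanishing_at_infinity :: "('g \<Rightarrow> complex) set" where
  "vanishing_at_infinity = {u. (u \<longlongrightarrow> 0) cofinite}"

definition WH_group_bound :: "'g::group_add itself \<Rightarrow> real \<Rightarrow> bool" where
  "WH_group_bound _ C \<longleftrightarrow>
     C > 0 \<and>
     (\<exists>F :: ('g \<Rightarrow> complex) filter.
        F \<noteq> bot \<and>
        F \<le> principal {u \<in> herz_schur \<inter> vanishing_at_infinity. herz_schur_norm u \<le> ereal C} \<and>
        (\<forall>g. ((\<lambda>u. u g) \<longlongrightarrow> 1) F))"

definition weak_Haagerup_group :: "'g::group_add itself \<Rightarrow> bool" where
  "weak_Haagerup_group G \<longleftrightarrow> (\<exists>C. WH_group_bound G C)"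

definition Lambda_WH_group :: "'g::group_add itself \<Rightarrow> ereal" where
  "Lambda_WH_group G = Inf {ereal C | C. WH_group_bound G C}"


section \<open>The group von Neumann algebra\<close>

lift_definition left_regular :: "'g::group_add \<Rightarrow> 'g ell2 oper" is "\<lambda>g f x. f (- g + x)"
proof -
  fix g :: 'g and f :: "'g \<Rightarrow> complex"
  assume "(\<lambda>i. (cmod (f i))\<^sup>2) summable_on UNIV"
  moreover have "bij (\<lambda>x. - g + x)"
    by (rule bijI'[where f = "\<lambda>x. - g + x"]) (auto intro: exI[of _ "g + y" for y] simp flip: add.assoc)
  ultimately show "(\<lambda>x. (cmod (f (- g + x)))\<^sup>2) summable_on UNIV"
    using summable_on_reindex_bij_betw[of "\<lambda>x. - g + x" UNIV UNIV "\<lambda>i. (cmod (f i))\<^sup>2"] by simp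
qed

definition group_vna :: "'g::group_add ell2 oper set" where
  "group_vna = generated_vna (range left_regular)"

definition group_trace :: "'g::group_add ell2 oper \<Rightarrow> complex" where
  "group_trace x = cinner (x (delta 0)) (delta 0)"

end

theory Submission
  imports Defs
begin

text \<open>
  Both constants are compared bound by bound: a constant \<open>C\<close> is admissible for the group if and only if
  it is admissible for its von Neumann algebra.

  A multiplier \<open>u\<close> is sent to the Schur multiplication by \<open>Re (u (t s\<^sup>-\<^sup>1))\<close>; it preserves \<open>L(\<Gamma>)\<close>, which
  by the commutation theorem consists of the operators with right invariant matrices, and it is
  symmetric since its symbol is real. Smith's argument bounds its cb norm by its norm, and on
  \<open>L\<^sup>2\<close> it is diagonal with coefficients tending to \<open>0\<close>. It is normal because it maps the functionals given
  by finite kernels to such functionals, these are norm dense in the predual, and the predual is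
  norm closed; the last fact follows from the duality of operator norm and trace norm for finite
  matrices.

  Conversely a map \<open>T\<close> is sent to \<open>u g = \<tau> (\<lambda> g T(\<lambda> (g\<^sup>-\<^sup>1)))\<close>. Applying \<open>T\<close> to the matrices
  \<open>[a x y \<lambda> (x\<^sup>-\<^sup>1 y)]\<close>, which are unitarily equivalent to \<open>[a x y] \<otimes> 1\<close>, shows that the Schur norm of \<open>u\<close> is
  at most \<open>C\<close>; and \<open>u\<close> vanishes at infinity because \<open>T\<close> is compact on \<open>L\<^sup>2\<close>, where the \<open>\<lambda> g\<close> are
  orthonormal.
\<close>

section \<open>Complex inner products\<close>

text \<open>The obstacle is normality of the Schur maps. Composing an ultraweakly continuous
  functional with such a map multiplies its kernel by the symbol, and the product kernel no longer
  displays square summable vectors \<xi> and \<eta>. They are rebuilt by iteration: a functional of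
  norm at most c that is a norm limit of finite kernels equals, up to an error of norm c / 2, a
  finite sum of vector functionals whose square sums are at most 2 c. The square sums of all stages
  then form a convergent geometric series. The other norm estimates are reduced to finite sections
  of matrices. The group may be uncountable, so limits are taken along
  \<open>finite_subsets_at_top\<close>. Inversion enters because a symbol \<open>u (- y + x)\<close>
  is constant along left translations, while the matrices of operators in L(\<Gamma>) are constant
  along right translations.\<close>

lemma cinner_add_right: "cinner x (y + z) = cinner x y + cinner x (z::'h::complex_hilbert)"
  by (metis cinner_add_left cinner_commute complex_cnj_add)

lemma cinner_scaleC_right: "cinner x (c *\<^sub>C y) = cnj c * cinner x (y::'h::complex_hilbert)"
  by (metis cinner_scaleC_left cinner_commute complex_cnj_mult)

lemma cinner_zero_left [simp]: "cinner 0 (y::'h::complex_hilbert) = 0"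
  using cinner_add_left[of 0 0 y] by simp

lemma cinner_zero_right [simp]: "cinner (y::'h::complex_hilbert) 0 = 0"
  using cinner_add_right[of y 0 0] by simp

lemma cinner_diff_left: "cinner (x - y) z = cinner x z - cinner y (z::'h::complex_hilbert)"
  using cinner_add_left[of "x - y" y z] by simp

lemma cinner_diff_right: "cinner z (x - y) = cinner z x - cinner z (y::'h::complex_hilbert)"
  using cinner_add_right[of z "x - y" y] by simp

lemma cinner_sum_left: "cinner (sum f A) (y::'h::complex_hilbert) = (\<Sum>a\<in>A. cinner (f a) y)"
  by (induction A rule: infinite_finite_induct) (simp_all add: cinner_add_left)

lemma cinner_sum_right: "cinner (y::'h::complex_hilbert) (sum f A) = (\<Sum>a\<in>A. cinner y (f a))"
  by (induction A rule: infinite_finite_induct) (simp_all add: cinner_add_right)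

lemma cinner_self: "cinner x (x::'h::complex_hilbert) = complex_of_real ((norm x)\<^sup>2)"
proof (rule complex_eqI)
  have "cnj (cinner x x) = cinner x x"
    using cinner_commute[of x x] by simp
  then show "Im (cinner x x) = Im (complex_of_real ((norm x)\<^sup>2))"
    by (simp add: complex_eq_iff)
qed (simp add: Re_cinner power2_norm_eq_inner)

lemma norm_scaleC: "norm (c *\<^sub>C (x::'h::complex_hilbert)) = cmod c * norm x"
proof -
  have "(norm (c *\<^sub>C x))\<^sup>2 = Re (c * cnj c * cinner x x)"
    by (simp only: power2_norm_eq_inner Re_cinner[symmetric] cinner_scaleC_left cinner_scaleC_right mult_ac)
  also have "\<dots> = (cmod c * norm x)\<^sup>2"
    by (simp only: cinner_self complex_norm_square[symmetric] power_mult_distrib of_real_mult[symmetric] Re_complex_of_real)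
  finally show ?thesis
    by (simp add: power2_eq_iff_nonneg)
qed

lemma unit_phase: "\<exists>u. cmod u = 1 \<and> u * z = complex_of_real (cmod z)"
proof (cases "z = 0")
  case False
  then have "cmod (cnj z / cmod z) = 1 \<and> cnj z / cmod z * z = complex_of_real (cmod z)"
    by (simp add: norm_divide field_simps complex_norm_square[symmetric] power2_eq_square)
  then show ?thesis
    by blast
qed (auto intro: exI[of _ 1])

text \<open>Rotating \<open>x\<close> by a phase makes the inner product real and nonnegative, which
  leaves the real Cauchy-Schwarz inequality.\<close>

lemma cinner_norm_le: "cmod (cinner x y) \<le> norm x * norm (y::'h::complex_hilbert)"
proof -
  obtain u where u: "cmod u = 1" "u * cinner x y = cmod (cinner x y)"
    using unit_phase by blast
  then have "cmod (cinner x y) = inner (u *\<^sub>C x) y"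
    by (metis Re_cinner cinner_scaleC_left Re_complex_of_real)
  also have "\<dots> \<le> norm (u *\<^sub>C x) * norm y"
    by (rule norm_cauchy_schwarz)
  finally show ?thesis
    by (simp add: norm_scaleC u)
qed

lemma scaleC_one [simp]: "1 *\<^sub>C (x::'h::complex_hilbert) = x"
  using scaleC_of_real[of 1 x] by simp

lemma scaleC_zero_right [simp]: "c *\<^sub>C (0::'h::complex_hilbert) = 0"
  using scaleC_add_right[of c 0 0] by simp

lemma scaleC_sum_right: "c *\<^sub>C sum f A = (\<Sum>a\<in>A. c *\<^sub>C (f a :: 'h::complex_hilbert))"
  by (induction A rule: infinite_finite_induct) (simp_all add: scaleC_add_right)

lemma cinner_extensionality:
  assumes "\<And>z::'h::complex_hilbert. cinner x z = cinner y z"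
  shows "x = y"
proof -
  have "cinner (x - y) (x - y) = 0"
    using assms by (simp add: cinner_diff_left)
  then show ?thesis
    by (simp add: cinner_self)
qed

lemma bounded_ops_linear: "A \<in> bounded_ops \<Longrightarrow> bounded_linear A"
  by (simp add: bounded_ops_def)

lemma bounded_ops_add: "A \<in> bounded_ops \<Longrightarrow> A (x + y) = A x + A y"
  by (simp add: bounded_ops_linear linear_simps)

lemma bounded_ops_zero: "A \<in> bounded_ops \<Longrightarrow> A 0 = 0"
  by (simp add: bounded_ops_linear linear_simps)

lemma bounded_ops_sum: "A \<in> bounded_ops \<Longrightarrow> A (sum f S) = (\<Sum>s\<in>S. A (f s))"
  by (simp add: bounded_ops_linear bounded_linear.linear linear_sum)

lemma bounded_ops_scale: "A \<in> bounded_ops \<Longrightarrow> A (c *\<^sub>C x) = c *\<^sub>C A x"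
  by (simp add: bounded_ops_def)

lemma bounded_ops_norm_le: "A \<in> bounded_ops \<Longrightarrow> norm (A x) \<le> onorm A * norm x"
  by (simp add: bounded_ops_linear onorm)

lemma bounded_ops_onorm_nonneg: "A \<in> bounded_ops \<Longrightarrow> 0 \<le> onorm A"
  by (simp add: bounded_ops_linear onorm_pos_le)

lemma bounded_opsI:
  fixes A :: "'h::complex_hilbert oper"
  assumes "\<And>x y. A (x + y) = A x + A y" and "\<And>c x. A (c *\<^sub>C x) = c *\<^sub>C A x"
    and "\<And>x. norm (A x) \<le> norm x * K"
  shows "A \<in> bounded_ops"
  unfolding bounded_ops_def
proof (intro CollectI conjI allI assms(2))
  show "bounded_linear A"
    using assms(1,3) by (intro bounded_linear_intro[where K = K])
      (simp_all add: assms(2) flip: scaleC_of_real)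
qed

lemma op_add_bounded: "A \<in> bounded_ops \<Longrightarrow> B \<in> bounded_ops \<Longrightarrow> op_add A B \<in> bounded_ops"
  by (simp add: bounded_ops_def bounded_linear_add scaleC_add_right)

lemma op_diff_bounded: "A \<in> bounded_ops \<Longrightarrow> B \<in> bounded_ops \<Longrightarrow> (\<lambda>\<xi>. A \<xi> - B \<xi>) \<in> bounded_ops"
proof -
  assume *: "A \<in> bounded_ops" "B \<in> bounded_ops"
  have "c *\<^sub>C (x - y) = c *\<^sub>C x - c *\<^sub>C y" for c and x y :: 'a
    using scaleC_add_right[of c "x - y" y] by (simp add: algebra_simps)
  with * show ?thesis
    by (simp add: bounded_ops_def bounded_linear_sub)
qed

lemma op_scale_bounded: "A \<in> bounded_ops \<Longrightarrow> op_scale c A \<in> bounded_ops"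
proof (rule bounded_opsI)
  assume A: "A \<in> bounded_ops"
  fix x y :: 'a and d
  show "c *\<^sub>C A (x + y) = c *\<^sub>C A x + c *\<^sub>C A y"
    using A by (simp add: bounded_ops_add scaleC_add_right)
  show "c *\<^sub>C A (d *\<^sub>C x) = d *\<^sub>C c *\<^sub>C A x"
    using A by (simp add: bounded_ops_scale scaleC_scaleC mult.commute)
  show "norm (c *\<^sub>C A x) \<le> norm x * (cmod c * onorm A)"
    using mult_left_mono[OF bounded_ops_norm_le[OF A, of x], of "cmod c"]
    by (simp add: norm_scaleC algebra_simps)
qed

lemma comp_bounded: "A \<in> bounded_ops \<Longrightarrow> B \<in> bounded_ops \<Longrightarrow> A \<circ> B \<in> bounded_ops"
  unfolding bounded_ops_def comp_def by (auto intro: bounded_linear_compose)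

section \<open>Coordinates in \<open>ell2\<close>\<close>

lemma ell2_eqI: "(\<And>i. coord x i = coord y i) \<Longrightarrow> x = y"
  by (simp add: coord_inject[symmetric] fun_eq_iff)

lemma coord_add: "coord (x + y) i = coord x i + coord y i"
  by transfer simp

lemma coord_scaleC: "coord (c *\<^sub>C x) i = c * coord x i"
  unfolding scaleC_ell2_def by transfer simp

lemma coord_delta: "coord (delta j) i = (if i = j then 1 else 0)"
  by transfer simp

lemma coord_sum: "coord (sum f A) i = (\<Sum>a\<in>A. coord (f a) i)"
  by (induction A rule: infinite_finite_induct) (simp_all add: coord_add coord_zero)

lemma cinner_ell2: "cinner x y = (\<Sum>\<^sub>\<infinity>i. coord x i * cnj (coord y i))"
  by (simp add: cinner_ell2_def ell2_inner.rep_eq)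

lemma coord_has_sum_cinner: "((\<lambda>i. coord x i * cnj (coord y i)) has_sum cinner x y) UNIV"
  unfolding cinner_ell2 by (intro has_sum_infsum ell2_mult_summable coord_summable)

text \<open>Finiteness is tested in the body because the lifting has to produce a square summable
  function for every set \<open>E\<close>.\<close>

lift_definition fvec :: "'a set \<Rightarrow> ('a \<Rightarrow> complex) \<Rightarrow> 'a ell2"
  is "\<lambda>E f i. if finite E \<and> i \<in> E then f i else 0"
proof -
  fix E :: "'a set" and f :: "'a \<Rightarrow> complex"
  show "(\<lambda>i. (cmod (if finite E \<and> i \<in> E then f i else 0))\<^sup>2) summable_on UNIV"
  proof (cases "finite E")
    case True
    then have "finite {i. (cmod (if finite E \<and> i \<in> E then f i else 0))\<^sup>2 \<noteq> 0}"
      by (rule rev_finite_subset) auto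
    then show ?thesis
      by (intro finite_nonzero_values_imp_summable_on) simp
  qed simp
qed

lemma coord_fvec: "finite E \<Longrightarrow> coord (fvec E f) i = (if i \<in> E then f i else 0)"
  by transfer simp

lemma cinner_fvec_left: "finite E \<Longrightarrow> cinner (fvec E f) y = (\<Sum>i\<in>E. f i * cnj (coord y i))"
proof -
  assume "finite E"
  then have "cinner (fvec E f) y = (\<Sum>\<^sub>\<infinity>i\<in>E. f i * cnj (coord y i))"
    unfolding cinner_ell2 by (intro infsum_cong_neutral) (auto simp: coord_fvec)
  with \<open>finite E\<close> show ?thesis
    by simp
qed

lemma cinner_fvec_right: "finite E \<Longrightarrow> cinner y (fvec E f) = (\<Sum>i\<in>E. coord y i * cnj (f i))"
  by (subst cinner_commute) (simp add: cinner_fvec_left mult.commute)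

lemma norm_fvec: "finite E \<Longrightarrow> norm (fvec E f) = L2_set (\<lambda>i. cmod (f i)) E"
proof -
  assume E: "finite E"
  have "complex_of_real ((norm (fvec E f))\<^sup>2) = complex_of_real (\<Sum>i\<in>E. (cmod (f i))\<^sup>2)"
    unfolding cinner_self[symmetric] cinner_fvec_left[OF E] of_real_sum
    by (intro sum.cong) (simp_all add: coord_fvec[OF E] complex_norm_square[symmetric])
  then have "(norm (fvec E f))\<^sup>2 = (\<Sum>i\<in>E. (cmod (f i))\<^sup>2)"
    using of_real_eq_iff by blast
  then show ?thesis
    unfolding L2_set_def by (metis norm_ge_zero real_sqrt_unique)
qed

lemma fvec_eq_sum: "finite E \<Longrightarrow> fvec E f = (\<Sum>i\<in>E. f i *\<^sub>C delta i)"
proof -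
  assume E: "finite E"
  have "coord (\<Sum>i\<in>E. f i *\<^sub>C delta i) j = (if j \<in> E then f j else 0)" for j
  proof -
    have "coord (\<Sum>i\<in>E. f i *\<^sub>C delta i) j = (\<Sum>i\<in>E. if j = i then f i else 0)"
      unfolding coord_sum coord_scaleC coord_delta by (intro sum.cong) auto
    with E show ?thesis
      by simp
  qed
  with E show ?thesis
    by (intro ell2_eqI) (simp add: coord_fvec)
qed

lemma delta_eq_fvec: "delta i = fvec {i} (\<lambda>_. 1)"
  by (simp add: fvec_eq_sum)

lemma norm_delta [simp]: "norm (delta i) = 1"
  by (simp add: delta_eq_fvec norm_fvec)

lemma cinner_delta_right [simp]: "cinner x (delta i) = coord x i"
  by (simp add: delta_eq_fvec cinner_fvec_right)

lemma cinner_delta_left: "cinner (delta i) x = cnj (coord x i)"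
  by (simp add: delta_eq_fvec cinner_fvec_left)

lemma L2_coord_le: "finite E \<Longrightarrow> L2_set (\<lambda>i. cmod (coord x i)) E \<le> norm x"
  unfolding L2_set_def by (rule real_le_lsqrt) (simp_all add: sum_coord_le)

text \<open>Pythagoras: truncation is an orthogonal projection, so the squared distance to
  \<open>x\<close> is the missing part of the sum of squares.\<close>

lemma fvec_coord_tendsto: "((\<lambda>E. fvec E (coord x)) \<longlongrightarrow> x) (finite_subsets_at_top UNIV)"
proof -
  let ?F = "finite_subsets_at_top UNIV" and ?s = "\<lambda>E. \<Sum>i\<in>E. (cmod (coord x i))\<^sup>2"
  have "(?s \<longlongrightarrow> (norm x)\<^sup>2) ?F"
    using has_sum_infsum[OF coord_summable[of x]] by (simp add: norm_ell2_sq has_sum_def)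
  then have lim: "((\<lambda>E. sqrt ((norm x)\<^sup>2 - ?s E)) \<longlongrightarrow> sqrt ((norm x)\<^sup>2 - (norm x)\<^sup>2)) ?F"
    by (rule tendsto_real_sqrt[OF tendsto_diff[OF tendsto_const]])
  have "sqrt ((norm x)\<^sup>2 - ?s E) = dist (fvec E (coord x)) x" if E: "finite E" for E
  proof -
    have sq: "?s E = (norm (fvec E (coord x)))\<^sup>2"
      by (simp add: norm_fvec[OF E] L2_set_def sum_nonneg)
    have "cinner (fvec E (coord x)) x = complex_of_real (?s E)"
      unfolding cinner_fvec_left[OF E] of_real_sum complex_norm_square ..
    then have "inner (fvec E (coord x)) x = ?s E"
      by (metis Re_cinner Re_complex_of_real)
    then have in1: "inner (fvec E (coord x)) x = (norm (fvec E (coord x)))\<^sup>2"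
      by (simp only: sq)
    have "(norm (fvec E (coord x) - x))\<^sup>2
        = (norm (fvec E (coord x)))\<^sup>2 - 2 * inner (fvec E (coord x)) x + (norm x)\<^sup>2"
      unfolding power2_norm_eq_inner inner_diff_left inner_diff_right inner_commute[of x "fvec E (coord x)"]
      by simp
    then have "(norm x)\<^sup>2 - ?s E = (norm (fvec E (coord x) - x))\<^sup>2"
      unfolding in1 sq by simp
    then show ?thesis
      by (simp add: dist_norm)
  qed
  then have "eventually (\<lambda>E. sqrt ((norm x)\<^sup>2 - ?s E) = dist (fvec E (coord x)) x) ?F"
    by (intro eventually_finite_subsets_at_top_weakI) simp
  from Lim_transform_eventually[OF lim this] show ?thesis
    by (subst tendsto_dist_iff) simp
qed

section \<open>Matrices of bounded operators\<close>

text \<open>The operator norm in finitary form: by \<open>mat_bound_of_op\<close> and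
  \<open>op_of_mat\<close> these are the matrices of the bounded operators of norm at most
  \<open>c\<close>.\<close>

definition mat_bound :: "('a \<Rightarrow> 'a \<Rightarrow> complex) \<Rightarrow> real \<Rightarrow> bool" where
  "mat_bound a c \<longleftrightarrow> (\<forall>E F \<xi>. finite E \<longrightarrow> finite F \<longrightarrow>
     L2_set (\<lambda>s. cmod (\<Sum>t\<in>F. a s t * \<xi> t)) E \<le> c * L2_set (\<lambda>t. cmod (\<xi> t)) F)"

lemma mat_boundD:
  "mat_bound a c \<Longrightarrow> finite E \<Longrightarrow> finite F \<Longrightarrow>
     L2_set (\<lambda>s. cmod (\<Sum>t\<in>F. a s t * \<xi> t)) E \<le> c * L2_set (\<lambda>t. cmod (\<xi> t)) F"
  by (simp add: mat_bound_def)

lemma mat_bound_entry_le: "mat_bound a c \<Longrightarrow> cmod (a s t) \<le> c"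
  using mat_boundD[of a c "{s}" "{t}" "\<lambda>_. 1"] by simp

lemma mat_bound_nonneg: "mat_bound a c \<Longrightarrow> 0 \<le> c"
  using mat_bound_entry_le norm_ge_zero order_trans by metis

lemma sum_mult_le_L2_set:
  "cmod (\<Sum>s\<in>E. f s * cnj (\<eta> s)) \<le> L2_set (\<lambda>s. cmod (f s)) E * L2_set (\<lambda>s. cmod (\<eta> s)) E"
proof -
  have "cmod (\<Sum>s\<in>E. f s * cnj (\<eta> s)) \<le> (\<Sum>s\<in>E. \<bar>cmod (f s)\<bar> * \<bar>cmod (\<eta> s)\<bar>)"
    by (rule order_trans[OF norm_sum]) (simp add: norm_mult)
  also have "\<dots> \<le> L2_set (\<lambda>s. cmod (f s)) E * L2_set (\<lambda>s. cmod (\<eta> s)) E"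
    by (rule L2_set_mult_ineq)
  finally show ?thesis .
qed

lemma mat_bound_bilinear:
  assumes "mat_bound a c" "finite E" "finite F"
  shows "cmod (\<Sum>s\<in>E. \<Sum>t\<in>F. a s t * \<xi> t * cnj (\<eta> s))
    \<le> c * L2_set (\<lambda>t. cmod (\<xi> t)) F * L2_set (\<lambda>s. cmod (\<eta> s)) E"
proof -
  have "cmod (\<Sum>s\<in>E. (\<Sum>t\<in>F. a s t * \<xi> t) * cnj (\<eta> s))
      \<le> L2_set (\<lambda>s. cmod (\<Sum>t\<in>F. a s t * \<xi> t)) E * L2_set (\<lambda>s. cmod (\<eta> s)) E"
    by (rule sum_mult_le_L2_set)
  also have "\<dots> \<le> c * L2_set (\<lambda>t. cmod (\<xi> t)) F * L2_set (\<lambda>s. cmod (\<eta> s)) E"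
    by (intro mult_right_mono mat_boundD assms L2_set_nonneg)
  finally show ?thesis
    by (simp add: sum_distrib_right)
qed

lemma L2_set_restrict:
  assumes "finite G" "E \<subseteq> G"
  shows "L2_set (\<lambda>t. cmod (if t \<in> E then f t else 0)) G = L2_set (\<lambda>t. cmod (f t)) E"
proof -
  have "(\<Sum>t\<in>G. (cmod (if t \<in> E then f t else 0))\<^sup>2) = (\<Sum>t\<in>E. (cmod (f t))\<^sup>2)"
    using assms by (intro sum.mono_neutral_cong_right) auto
  then show ?thesis
    by (simp add: L2_set_def)
qed

lemma le_of_square_le_mult:
  fixes x :: real
  assumes "x\<^sup>2 \<le> K * x" "0 \<le> K" "0 \<le> x"
  shows "x \<le> K"
  using assms by (cases "x = 0") (auto simp: power2_eq_square mult_le_cancel_right)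

text \<open>Taking for \<open>\<eta>\<close> the image of \<open>\<xi>\<close> gives the square of
  the norm to be estimated, and \<open>le_of_square_le_mult\<close> cancels one factor. Square
  sections suffice because both vectors can be padded with zeros to
  \<open>E \<union> F\<close>.\<close>

lemma mat_boundI_bilinear:
  assumes c: "0 \<le> c"
    and bound: "\<And>E \<xi> \<eta>. finite E \<Longrightarrow> cmod (\<Sum>s\<in>E. \<Sum>t\<in>E. a s t * \<xi> t * cnj (\<eta> s))
      \<le> c * L2_set (\<lambda>t. cmod (\<xi> t)) E * L2_set (\<lambda>s. cmod (\<eta> s)) E"
  shows "mat_bound a c"
  unfolding mat_bound_def
proof (intro allI impI)
  fix E F :: "'a set" and \<xi> :: "'a \<Rightarrow> complex"
  assume fin: "finite E" "finite F"
  define \<zeta> where "\<zeta> s = (\<Sum>t\<in>F. a s t * \<xi> t)" for s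
  let ?G = "E \<union> F"
  let ?\<xi> = "\<lambda>t. if t \<in> F then \<xi> t else 0" and ?\<eta> = "\<lambda>s. if s \<in> E then \<zeta> s else 0"
  have "(\<Sum>s\<in>?G. \<Sum>t\<in>?G. a s t * ?\<xi> t * cnj (?\<eta> s)) = (\<Sum>s\<in>E. \<Sum>t\<in>F. a s t * \<xi> t * cnj (\<zeta> s))"
    using fin by (intro sum.mono_neutral_cong_right) (auto intro!: sum.mono_neutral_cong_right)
  also have "\<dots> = (\<Sum>s\<in>E. \<zeta> s * cnj (\<zeta> s))"
    by (simp add: \<zeta>_def sum_distrib_right)
  also have "\<dots> = complex_of_real ((L2_set (\<lambda>s. cmod (\<zeta> s)) E)\<^sup>2)"
    by (simp add: L2_set_def sum_nonneg complex_norm_square del: of_real_power)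
  finally have "(L2_set (\<lambda>s. cmod (\<zeta> s)) E)\<^sup>2
      \<le> c * L2_set (\<lambda>t. cmod (?\<xi> t)) ?G * L2_set (\<lambda>s. cmod (?\<eta> s)) ?G"
    using bound[of ?G ?\<xi> ?\<eta>] fin by (simp add: norm_of_real abs_of_nonneg del: of_real_power)
  also have "\<dots> = c * L2_set (\<lambda>t. cmod (\<xi> t)) F * L2_set (\<lambda>s. cmod (\<zeta> s)) E"
    using fin by (subst (1 2) L2_set_restrict) auto
  finally show "L2_set (\<lambda>s. cmod (\<Sum>t\<in>F. a s t * \<xi> t)) E \<le> c * L2_set (\<lambda>t. cmod (\<xi> t)) F"
    unfolding \<zeta>_def by (rule le_of_square_le_mult) (simp_all add: c L2_set_nonneg)
qed

lemma entry_cinner_fvec: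
  assumes A: "A \<in> bounded_ops" and "finite E" "finite F"
  shows "cinner (A (fvec F \<xi>)) (fvec E \<eta>) = (\<Sum>s\<in>E. \<Sum>t\<in>F. entry A s t * \<xi> t * cnj (\<eta> s))"
  unfolding fvec_eq_sum[OF assms(2)] fvec_eq_sum[OF assms(3)] bounded_ops_sum[OF A]
    bounded_ops_scale[OF A] cinner_sum_left cinner_sum_right cinner_scaleC_left cinner_scaleC_right
    entry_def
  by (simp only: sum_distrib_left mult_ac complex_cnj_mult complex_cnj_cnj)

lemma entry_eq_coord: "entry A s t = coord (A (delta t)) s"
  by (simp add: entry_def)

text \<open>The limit runs over square sections because the double series need not converge
  absolutely. Truncating both vectors leaves one error for each argument.\<close>

lemma entry_cinner_tendsto:
  assumes A: "A \<in> bounded_ops"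
  shows "((\<lambda>E. \<Sum>s\<in>E. \<Sum>t\<in>E. entry A s t * coord \<xi> t * cnj (coord \<eta> s))
    \<longlongrightarrow> cinner (A \<xi>) \<eta>) (finite_subsets_at_top UNIV)"
proof -
  let ?v = "\<lambda>\<xi> E. fvec E (coord \<xi>)" and ?F = "finite_subsets_at_top UNIV"
  have "((\<lambda>E. A (?v \<xi> E)) \<longlongrightarrow> A \<xi>) ?F"
    using bounded_linear.tendsto[OF bounded_ops_linear[OF A] fvec_coord_tendsto] .
  then have "((\<lambda>E. norm (A (?v \<xi> E) - A \<xi>) * norm (?v \<eta> E) + norm (A \<xi>) * norm (?v \<eta> E - \<eta>))
      \<longlongrightarrow> norm (A \<xi> - A \<xi>) * norm \<eta> + norm (A \<xi>) * norm (\<eta> - \<eta>)) ?F"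
    by (intro tendsto_intros fvec_coord_tendsto)
  then have lim: "((\<lambda>E. norm (A (?v \<xi> E) - A \<xi>) * norm (?v \<eta> E) + norm (A \<xi>) * norm (?v \<eta> E - \<eta>))
      \<longlongrightarrow> 0) ?F"
    by simp
  have "cmod (cinner (A (?v \<xi> E)) (?v \<eta> E) - cinner (A \<xi>) \<eta>)
      \<le> norm (A (?v \<xi> E) - A \<xi>) * norm (?v \<eta> E) + norm (A \<xi>) * norm (?v \<eta> E - \<eta>)" for E
  proof -
    have "cinner (A (?v \<xi> E)) (?v \<eta> E) - cinner (A \<xi>) \<eta>
        = cinner (A (?v \<xi> E) - A \<xi>) (?v \<eta> E) + cinner (A \<xi>) (?v \<eta> E - \<eta>)"
      by (simp add: cinner_diff_left cinner_diff_right)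
    then show ?thesis
      by (simp only:) (intro norm_triangle_mono cinner_norm_le)
  qed
  then have "((\<lambda>E. cinner (A (?v \<xi> E)) (?v \<eta> E) - cinner (A \<xi>) \<eta>) \<longlongrightarrow> 0) ?F"
    by (intro Lim_null_comparison[OF _ lim] always_eventually allI)
  then have "((\<lambda>E. cinner (A (?v \<xi> E)) (?v \<eta> E)) \<longlongrightarrow> cinner (A \<xi>) \<eta>) ?F"
    by (simp only: Lim_null[symmetric])
  moreover have "eventually (\<lambda>E. cinner (A (?v \<xi> E)) (?v \<eta> E)
      = (\<Sum>s\<in>E. \<Sum>t\<in>E. entry A s t * coord \<xi> t * cnj (coord \<eta> s))) ?F"
    by (intro eventually_finite_subsets_at_top_weakI) (simp add: entry_cinner_fvec[OF A])
  ultimately show ?thesis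
    by (rule Lim_transform_eventually)
qed

lemma entry_inject:
  assumes "A \<in> bounded_ops" "B \<in> bounded_ops" "\<And>s t. entry A s t = entry B s t"
  shows "A = B"
proof
  fix \<xi>
  show "A \<xi> = B \<xi>"
  proof (rule cinner_extensionality)
    fix \<eta>
    show "cinner (A \<xi>) \<eta> = cinner (B \<xi>) \<eta>"
      using entry_cinner_tendsto[OF assms(1), of \<xi> \<eta>] entry_cinner_tendsto[OF assms(2), of \<xi> \<eta>]
      unfolding assms(3) by (rule tendsto_unique[rotated]) simp
  qed
qed

lemma mat_bound_of_op:
  assumes A: "A \<in> bounded_ops" and c: "onorm A \<le> c"
  shows "mat_bound (entry A) c"
proof (rule mat_boundI_bilinear)
  show "0 \<le> c"
    using bounded_ops_onorm_nonneg[OF A] c by simp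
  fix E :: "'a set" and \<xi> \<eta> :: "'a \<Rightarrow> complex"
  assume E: "finite E"
  have "cmod (cinner (A (fvec E \<xi>)) (fvec E \<eta>)) \<le> norm (A (fvec E \<xi>)) * norm (fvec E \<eta>)"
    by (rule cinner_norm_le)
  also have "\<dots> \<le> (c * norm (fvec E \<xi>)) * norm (fvec E \<eta>)"
    by (intro mult_right_mono order_trans[OF bounded_ops_norm_le[OF A]] c) auto
  finally show "cmod (\<Sum>s\<in>E. \<Sum>t\<in>E. entry A s t * \<xi> t * cnj (\<eta> s))
      \<le> c * L2_set (\<lambda>t. cmod (\<xi> t)) E * L2_set (\<lambda>s. cmod (\<eta> s)) E"
    by (simp add: entry_cinner_fvec[OF A E E] norm_fvec[OF E])
qed

lemma ell2I:
  fixes f :: "'a \<Rightarrow> complex"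
  assumes "\<And>E. finite E \<Longrightarrow> L2_set (\<lambda>i. cmod (f i)) E \<le> K"
  shows "\<exists>x. coord x = f \<and> norm x \<le> K"
proof -
  have K: "0 \<le> K"
    using assms[of "{}"] by simp
  have le: "(\<Sum>i\<in>E. (cmod (f i))\<^sup>2) \<le> K\<^sup>2" if "finite E" for E
    using power_mono[OF assms[OF that] L2_set_nonneg, of 2] by (simp add: L2_set_def sum_nonneg)
  have sm: "(\<lambda>i. (cmod (f i))\<^sup>2) summable_on UNIV"
    by (rule nonneg_bdd_above_summable_on) (auto intro!: bdd_aboveI[of _ "K\<^sup>2"] le)
  then have c: "coord (Abs_ell2 f) = f"
    by (simp add: Abs_ell2_inverse)
  have "(norm (Abs_ell2 f))\<^sup>2 \<le> K\<^sup>2"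
    unfolding norm_ell2_sq c by (rule infsum_le_finite_sums[OF sm]) (simp add: le)
  then have "norm (Abs_ell2 f) \<le> K"
    using K by (simp add: power2_le_iff_abs_le)
  with c show ?thesis
    by blast
qed

text \<open>Every row is square summable, so coordinate \<open>s\<close> of the image can be defined
  as an inner product with row \<open>s\<close>; the bounds on finite sets of coordinates pass to
  the limit.\<close>

lemma op_of_mat:
  fixes a :: "'a \<Rightarrow> 'a \<Rightarrow> complex"
  assumes a: "mat_bound a c"
  shows "\<exists>A\<in>bounded_ops. entry A = a \<and> onorm A \<le> c"
proof -
  \<comment> \<open>The row is applied to its own conjugate: the squared length of a finite piece is
    at most \<open>c\<close> times that length.\<close>
  have "\<exists>r. coord r = (\<lambda>t. cnj (a s t)) \<and> norm r \<le> c" for s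
  proof (rule ell2I)
    fix F :: "'a set" assume F: "finite F"
    let ?l = "L2_set (\<lambda>t. cmod (cnj (a s t))) F"
    have "complex_of_real (?l\<^sup>2) = (\<Sum>t\<in>F. a s t * cnj (a s t))"
      by (simp add: L2_set_def sum_nonneg complex_norm_square del: of_real_power complex_mod_cnj)
        (simp add: mult.commute)
    then have "?l\<^sup>2 = cmod (\<Sum>t\<in>F. a s t * cnj (a s t))"
      by (metis abs_of_nonneg norm_of_real zero_le_power2)
    also have "\<dots> \<le> c * ?l"
      using mat_boundD[OF a _ F, of "{s}" "\<lambda>t. cnj (a s t)"] by simp
    finally show "?l \<le> c"
      by (rule le_of_square_le_mult) (simp_all add: mat_bound_nonneg[OF a] L2_set_nonneg)
  qed
  then obtain r where r: "\<And>s t. coord (r s) t = cnj (a s t)"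
    by metis
  have row: "((\<lambda>F. \<Sum>t\<in>F. a s t * coord \<xi> t) \<longlongrightarrow> cinner \<xi> (r s)) (finite_subsets_at_top UNIV)" for \<xi> s
    using coord_has_sum_cinner[of \<xi> "r s"] by (simp add: has_sum_def r mult.commute)
  have "\<exists>\<zeta>. coord \<zeta> = (\<lambda>s. cinner \<xi> (r s)) \<and> norm \<zeta> \<le> c * norm \<xi>" for \<xi>
  proof (rule ell2I)
    fix E :: "'a set" assume E: "finite E"
    show "L2_set (\<lambda>s. cmod (cinner \<xi> (r s))) E \<le> c * norm \<xi>"
    proof (rule tendsto_upperbound)
      show "((\<lambda>F. L2_set (\<lambda>s. cmod (\<Sum>t\<in>F. a s t * coord \<xi> t)) E)
          \<longlongrightarrow> L2_set (\<lambda>s. cmod (cinner \<xi> (r s))) E) (finite_subsets_at_top UNIV)"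
        unfolding L2_set_def by (intro tendsto_intros row)
      show "\<forall>\<^sub>F F in finite_subsets_at_top UNIV.
          L2_set (\<lambda>s. cmod (\<Sum>t\<in>F. a s t * coord \<xi> t)) E \<le> c * norm \<xi>"
        by (intro eventually_finite_subsets_at_top_weakI order_trans[OF mat_boundD[OF a E]]
            mult_left_mono L2_coord_le mat_bound_nonneg[OF a])
    qed simp
  qed
  then obtain A where A: "\<And>\<xi> s. coord (A \<xi>) s = cinner \<xi> (r s)" "\<And>\<xi>. norm (A \<xi>) \<le> c * norm \<xi>"
    by metis
  have "A \<in> bounded_ops"
  proof (rule bounded_opsI)
    fix x y :: "'a ell2" and d
    show "A (x + y) = A x + A y" "A (d *\<^sub>C x) = d *\<^sub>C A x"
      by (rule ell2_eqI; simp add: A coord_add coord_scaleC cinner_add_left cinner_scaleC_left)+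
    show "norm (A x) \<le> norm x * c"
      using A(2)[of x] by (simp add: mult.commute)
  qed
  moreover have "entry A = a"
    by (simp add: fun_eq_iff entry_eq_coord A cinner_delta_left r)
  moreover have "onorm A \<le> c"
    by (rule onorm_bound) (simp_all add: A mat_bound_nonneg[OF a])
  ultimately show ?thesis
    by blast
qed

text \<open>\<open>adjoint\<close> refers to the real inner product. The conjugate transpose
  satisfies the complex identity, whose real part determines \<open>adjoint\<close>.\<close>

lemma adjoint_op:
  assumes A: "A \<in> bounded_ops"
  shows "adjoint A \<in> bounded_ops" "cinner (A x) y = cinner x (adjoint A y)"
    and "entry (adjoint A) s t = cnj (entry A t s)"
proof -
  have "mat_bound (\<lambda>s t. cnj (entry A t s)) (onorm A)"
  proof (rule mat_boundI_bilinear)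
    fix E :: "'a set" and \<xi> \<eta> :: "'a \<Rightarrow> complex"
    assume E: "finite E"
    have "(\<Sum>s\<in>E. \<Sum>t\<in>E. cnj (entry A t s) * \<xi> t * cnj (\<eta> s))
        = cnj (\<Sum>t\<in>E. \<Sum>s\<in>E. entry A t s * \<eta> s * cnj (\<xi> t))"
      by (subst sum.swap) (simp only: cnj_sum complex_cnj_mult complex_cnj_cnj mult_ac)
    then show "cmod (\<Sum>s\<in>E. \<Sum>t\<in>E. cnj (entry A t s) * \<xi> t * cnj (\<eta> s))
        \<le> onorm A * L2_set (\<lambda>t. cmod (\<xi> t)) E * L2_set (\<lambda>s. cmod (\<eta> s)) E"
      using mat_bound_bilinear[OF mat_bound_of_op[OF A order_refl] E E, of \<eta> \<xi>]
      by (simp only: complex_mod_cnj mult_ac)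
  qed (rule bounded_ops_onorm_nonneg[OF A])
  from op_of_mat[OF this] obtain B where B: "B \<in> bounded_ops" "entry B = (\<lambda>s t. cnj (entry A t s))"
    by blast
  have cin: "cinner (A x) y = cinner x (B y)" for x y
  proof (rule tendsto_unique)
    show "((\<lambda>E. \<Sum>s\<in>E. \<Sum>t\<in>E. entry A s t * coord x t * cnj (coord y s)) \<longlongrightarrow> cinner (A x) y)
        (finite_subsets_at_top UNIV)"
      by (rule entry_cinner_tendsto[OF A])
    have "((\<lambda>E. cnj (\<Sum>s\<in>E. \<Sum>t\<in>E. entry B s t * coord y t * cnj (coord x s))) \<longlongrightarrow> cnj (cinner (B y) x))
        (finite_subsets_at_top UNIV)"
      by (intro tendsto_intros entry_cinner_tendsto[OF B(1)])
    also have "(\<lambda>E. cnj (\<Sum>s\<in>E. \<Sum>t\<in>E. entry B s t * coord y t * cnj (coord x s)))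
        = (\<lambda>E. \<Sum>s\<in>E. \<Sum>t\<in>E. entry A s t * coord x t * cnj (coord y s))"
      by (rule ext, subst sum.swap) (simp only: B(2) cnj_sum complex_cnj_mult complex_cnj_cnj mult_ac)
    finally show "((\<lambda>E. \<Sum>s\<in>E. \<Sum>t\<in>E. entry A s t * coord x t * cnj (coord y s)) \<longlongrightarrow> cinner x (B y))
        (finite_subsets_at_top UNIV)"
      by (simp flip: cinner_commute)
  qed simp
  have "adjoint A = B"
    by (rule adjoint_unique) (simp add: Re_cinner[symmetric] cin)
  with B cin show "adjoint A \<in> bounded_ops" "cinner (A x) y = cinner x (adjoint A y)"
    "entry (adjoint A) s t = cnj (entry A t s)"
    by simp_all
qed

text \<open>The entry is an inner product of two square summable vectors, so the sum converges
  unconditionally and its terms may later be permuted.\<close>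

lemma entry_comp_has_sum:
  assumes A: "A \<in> bounded_ops" and B: "B \<in> bounded_ops"
  shows "((\<lambda>r. entry A s r * entry B r t) has_sum entry (A \<circ> B) s t) UNIV"
proof -
  have "entry (A \<circ> B) s t = cinner (B (delta t)) (adjoint A (delta s))"
    by (simp add: entry_def adjoint_op(2)[OF A] del: cinner_delta_right)
  moreover have "coord (adjoint A (delta s)) r = cnj (entry A s r)" for r
    using adjoint_op(3)[OF A, of r s] by (simp add: entry_eq_coord)
  ultimately show ?thesis
    using coord_has_sum_cinner[of "B (delta t)" "adjoint A (delta s)"]
    by (simp add: entry_eq_coord[of B] mult.commute)
qed

section \<open>Schur multipliers\<close>

definition schur_bound :: "('a \<Rightarrow> 'a \<Rightarrow> complex) \<Rightarrow> real \<Rightarrow> bool" where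
  "schur_bound m C \<longleftrightarrow> (\<forall>a. mat_bound a 1 \<longrightarrow> mat_bound (\<lambda>s t. m s t * a s t) C)"

section \<open>Operations on matrices and symbols that preserve the bounds\<close>

lemma mat_bound_scale:
  assumes "mat_bound a c" "cmod z \<le> r"
  shows "mat_bound (\<lambda>s t. z * a s t) (r * c)"
proof (rule mat_boundI_bilinear)
  have r: "0 \<le> r"
    using assms(2) norm_ge_zero order_trans by blast
  then show "0 \<le> r * c"
    using mat_bound_nonneg[OF assms(1)] by simp
  fix E :: "'a set" and \<xi> \<eta> :: "'a \<Rightarrow> complex"
  assume E: "finite E"
  have "(\<Sum>s\<in>E. \<Sum>t\<in>E. z * a s t * \<xi> t * cnj (\<eta> s)) = z * (\<Sum>s\<in>E. \<Sum>t\<in>E. a s t * \<xi> t * cnj (\<eta> s))"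
    by (simp only: sum_distrib_left mult.assoc)
  then show "cmod (\<Sum>s\<in>E. \<Sum>t\<in>E. z * a s t * \<xi> t * cnj (\<eta> s))
      \<le> r * c * L2_set (\<lambda>t. cmod (\<xi> t)) E * L2_set (\<lambda>s. cmod (\<eta> s)) E"
    using mult_mono[OF assms(2) mat_bound_bilinear[OF assms(1) E E, of \<xi> \<eta>] r norm_ge_zero]
    by (simp only: norm_mult mult.assoc)
qed

lemma mat_bound_add:
  assumes "mat_bound a c" "mat_bound b d"
  shows "mat_bound (\<lambda>s t. a s t + b s t) (c + d)"
proof (rule mat_boundI_bilinear)
  show "0 \<le> c + d"
    using assms[THEN mat_bound_nonneg] by simp
  fix E :: "'a set" and \<xi> \<eta> :: "'a \<Rightarrow> complex"
  assume E: "finite E"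
  have "(\<Sum>s\<in>E. \<Sum>t\<in>E. (a s t + b s t) * \<xi> t * cnj (\<eta> s))
      = (\<Sum>s\<in>E. \<Sum>t\<in>E. a s t * \<xi> t * cnj (\<eta> s)) + (\<Sum>s\<in>E. \<Sum>t\<in>E. b s t * \<xi> t * cnj (\<eta> s))"
    by (simp only: sum.distrib distrib_right)
  also have "cmod \<dots> \<le> c * L2_set (\<lambda>t. cmod (\<xi> t)) E * L2_set (\<lambda>s. cmod (\<eta> s)) E
      + d * L2_set (\<lambda>t. cmod (\<xi> t)) E * L2_set (\<lambda>s. cmod (\<eta> s)) E"
    by (intro norm_triangle_mono mat_bound_bilinear assms E)
  finally show "cmod (\<Sum>s\<in>E. \<Sum>t\<in>E. (a s t + b s t) * \<xi> t * cnj (\<eta> s))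
      \<le> (c + d) * L2_set (\<lambda>t. cmod (\<xi> t)) E * L2_set (\<lambda>s. cmod (\<eta> s)) E"
    by (simp only: distrib_right)
qed

lemma mat_bound_cnj:
  assumes "mat_bound a c"
  shows "mat_bound (\<lambda>s t. cnj (a s t)) c"
  unfolding mat_bound_def
proof (intro allI impI)
  fix E F :: "'a set" and \<xi> :: "'a \<Rightarrow> complex"
  assume "finite E" "finite F"
  from mat_boundD[OF assms this, of "\<lambda>t. cnj (\<xi> t)"]
  have "L2_set (\<lambda>s. cmod (cnj (\<Sum>t\<in>F. a s t * cnj (\<xi> t)))) E \<le> c * L2_set (\<lambda>t. cmod (\<xi> t)) F"
    by (simp only: complex_mod_cnj)
  then show "L2_set (\<lambda>s. cmod (\<Sum>t\<in>F. cnj (a s t) * \<xi> t)) E \<le> c * L2_set (\<lambda>t. cmod (\<xi> t)) F"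
    by (simp only: cnj_sum complex_cnj_mult complex_cnj_cnj)
qed

lemma mat_bound_reindex:
  assumes "mat_bound a c" and f: "\<And>s. f (f s) = s"
  shows "mat_bound (\<lambda>s t. a (f s) (f t)) c"
  unfolding mat_bound_def
proof (intro allI impI)
  fix E F :: "'a set" and \<xi> :: "'a \<Rightarrow> complex"
  assume "finite E" "finite F"
  then have "finite (f ` E)" "finite (f ` F)"
    by simp_all
  from mat_boundD[OF assms(1) this, of "\<lambda>t. \<xi> (f t)"]
  have "L2_set (\<lambda>s. cmod (\<Sum>t\<in>f ` F. a s t * \<xi> (f t))) (f ` E) \<le> c * L2_set (\<lambda>t. cmod (\<xi> (f t))) (f ` F)" .
  moreover have inj: "inj_on f A" for A
    by (rule inj_on_inverseI[of _ f]) (rule f)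
  ultimately show "L2_set (\<lambda>s. cmod (\<Sum>t\<in>F. a (f s) (f t) * \<xi> t)) E \<le> c * L2_set (\<lambda>t. cmod (\<xi> t)) F"
    by (simp only: L2_set_def sum.reindex[OF inj] o_def f)
qed

lemma schur_bound_nonneg: "schur_bound m C \<Longrightarrow> 0 \<le> C"
proof -
  have "mat_bound (\<lambda>_ _. 0 :: complex) 1"
    by (simp add: mat_bound_def L2_set_nonneg L2_set_0')
  then show "schur_bound m C \<Longrightarrow> 0 \<le> C"
    unfolding schur_bound_def using mat_bound_nonneg by blast
qed

lemma schur_boundD:
  assumes m: "schur_bound m C" and a: "mat_bound a c"
  shows "mat_bound (\<lambda>s t. m s t * a s t) (C * c)"
proof (cases "c = 0")
  case True
  then have "a s t = 0" for s t
    using mat_bound_entry_le[OF a, of s t] by simp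
  then show ?thesis
    by (simp add: True mat_bound_def L2_set_def)
next
  case False
  then have c: "c > 0"
    using mat_bound_nonneg[OF a] by simp
  have "mat_bound (\<lambda>s t. complex_of_real (1 / c) * a s t) (1 / c * c)"
    using c by (intro mat_bound_scale[OF a]) (simp add: norm_divide)
  then have "mat_bound (\<lambda>s t. m s t * (complex_of_real (1 / c) * a s t)) C"
    using m c unfolding schur_bound_def by (elim allE[of _ "\<lambda>s t. complex_of_real (1 / c) * a s t"]) simp
  then have "mat_bound (\<lambda>s t. complex_of_real c * (m s t * (complex_of_real (1 / c) * a s t))) (c * C)"
    using c by (intro mat_bound_scale) simp_all
  then show ?thesis
    using c by (simp add: mult_ac)
qed

text \<open>The real part is the mean of \<open>m\<close> and its conjugate. Multiplying by the
  conjugate symbol amounts to conjugating the matrix, multiplying by \<open>m\<close> and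
  conjugating again, which has the same bound.\<close>

lemma schur_bound_Re:
  assumes m: "schur_bound m C"
  shows "schur_bound (\<lambda>s t. complex_of_real (Re (m s t))) C"
  unfolding schur_bound_def
proof (intro allI impI)
  fix a :: "'a \<Rightarrow> 'a \<Rightarrow> complex"
  assume a: "mat_bound a 1"
  have "mat_bound (\<lambda>s t. cnj (m s t * cnj (a s t))) C"
    using mat_bound_cnj[of "\<lambda>s t. m s t * cnj (a s t)" C] m mat_bound_cnj[OF a]
    by (simp only: schur_bound_def)
  then have "mat_bound (\<lambda>s t. (1/2) * (m s t * a s t) + (1/2) * cnj (m s t * cnj (a s t)))
      (1/2 * C + 1/2 * C)"
    using m a by (intro mat_bound_add mat_bound_scale) (simp_all add: schur_bound_def)
  moreover have "(1/2) * (m s t * a s t) + (1/2) * cnj (m s t * cnj (a s t))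
      = complex_of_real (Re (m s t)) * a s t" for s t
    by (simp add: complex_eq_iff field_simps)
  ultimately show "mat_bound (\<lambda>s t. complex_of_real (Re (m s t)) * a s t) C"
    by simp
qed

text \<open>An involution of the index set acts as a unitary permutation of the basis. It will be
  applied to inversion in the group.\<close>

lemma schur_bound_reindex:
  assumes m: "schur_bound m C" and f: "\<And>s. f (f s) = s"
  shows "schur_bound (\<lambda>s t. m (f s) (f t)) C"
  unfolding schur_bound_def
proof (intro allI impI)
  fix a :: "'a \<Rightarrow> 'a \<Rightarrow> complex"
  assume a: "mat_bound a 1"
  have "mat_bound (\<lambda>s t. m s t * a (f s) (f t)) C"
    using m mat_bound_reindex[OF a f] by (simp add: schur_bound_def)
  from mat_bound_reindex[OF this f] show "mat_bound (\<lambda>s t. m (f s) (f t) * a s t) C"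
    by (simp add: f)
qed

text \<open>Symbols live on pairs here because those used on L(\<Gamma>) depend on
  \<open>t - s\<close>, which \<open>schur_map\<close> does not cover in general. The description is
  unique by \<open>entry_inject\<close>.\<close>

definition schur_op :: "('a \<Rightarrow> 'a \<Rightarrow> complex) \<Rightarrow> 'a ell2 oper \<Rightarrow> 'a ell2 oper" where
  "schur_op m A = (THE B. B \<in> bounded_ops \<and> (\<forall>s t. entry B s t = m s t * entry A s t))"

lemma schur_op_eqI:
  assumes "B \<in> bounded_ops" "\<And>s t. entry B s t = m s t * entry A s t"
  shows "schur_op m A = B"
  unfolding schur_op_def
  by (rule the_equality) (auto intro!: entry_inject simp: assms)

lemma schur_op:
  assumes "schur_bound m C" "A \<in> bounded_ops"
  shows "schur_op m A \<in> bounded_ops" "entry (schur_op m A) s t = m s t * entry A s t"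
    "onorm (schur_op m A) \<le> C * onorm A"
proof -
  have "mat_bound (\<lambda>s t. m s t * entry A s t) (C * onorm A)"
    by (intro schur_boundD assms mat_bound_of_op order_refl)
  from op_of_mat[OF this] obtain B where B: "B \<in> bounded_ops"
      "entry B = (\<lambda>s t. m s t * entry A s t)" "onorm B \<le> C * onorm A"
    by blast
  moreover from B have "schur_op m A = B"
    by (intro schur_op_eqI) simp_all
  ultimately show "schur_op m A \<in> bounded_ops" "entry (schur_op m A) s t = m s t * entry A s t"
    "onorm (schur_op m A) \<le> C * onorm A"
    by simp_all
qed

section \<open>Herz-Schur norms as bounds on finite sections\<close>

lemma schur_map_eq: "schur_map u = schur_op (\<lambda>x y. u (- y + x))"
  by (simp add: fun_eq_iff schur_map_def schur_op_def multiplier_rel_def)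

lemma herz_schur_iff:
  "u \<in> herz_schur \<and> herz_schur_norm u \<le> ereal C \<longleftrightarrow> schur_bound (\<lambda>x y. u (- y + x)) C"
proof (intro iffI conjI)
  assume u: "u \<in> herz_schur \<and> herz_schur_norm u \<le> ereal C"
  show "schur_bound (\<lambda>x y. u (- y + x)) C"
    unfolding schur_bound_def
  proof (intro allI impI)
    fix a :: "'a \<Rightarrow> 'a \<Rightarrow> complex"
    assume "mat_bound a 1"
    from op_of_mat[OF this] obtain A where A: "A \<in> bounded_ops" "entry A = a" "onorm A \<le> 1"
      by blast
    with u obtain B where B: "B \<in> bounded_ops" "\<And>x y. entry B x y = u (- y + x) * entry A x y"
      unfolding herz_schur_def multiplier_rel_def by blast
    then have "schur_map u A = B"
      unfolding schur_map_eq by (rule schur_op_eqI)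
    moreover have "ereal (onorm (schur_map u A)) \<le> herz_schur_norm u"
      unfolding herz_schur_norm_def using A by (intro SUP_upper) simp
    ultimately have "onorm B \<le> C"
      using u by (metis ereal_less_eq(3) order_trans)
    from mat_bound_of_op[OF B(1) this] show "mat_bound (\<lambda>x y. u (- y + x) * a x y) C"
      using B(2) A(2) by (metis (no_types, lifting) ext)
  qed
next
  assume m: "schur_bound (\<lambda>x y. u (- y + x)) C"
  show "u \<in> herz_schur"
    unfolding herz_schur_def multiplier_rel_def using schur_op(1,2)[OF m] by blast
  show "herz_schur_norm u \<le> ereal C"
    unfolding herz_schur_norm_def
  proof (rule SUP_least)
    fix A :: "'a ell2 oper"
    assume "A \<in> {A \<in> bounded_ops. onorm A \<le> 1}"
    then have A: "A \<in> bounded_ops" "onorm A \<le> 1"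
      by simp_all
    have "onorm (schur_map u A) \<le> C * onorm A"
      unfolding schur_map_eq by (rule schur_op(3)[OF m A(1)])
    also have "\<dots> \<le> C"
      using mult_left_mono[OF A(2) schur_bound_nonneg[OF m]] by simp
    finally show "ereal (onorm (schur_map u A)) \<le> ereal C"
      by simp
  qed
qed

section \<open>The commutation theorem\<close>

text \<open>Rules for words in a group that need not be commutative: differences become sums with
  inverses, brackets move to the right and neighbouring inverses cancel.\<close>

lemmas group_cancel_simps = diff_conv_add_uminus minus_add minus_minus add.assoc minus_add_cancel
  add_minus_cancel left_minus right_minus add_0_left add_0_right

lemma commutant_triple:
  assumes "S \<subseteq> bounded_ops"
  shows "commutant (commutant (commutant S)) = commutant S"
proof
  have "S \<subseteq> commutant (commutant S)"
    using assms unfolding commutant_def by auto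
  then show "commutant (commutant (commutant S)) \<subseteq> commutant S"
    unfolding commutant_def by blast
  show "commutant S \<subseteq> commutant (commutant (commutant S))"
    unfolding commutant_def by auto
qed

section \<open>Translation operators and the left regular representation\<close>

lemma reindex_op:
  fixes f :: "'a \<Rightarrow> 'a"
  assumes "inj f"
  shows "\<exists>R\<in>bounded_ops. \<forall>x s. coord (R x) s = coord x (f s)"
proof -
  have "\<exists>y. coord y = (\<lambda>s. coord x (f s)) \<and> norm y \<le> norm x" for x
  proof (rule ell2I)
    fix E :: "'a set" assume "finite E"
    then have "L2_set (\<lambda>i. cmod (coord x i)) (f ` E) \<le> norm x"
      by (intro L2_coord_le) simp
    then show "L2_set (\<lambda>i. cmod (coord x (f i))) E \<le> norm x"
      by (simp add: L2_set_def sum.reindex[OF inj_on_subset[OF assms subset_UNIV]])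
  qed
  then obtain R where R: "\<And>x s. coord (R x) s = coord x (f s)" "\<And>x. norm (R x) \<le> norm x"
    by metis
  have "R \<in> bounded_ops"
    by (rule bounded_opsI[where K = 1]) (auto intro!: ell2_eqI simp: R coord_add coord_scaleC)
  with R(1) show ?thesis
    by blast
qed

lemma coord_left_regular: "coord (left_regular g x) s = coord x (- g + s)"
  by transfer simp

lemma left_regular_bounded: "left_regular g \<in> bounded_ops"
proof -
  have "inj (\<lambda>s. - g + s)"
    by (rule injI) simp
  from reindex_op[OF this] obtain R where R: "R \<in> bounded_ops" "\<And>x s. coord (R x) s = coord x (- g + s)"
    by blast
  then have "left_regular g = R"
    by (intro ext ell2_eqI) (simp add: coord_left_regular)
  with R(1) show ?thesis
    by simp
qed

lemma left_regular_delta: "left_regular g (delta t) = delta (g + t)"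
  by (rule ell2_eqI) (auto simp: coord_left_regular coord_delta simp flip: add.assoc)

lemma entry_left_regular: "entry (left_regular g) s t = (if s = g + t then 1 else 0)"
  by (simp add: entry_eq_coord left_regular_delta coord_delta)

lemma left_regular_add: "left_regular (g + h) x = left_regular g (left_regular h x)"
  by (rule ell2_eqI) (simp only: coord_left_regular group_cancel_simps)

lemma norm_left_regular: "norm (left_regular g x) = norm x"
proof -
  have "bij (\<lambda>s. - g + s)"
    by (rule o_bij[of "\<lambda>s. g + s"]) (auto simp: fun_eq_iff simp flip: add.assoc)
  then have "(norm (left_regular g x))\<^sup>2 = (norm x)\<^sup>2"
    unfolding norm_ell2_sq coord_left_regular
    using infsum_reindex_bij_betw[of "\<lambda>s. - g + s" UNIV UNIV "\<lambda>i. (cmod (coord x i))\<^sup>2"] by simp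
  then show ?thesis
    by simp
qed

text \<open>The image of the right regular representation, described through coordinates so that the
  definition does not have to construct the operators.\<close>

definition right_shifts :: "'g::group_add ell2 oper set" where
  "right_shifts = {R \<in> bounded_ops. \<exists>r. \<forall>x s. coord (R x) s = coord x (s + r)}"

definition right_invariant :: "'g::group_add ell2 oper set" where
  "right_invariant = {x \<in> bounded_ops. \<forall>s t r. entry x (s + r) (t + r) = entry x s t}"

text \<open>Exhibiting the set as a commutant makes it its own double commutant, by
  \<open>commutant_triple\<close>.\<close>

lemma right_invariant_eq: "(right_invariant :: 'g::group_add ell2 oper set) = commutant right_shifts"
proof -
  have comm: "R \<circ> x = x \<circ> R \<longleftrightarrow> (\<forall>s t. entry x (s + r) (t + r) = entry x s t)"
    if x: "x \<in> bounded_ops" and R: "R \<in> bounded_ops" "\<And>x s. coord (R x) s = coord x (s + r)"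
    for x R :: "'g ell2 oper" and r
  proof -
    have "R (delta (t + r)) = delta t" for t
      by (rule ell2_eqI) (simp add: R(2) coord_delta)
    then have e: "entry (x \<circ> R) s (t + r) = entry x s t" "entry (R \<circ> x) s t = entry x (s + r) t" for s t
      by (simp_all add: entry_eq_coord R(2))
    show ?thesis
    proof
      assume "R \<circ> x = x \<circ> R"
      then show "\<forall>s t. entry x (s + r) (t + r) = entry x s t"
        using e by metis
    next
      assume *: "\<forall>s t. entry x (s + r) (t + r) = entry x s t"
      show "R \<circ> x = x \<circ> R"
      proof (rule entry_inject)
        fix s t
        show "entry (R \<circ> x) s t = entry (x \<circ> R) s t"
          using e(1)[of s "t - r"] * e(2)[of s t] by (metis diff_add_cancel)
      qed (intro comp_bounded x R)+
    qed
  qed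
  have ex: "\<exists>R\<in>bounded_ops. \<forall>x s. coord (R x) s = coord x (s + r)" for r :: 'g
    by (rule reindex_op) (auto intro: injI)
  show ?thesis
  proof (intro equalityI subsetI)
    fix x :: "'g ell2 oper"
    assume "x \<in> right_invariant"
    then show "x \<in> commutant right_shifts"
      unfolding right_invariant_def commutant_def right_shifts_def using comm by blast
  next
    fix x :: "'g ell2 oper"
    assume x: "x \<in> commutant right_shifts"
    then have "x \<in> bounded_ops"
      by (simp add: commutant_def)
    moreover have "\<forall>s t. entry x (s + r) (t + r) = entry x s t" for r
    proof -
      obtain R where R: "R \<in> bounded_ops" "\<forall>x s. coord (R x) s = coord x (s + r)"
        using ex by blast
      then have "R \<circ> x = x \<circ> R"
        using x unfolding commutant_def right_shifts_def by blast
      with comm[OF \<open>x \<in> bounded_ops\<close> R(1)] R(2) show ?thesis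
        by blast
    qed
    ultimately show "x \<in> right_invariant"
      unfolding right_invariant_def by blast
  qed
qed

lemma right_invariant_bounded: "x \<in> right_invariant \<Longrightarrow> x \<in> bounded_ops"
  by (simp add: right_invariant_def)

lemma von_neumann_algebra_right_invariant: "von_neumann_algebra right_invariant"
  unfolding von_neumann_algebra_def
proof (intro conjI ballI)
  show "commutant (commutant right_invariant) = right_invariant"
    unfolding right_invariant_eq by (rule commutant_triple) (auto simp: right_shifts_def)
  fix x :: "'a ell2 oper"
  assume "x \<in> right_invariant"
  then show "adjoint x \<in> right_invariant"
    unfolding right_invariant_def by (simp add: adjoint_op)
qed (auto simp: right_invariant_def)

lemma left_regular_right_invariant: "left_regular g \<in> right_invariant"
  by (simp add: right_invariant_def left_regular_bounded entry_left_regular flip: add.assoc)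

text \<open>The matrix of \<open>x\<close> is invariant under right translations and that of
  \<open>y\<close> under left translations, so the two act as convolutions from opposite sides. The
  two products differ only by a permutation of the summands.\<close>

lemma right_invariant_commute:
  fixes x y :: "'g::group_add ell2 oper"
  assumes x: "x \<in> right_invariant" and y: "y \<in> commutant (range left_regular)"
  shows "x \<circ> y = y \<circ> x"
proof (rule entry_inject)
  have b: "x \<in> bounded_ops" "y \<in> bounded_ops"
    using x y by (simp_all add: right_invariant_def commutant_def)
  then show "x \<circ> y \<in> bounded_ops" "y \<circ> x \<in> bounded_ops"
    by (auto intro: comp_bounded)
  have y_inv: "entry y (g + s) (g + t) = entry y s t" for g s t
  proof -
    have "left_regular g \<circ> y = y \<circ> left_regular g"
      using y by (simp add: commutant_def)
    then have "entry (left_regular g \<circ> y) (g + s) t = entry (y \<circ> left_regular g) (g + s) t"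
      by simp
    then show ?thesis
      by (simp add: entry_eq_coord coord_left_regular left_regular_delta flip: add.assoc)
  qed
  have x_inv: "entry x (s + r) (t + r) = entry x s t" for s t r
    using x by (simp add: right_invariant_def)
  fix s t :: 'g
  \<comment> \<open>Substituting \<open>r = t - q + s\<close> in the sum for
    \<open>x \<circ> y\<close> gives the one for \<open>y \<circ> x\<close>: invariance turns
    \<open>entry x s r\<close> into \<open>entry x q t\<close> and \<open>entry y r t\<close> into
    \<open>entry y s q\<close>.\<close>
  have bij: "bij (\<lambda>q. t - q + s)"
    by (rule o_bij[of "\<lambda>r. s - r + t"])
      (simp_all only: fun_eq_iff o_def id_def group_cancel_simps simp_thms)
  have terms: "entry x s (t - q + s) * entry y (t - q + s) t = entry y s q * entry x q t" for q
  proof -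
    have "entry x s (t - q + s) = entry x q t"
      using x_inv[of s "- s + q" "t - q + s"]
      by (simp only: group_cancel_simps)
    moreover have "entry y (t - q + s) t = entry y s q"
      using y_inv[of "q - t" "t - q + s" t]
      by (simp only: group_cancel_simps)
    ultimately show ?thesis
      by simp
  qed
  have "((\<lambda>q. entry x s (t - q + s) * entry y (t - q + s) t) has_sum entry (x \<circ> y) s t) UNIV"
    using has_sum_reindex_bij_betw[of "\<lambda>q. t - q + s" UNIV UNIV "\<lambda>r. entry x s r * entry y r t"]
      bij entry_comp_has_sum[OF b, of s t] by simp
  then show "entry (x \<circ> y) s t = entry (y \<circ> x) s t"
    unfolding terms using entry_comp_has_sum[OF b(2,1), of s t] by (rule has_sum_unique)
qed

text \<open>If \<open>M\<close> contains the left translations, its commutant lies in theirs. Right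
  invariant operators commute with the latter, hence belong to the double commutant of
  \<open>M\<close>.\<close>

lemma group_vna_eq: "(group_vna :: 'g::group_add ell2 oper set) = right_invariant"
proof
  show "(group_vna :: 'g ell2 oper set) \<subseteq> right_invariant"
    unfolding group_vna_def generated_vna_def
    using von_neumann_algebra_right_invariant left_regular_right_invariant by blast
  show "right_invariant \<subseteq> (group_vna :: 'g ell2 oper set)"
    unfolding group_vna_def generated_vna_def
  proof (intro Inter_greatest)
    fix M :: "'g ell2 oper set"
    assume "M \<in> {M. von_neumann_algebra M \<and> range left_regular \<subseteq> M}"
    then have M: "commutant (commutant M) = M" "range left_regular \<subseteq> M"
      by (simp_all add: von_neumann_algebra_def)
    then have "commutant M \<subseteq> commutant (range left_regular)"
      unfolding commutant_def by blast
    then have "right_invariant \<subseteq> commutant (commutant M)"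
      using right_invariant_commute unfolding commutant_def[of "commutant M"]
      by (fastforce dest: right_invariant_bounded)
    with M(1) show "right_invariant \<subseteq> M"
      by simp
  qed
qed

section \<open>Ultraweakly continuous functionals\<close>

lemma convex_separation:
  fixes K :: "'b::real_inner set"
  assumes "convex K" "bounded K" "K \<noteq> {}" and \<epsilon>: "0 < \<epsilon>"
    and far: "\<And>p. p \<in> K \<Longrightarrow> \<epsilon> \<le> norm (z - p)"
  shows "\<exists>w b. (\<forall>q\<in>K. inner q w \<le> b) \<and> b < inner z w"
proof -
  obtain D where D: "D > 0" "\<And>p. p \<in> K \<Longrightarrow> norm p \<le> D"
    using \<open>bounded K\<close> by (auto simp: bounded_pos)
  \<comment> \<open>\<open>K\<close> need not be closed, so a nearest point may not exist; a point
    \<open>p\<close> whose squared distance exceeds the infimum \<open>d\<close> by less than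
    \<open>\<eta>\<close> takes its place. The choice of \<open>\<theta>\<close> makes the quadratic
    term of a move from \<open>p\<close> towards \<open>q\<close> at most
    \<open>\<theta> * \<epsilon>\<^sup>2\<close>, and \<open>\<eta>\<close> adds half of this.
    Dividing by \<open>2 * \<theta>\<close> gives
    \<open>inner (q - p) w \<le> 3 / 4 * \<epsilon>\<^sup>2\<close>, which is less than
    \<open>inner (z - p) w\<close>.\<close>
  define d where "d = (INF p\<in>K. (norm (z - p))\<^sup>2)"
  define \<theta> where "\<theta> = min 1 (\<epsilon>\<^sup>2 / (2 * D)\<^sup>2)"
  define \<eta> where "\<eta> = \<theta> * \<epsilon>\<^sup>2 / 2"
  have \<theta>: "0 < \<theta>" "\<theta> \<le> 1" "\<theta> * (2 * D)\<^sup>2 \<le> \<epsilon>\<^sup>2"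
    using \<epsilon> D(1) by (auto simp: \<theta>_def min_def field_simps)
  have \<eta>: "0 < \<eta>"
    using \<theta> \<epsilon> by (simp add: \<eta>_def)
  have bdd: "bdd_below ((\<lambda>p. (norm (z - p))\<^sup>2) ` K)"
    by (rule bdd_belowI[of _ 0]) auto
  have "(INF p\<in>K. (norm (z - p))\<^sup>2) < d + \<eta>"
    using \<eta> by (simp add: d_def)
  then obtain p where p: "p \<in> K" "(norm (z - p))\<^sup>2 < d + \<eta>"
    using bdd \<open>K \<noteq> {}\<close> by (subst (asm) cINF_less_iff) auto
  define w where "w = z - p"
  have "inner q w \<le> inner p w + 3 / 4 * \<epsilon>\<^sup>2" if q: "q \<in> K" for q
  proof -
    have "p + \<theta> *\<^sub>R (q - p) = (1 - \<theta>) *\<^sub>R p + \<theta> *\<^sub>R q"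
      by (simp add: algebra_simps)
    then have "p + \<theta> *\<^sub>R (q - p) \<in> K"
      using \<open>convex K\<close> p(1) q \<theta> by (simp add: convex_alt)
    then have "d \<le> (norm (z - (p + \<theta> *\<^sub>R (q - p))))\<^sup>2"
      unfolding d_def by (intro cINF_lower bdd)
    also have "z - (p + \<theta> *\<^sub>R (q - p)) = w - \<theta> *\<^sub>R (q - p)"
      by (simp add: w_def)
    also have "(norm (w - \<theta> *\<^sub>R (q - p)))\<^sup>2
        = (norm w)\<^sup>2 - 2 * \<theta> * inner (q - p) w + \<theta>\<^sup>2 * (norm (q - p))\<^sup>2"
      unfolding power2_norm_eq_inner
      by (simp add: inner_diff_left inner_diff_right inner_commute algebra_simps power2_eq_square)
    finally have "2 * \<theta> * inner (q - p) w \<le> \<eta> + \<theta>\<^sup>2 * (norm (q - p))\<^sup>2"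
      using p(2) by (simp add: w_def)
    also have "\<theta>\<^sup>2 * (norm (q - p))\<^sup>2 \<le> \<theta>\<^sup>2 * (2 * D)\<^sup>2"
      using norm_triangle_ineq4[of q p] D(2)[OF p(1)] D(2)[OF q]
      by (intro mult_left_mono power_mono) auto
    also have "\<theta>\<^sup>2 * (2 * D)\<^sup>2 = \<theta> * (\<theta> * (2 * D)\<^sup>2)"
      by (simp add: power2_eq_square)
    also have "\<dots> \<le> \<theta> * \<epsilon>\<^sup>2"
      using \<theta> by (intro mult_left_mono) auto
    also have "\<eta> + \<theta> * \<epsilon>\<^sup>2 = \<theta> * (3 / 2 * \<epsilon>\<^sup>2)"
      by (simp add: \<eta>_def)
    finally have "\<theta> * (2 * inner (q - p) w) \<le> \<theta> * (3 / 2 * \<epsilon>\<^sup>2)"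
      by (simp add: mult_ac)
    then have "2 * inner (q - p) w \<le> 3 / 2 * \<epsilon>\<^sup>2"
      using \<theta>(1) by simp
    then show ?thesis
      by (simp add: inner_diff_left)
  qed
  moreover have "inner p w + 3 / 4 * \<epsilon>\<^sup>2 < inner z w"
  proof -
    have "\<epsilon>\<^sup>2 \<le> (norm w)\<^sup>2"
      using far[OF p(1)] \<epsilon> unfolding w_def by (intro power_mono) auto
    also have "(norm w)\<^sup>2 = inner z w - inner p w"
      by (simp add: power2_norm_eq_inner w_def inner_diff_left)
    finally have "\<epsilon>\<^sup>2 \<le> inner z w - inner p w" .
    moreover have "0 < \<epsilon>\<^sup>2"
      using \<epsilon> by simp
    ultimately show ?thesis
      by linarith
  qed
  ultimately show ?thesis
    by blast
qed

text \<open>By homogeneity both vectors may be normalized, and a phase put into \<open>x\<close>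
  makes the sum real and nonnegative.\<close>

lemma bilinear_bound_of_unit:
  fixes a :: "'a \<Rightarrow> 'a \<Rightarrow> complex"
  assumes E: "finite E" and b: "0 \<le> b"
    and unit: "\<And>x y. L2_set (\<lambda>t. cmod (x t)) E \<le> 1 \<Longrightarrow> L2_set (\<lambda>t. cmod (y t)) E \<le> 1 \<Longrightarrow>
      Re (\<Sum>s\<in>E. \<Sum>t\<in>E. a s t * x t * cnj (y s)) \<le> b"
  shows "cmod (\<Sum>s\<in>E. \<Sum>t\<in>E. a s t * \<xi> t * cnj (\<eta> s))
    \<le> b * L2_set (\<lambda>t. cmod (\<xi> t)) E * L2_set (\<lambda>t. cmod (\<eta> t)) E"
proof -
  let ?S = "\<Sum>s\<in>E. \<Sum>t\<in>E. a s t * \<xi> t * cnj (\<eta> s)"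
  let ?X = "L2_set (\<lambda>t. cmod (\<xi> t)) E" and ?Y = "L2_set (\<lambda>t. cmod (\<eta> t)) E"
  show ?thesis
  proof (cases "?S = 0")
    case True
    then show ?thesis
      using b by (simp add: L2_set_nonneg)
  next
    case False
    have "?X \<noteq> 0"
    proof
      assume "?X = 0"
      then have "\<xi> t = 0" if "t \<in> E" for t
        using that E by (simp add: L2_set_eq_0_iff)
      then have "?S = 0"
        by simp
      with False show False ..
    qed
    moreover have "?Y \<noteq> 0"
    proof
      assume "?Y = 0"
      then have "\<eta> t = 0" if "t \<in> E" for t
        using that E by (simp add: L2_set_eq_0_iff)
      then have "?S = 0"
        by simp
      with False show False ..
    qed
    ultimately have XY: "?X > 0" "?Y > 0"
      using L2_set_nonneg[of "\<lambda>t. cmod (\<xi> t)" E] L2_set_nonneg[of "\<lambda>t. cmod (\<eta> t)" E] by linarith+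
    have sc: "L2_set (\<lambda>t. cmod (z * f t)) E = cmod z * L2_set (\<lambda>t. cmod (f t)) E" for z f
      using L2_set_right_distrib[of "cmod z" "\<lambda>t. cmod (f t)" E] by (simp add: norm_mult)
    obtain u where u: "cmod u = 1" "u * ?S = complex_of_real (cmod ?S)"
      using unit_phase by blast
    define x where "x = (\<lambda>t. (u / ?X) * \<xi> t)"
    define y where "y = (\<lambda>t. complex_of_real (1 / ?Y) * \<eta> t)"
    have "Re (\<Sum>s\<in>E. \<Sum>t\<in>E. a s t * x t * cnj (y s)) \<le> b"
      unfolding x_def y_def
      by (rule unit; subst sc) (use XY u in \<open>simp_all add: norm_divide\<close>)
    also have "(\<Sum>s\<in>E. \<Sum>t\<in>E. a s t * x t * cnj (y s)) = (u / ?X) * complex_of_real (1 / ?Y) * ?S"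
      by (simp only: x_def y_def sum_distrib_left complex_cnj_mult complex_cnj_complex_of_real mult_ac)
    also have "\<dots> = complex_of_real (cmod ?S / (?X * ?Y))"
      using u(2) by (simp add: field_simps)
    finally show ?thesis
      using XY by (simp add: divide_le_eq mult_ac)
  qed
qed

text \<open>The convex hull of the kernels \<open>c\<close> times a rank one matrix of vectors in
  the unit ball comes arbitrarily close to \<open>k\<close>. Otherwise a separating vector would
  give a matrix of norm at most \<open>b / c\<close> whose pairing with \<open>k\<close> has real
  part above \<open>b\<close>.\<close>

lemma finite_trace_duality:
  fixes k :: "'a \<Rightarrow> 'a \<Rightarrow> complex"
  assumes E: "finite E" and c: "0 < c" and \<epsilon>: "0 < \<epsilon>"
    and dual: "\<And>a r. mat_bound a r \<Longrightarrow> cmod (\<Sum>s\<in>E. \<Sum>t\<in>E. k s t * a s t) \<le> c * r"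
  shows "\<exists>N::nat. \<exists>\<alpha> \<beta>. (\<Sum>n<N. (L2_set (\<lambda>t. cmod (\<alpha> n t)) E)\<^sup>2) \<le> c \<and>
    (\<Sum>n<N. (L2_set (\<lambda>t. cmod (\<beta> n t)) E)\<^sup>2) \<le> c \<and>
    (\<forall>s\<in>E. \<forall>t\<in>E. cmod (k s t - (\<Sum>n<N. \<alpha> n t * cnj (\<beta> n s))) < \<epsilon>)"
proof -
  define ball where "ball = {x :: 'a \<Rightarrow> complex. L2_set (\<lambda>t. cmod (x t)) E \<le> 1}"
  define rk where "rk x y = fvec (E \<times> E) (\<lambda>(s, t). complex_of_real c * (x t * cnj (y s)))"
    for x y :: "'a \<Rightarrow> complex"
  define R where "R = (\<lambda>(x, y). rk x y) ` (ball \<times> ball)"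
  define z where "z = fvec (E \<times> E) (\<lambda>(s, t). k s t)"
  have EE: "finite (E \<times> E)"
    using E by simp
  have "\<exists>p\<in>convex hull R. norm (z - p) < \<epsilon>"
  proof (rule ccontr)
    assume "\<not> ?thesis"
    then have far: "\<epsilon> \<le> norm (z - p)" if "p \<in> convex hull R" for p
      using that by force
    have zero: "(\<lambda>_. 0) \<in> ball"
      by (simp add: ball_def L2_set_0')
    have bR: "bounded R"
    proof (rule boundedI)
      fix p assume "p \<in> R"
      then obtain x y where xy: "x \<in> ball" "y \<in> ball" "p = rk x y"
        by (auto simp: R_def)
      have le: "cmod (x t) \<le> 1" "cmod (y t) \<le> 1" if "t \<in> E" for t
        using xy member_le_L2_set[OF E that, of "\<lambda>t. cmod (x t)"]
          member_le_L2_set[OF E that, of "\<lambda>t. cmod (y t)"] by (auto simp: ball_def)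
      have "norm p \<le> (\<Sum>i\<in>E \<times> E. cmod (case i of (s, t) \<Rightarrow> complex_of_real c * (x t * cnj (y s))))"
        unfolding xy(3) rk_def norm_fvec[OF EE] by (rule L2_set_le_sum) simp
      also have "\<dots> \<le> (\<Sum>i\<in>E \<times> E. c)"
      proof (rule sum_mono)
        fix i assume "i \<in> E \<times> E"
        then show "cmod (case i of (s, t) \<Rightarrow> complex_of_real c * (x t * cnj (y s))) \<le> c"
          using c le by (auto simp: norm_mult mult_le_one)
      qed
      finally show "norm p \<le> (\<Sum>i\<in>E \<times> E. c)" .
    qed
    have "rk (\<lambda>_. 0) (\<lambda>_. 0) \<in> R"
      using zero by (auto simp: R_def)
    then have "convex hull R \<noteq> {}"
      using hull_inc by fast
    then obtain w b where w: "\<And>q. q \<in> convex hull R \<Longrightarrow> inner q w \<le> b" "b < inner z w"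
      using convex_separation[OF convex_convex_hull bounded_convex_hull[OF bR] _ \<epsilon> far] by blast
    \<comment> \<open>The conjugate compensates for the inner product being conjugate linear in
      \<open>w\<close>. Extension by zero makes \<open>a\<close> a matrix on the whole index set, to
      which \<open>dual\<close> applies.\<close>
    define a where "a s t = (if s \<in> E \<and> t \<in> E then cnj (coord w (s, t)) else 0)" for s t
    have inner_eq: "inner (fvec (E \<times> E) (\<lambda>(s, t). f s t)) w = Re (\<Sum>s\<in>E. \<Sum>t\<in>E. f s t * a s t)" for f
    proof -
      have "cinner (fvec (E \<times> E) (\<lambda>(s, t). f s t)) w = (\<Sum>i\<in>E \<times> E. (\<lambda>(s, t). f s t * a s t) i)"
        unfolding cinner_fvec_left[OF EE] by (intro sum.cong) (auto simp: a_def)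
      also have "\<dots> = (\<Sum>s\<in>E. \<Sum>t\<in>E. f s t * a s t)"
        by (simp add: sum.cartesian_product)
      finally show ?thesis
        by (simp flip: Re_cinner)
    qed
    have unit: "c * Re (\<Sum>s\<in>E. \<Sum>t\<in>E. a s t * x t * cnj (y s)) \<le> b" if "x \<in> ball" "y \<in> ball" for x y
    proof -
      have "rk x y \<in> convex hull R"
        using that by (intro hull_inc) (auto simp: R_def)
      then have "inner (rk x y) w \<le> b"
        by (rule w(1))
      also have "inner (rk x y) w = Re (complex_of_real c * (\<Sum>s\<in>E. \<Sum>t\<in>E. a s t * x t * cnj (y s)))"
        unfolding rk_def inner_eq by (simp only: sum_distrib_left mult_ac)
      finally show ?thesis
        by simp
    qed
    have b: "0 \<le> b"
      using unit[OF zero zero] by simp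
    have "mat_bound a (b / c)"
    proof (rule mat_boundI_bilinear)
      show "0 \<le> b / c"
        using b c by simp
      fix F :: "'a set" and \<xi> \<eta> :: "'a \<Rightarrow> complex"
      assume F: "finite F"
      define \<xi>' where "\<xi>' t = (if t \<in> F then \<xi> t else 0)" for t
      define \<eta>' where "\<eta>' t = (if t \<in> F then \<eta> t else 0)" for t
      have le: "L2_set (\<lambda>t. cmod (if t \<in> F then f t else 0)) E \<le> L2_set (\<lambda>t. cmod (f t)) F" for f
      proof -
        have "(\<Sum>t\<in>E. (cmod (if t \<in> F then f t else 0))\<^sup>2) = (\<Sum>t\<in>E \<inter> F. (cmod (f t))\<^sup>2)"
          using E by (intro sum.mono_neutral_cong_right) auto
        also have "\<dots> \<le> (\<Sum>t\<in>F. (cmod (f t))\<^sup>2)"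
          using F by (intro sum_mono2) auto
        finally show ?thesis
          by (simp add: L2_set_def)
      qed
      have "(\<Sum>s\<in>F. \<Sum>t\<in>F. a s t * \<xi> t * cnj (\<eta> s)) = (\<Sum>s\<in>E \<inter> F. \<Sum>t\<in>E \<inter> F. a s t * \<xi> t * cnj (\<eta> s))"
      proof (rule sum.mono_neutral_cong_right[OF F])
        show "\<forall>s\<in>F - E \<inter> F. (\<Sum>t\<in>F. a s t * \<xi> t * cnj (\<eta> s)) = 0"
          by (auto simp: a_def intro!: sum.neutral split: if_splits)
        show "(\<Sum>t\<in>F. a s t * \<xi> t * cnj (\<eta> s)) = (\<Sum>t\<in>E \<inter> F. a s t * \<xi> t * cnj (\<eta> s))" for s
          using F by (intro sum.mono_neutral_right) (auto simp: a_def split: if_splits)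
      qed auto
      also have "\<dots> = (\<Sum>s\<in>E. \<Sum>t\<in>E. a s t * \<xi>' t * cnj (\<eta>' s))"
        using E by (intro sum.mono_neutral_cong_left)
          (auto intro!: sum.mono_neutral_cong_left simp: \<xi>'_def \<eta>'_def)
      also have "cmod \<dots> \<le> b / c * L2_set (\<lambda>t. cmod (\<xi>' t)) E * L2_set (\<lambda>t. cmod (\<eta>' t)) E"
        using E b c unit by (intro bilinear_bound_of_unit) (auto simp: ball_def field_simps)
      also have "\<dots> \<le> b / c * L2_set (\<lambda>t. cmod (\<xi> t)) F * L2_set (\<lambda>t. cmod (\<eta> t)) F"
        using b c unfolding \<xi>'_def \<eta>'_def by (intro mult_mono le) (auto simp: L2_set_nonneg)
      finally show "cmod (\<Sum>s\<in>F. \<Sum>t\<in>F. a s t * \<xi> t * cnj (\<eta> s))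
        \<le> b / c * L2_set (\<lambda>t. cmod (\<xi> t)) F * L2_set (\<lambda>t. cmod (\<eta> t)) F" .
    qed
    from dual[OF this] have "cmod (\<Sum>s\<in>E. \<Sum>t\<in>E. k s t * a s t) \<le> b"
      using c by simp
    moreover have "inner z w = Re (\<Sum>s\<in>E. \<Sum>t\<in>E. k s t * a s t)"
      unfolding z_def by (rule inner_eq)
    ultimately show False
      using w(2) complex_Re_le_cmod[of "\<Sum>s\<in>E. \<Sum>t\<in>E. k s t * a s t"] by linarith
  qed
  then obtain p where p: "p \<in> convex hull R" "norm (z - p) < \<epsilon>"
    by blast
  from p(1) obtain N :: nat and u X where u: "\<And>i. i \<in> {1..N} \<Longrightarrow> 0 \<le> u i \<and> X i \<in> R"
      "sum u {1..N} = 1" "(\<Sum>i\<in>{1..N}. u i *\<^sub>R X i) = p"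
    unfolding convex_hull_indexed by blast
  then have "\<forall>i\<in>{1..N}. \<exists>x y. x \<in> ball \<and> y \<in> ball \<and> X i = rk x y"
    by (fastforce simp: R_def)
  then obtain x y where xy: "\<And>i. i \<in> {1..N} \<Longrightarrow> x i \<in> ball \<and> y i \<in> ball \<and> X i = rk (x i) (y i)"
    by metis
  \<comment> \<open>The weight \<open>c * u (Suc n)\<close> is split evenly between the two factors,
    so that both square sums are at most \<open>c\<close>, the weights \<open>u\<close> having sum
    1. \<open>Suc\<close> passes from \<open>{1..N}\<close> to \<open>{..<N}\<close>.\<close>
  define \<alpha> where "\<alpha> n t = complex_of_real (sqrt (c * u (Suc n))) * x (Suc n) t" for n t
  define \<beta> where "\<beta> n t = complex_of_real (sqrt (c * u (Suc n))) * y (Suc n) t" for n t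
  have N: "Suc n \<in> {1..N}" if "n < N" for n
    using that by simp
  have shift: "(\<Sum>i\<in>{1..N}. f i) = (\<Sum>n<N. f (Suc n))" for f :: "nat \<Rightarrow> 'z::comm_monoid_add"
    by (rule sum.reindex_bij_witness[of _ Suc "\<lambda>i. i - 1"]) auto
  have le: "(\<Sum>n<N. (L2_set (\<lambda>t. cmod (complex_of_real (sqrt (c * u (Suc n))) * f (Suc n) t)) E)\<^sup>2) \<le> c"
    if f: "\<And>i. i \<in> {1..N} \<Longrightarrow> f i \<in> ball" for f
  proof -
    have "(L2_set (\<lambda>t. cmod (complex_of_real (sqrt (c * u (Suc n))) * f (Suc n) t)) E)\<^sup>2 \<le> c * u (Suc n)"
      if n: "n < N" for n
    proof -
      have cu: "0 \<le> c * u (Suc n)"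
        using c u(1)[OF N[OF n]] by simp
      have "L2_set (\<lambda>t. cmod (complex_of_real (sqrt (c * u (Suc n))) * f (Suc n) t)) E
          = sqrt (c * u (Suc n)) * L2_set (\<lambda>t. cmod (f (Suc n) t)) E"
        using L2_set_right_distrib[of "sqrt (c * u (Suc n))" "\<lambda>t. cmod (f (Suc n) t)" E] cu
        by (simp add: norm_mult)
      also have "\<dots> \<le> sqrt (c * u (Suc n)) * 1"
        using f[OF N[OF n]] cu by (intro mult_left_mono) (auto simp: ball_def)
      finally show ?thesis
        using power_mono[of _ "sqrt (c * u (Suc n))" 2] cu by (simp add: L2_set_nonneg)
    qed
    then have "(\<Sum>n<N. (L2_set (\<lambda>t. cmod (complex_of_real (sqrt (c * u (Suc n))) * f (Suc n) t)) E)\<^sup>2)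
        \<le> (\<Sum>n<N. c * u (Suc n))"
      by (intro sum_mono) simp
    also have "\<dots> = c"
      using u(2) unfolding shift sum_distrib_left[symmetric] by simp
    finally show ?thesis .
  qed
  have "cmod (k s t - (\<Sum>n<N. \<alpha> n t * cnj (\<beta> n s))) < \<epsilon>" if st: "s \<in> E" "t \<in> E" for s t
  proof -
    have "coord p (s, t) = (\<Sum>n<N. coord (u (Suc n) *\<^sub>R X (Suc n)) (s, t))"
      unfolding u(3)[symmetric] coord_sum shift ..
    also have "\<dots> = (\<Sum>n<N. \<alpha> n t * cnj (\<beta> n s))"
    proof (rule sum.cong[OF refl])
      fix n assume "n \<in> {..<N}"
      then have n: "n < N" by simp
      have cu: "0 \<le> c * u (Suc n)"
        using c u(1)[OF N[OF n]] by simp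
      have "coord (u (Suc n) *\<^sub>R X (Suc n)) (s, t)
          = complex_of_real (c * u (Suc n)) * (x (Suc n) t * cnj (y (Suc n) s))"
        using xy[OF N[OF n]] st unfolding scaleC_of_real[symmetric] coord_scaleC
        by (simp add: rk_def coord_fvec[OF EE])
      also have "complex_of_real (c * u (Suc n))
          = complex_of_real (sqrt (c * u (Suc n))) * complex_of_real (sqrt (c * u (Suc n)))"
        unfolding of_real_mult[symmetric] using cu by (simp del: of_real_mult)
      finally show "coord (u (Suc n) *\<^sub>R X (Suc n)) (s, t) = \<alpha> n t * cnj (\<beta> n s)"
        unfolding \<alpha>_def \<beta>_def by (simp only: complex_cnj_mult complex_cnj_complex_of_real mult_ac)
    qed
    finally have "k s t - (\<Sum>n<N. \<alpha> n t * cnj (\<beta> n s)) = coord (z - p) (s, t)"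
      using st by (simp add: coord_minus z_def coord_fvec[OF EE])
    then show ?thesis
      using cmod_coord_le[of "z - p" "(s, t)"] p(2) by simp
  qed
  moreover have "(\<Sum>n<N. (L2_set (\<lambda>t. cmod (\<alpha> n t)) E)\<^sup>2) \<le> c"
    "(\<Sum>n<N. (L2_set (\<lambda>t. cmod (\<beta> n t)) E)\<^sup>2) \<le> c"
    unfolding \<alpha>_def \<beta>_def using xy by (intro le; blast)+
  ultimately show ?thesis
    by blast
qed

section \<open>Functionals that are norm limits of finite kernels\<close>

abbreviation ker_sum :: "'a set \<Rightarrow> ('a \<Rightarrow> 'a \<Rightarrow> complex) \<Rightarrow> ('a \<Rightarrow> 'a \<Rightarrow> complex) \<Rightarrow> complex" where
  "ker_sum E k a \<equiv> (\<Sum>s\<in>E. \<Sum>t\<in>E. k s t * a s t)"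

text \<open>The norm closure of the functionals given by finite kernels. For bounded functionals it
  is the predual, by \<open>ultraweak_approx\<close> and
  \<open>ker_approx_representation\<close>.\<close>

definition ker_approx :: "('a ell2 oper \<Rightarrow> complex) \<Rightarrow> bool" where
  "ker_approx \<phi> \<longleftrightarrow> (\<forall>\<epsilon>>0. \<exists>E k. finite E \<and>
     (\<forall>x\<in>bounded_ops. cmod (\<phi> x - ker_sum E k (entry x)) \<le> \<epsilon> * onorm x))"

lemma ker_approxE:
  assumes "ker_approx \<phi>" "0 < \<epsilon>"
  obtains E k where "finite E"
    and "\<forall>x\<in>bounded_ops. cmod (\<phi> x - ker_sum E k (entry x)) \<le> \<epsilon> * onorm x"
proof -
  have "\<exists>E k. finite E \<and> (\<forall>x\<in>bounded_ops. cmod (\<phi> x - ker_sum E k (entry x)) \<le> \<epsilon> * onorm x)"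
    using assms(1)[unfolded ker_approx_def, rule_format, OF assms(2)] .
  then show thesis
    by (elim exE conjE) (rule that)
qed

lemma ker_sum_extend:
  assumes "finite G" "E \<subseteq> G"
  shows "ker_sum G (\<lambda>s t. if s \<in> E \<and> t \<in> E then k s t else 0) a = ker_sum E k a"
proof (rule sum.mono_neutral_cong_right[OF assms])
  show "\<forall>s\<in>G - E. (\<Sum>t\<in>G. (if s \<in> E \<and> t \<in> E then k s t else 0) * a s t) = 0"
    by (auto intro!: sum.neutral)
  show "(\<Sum>t\<in>G. (if s \<in> E \<and> t \<in> E then k s t else 0) * a s t) = (\<Sum>t\<in>E. k s t * a s t)"
    if "s \<in> E" for s
    using assms that by (intro sum.mono_neutral_cong_right) auto
qed

lemma ker_approx_diff:
  assumes \<phi>: "ker_approx \<phi>" and E: "finite E"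
  shows "ker_approx (\<lambda>x. \<phi> x - ker_sum E k (entry x))"
  unfolding ker_approx_def
proof (intro allI impI)
  fix \<epsilon> :: real assume "\<epsilon> > 0"
  with \<phi> obtain E' k' where E': "finite E'"
      "\<forall>x\<in>bounded_ops. cmod (\<phi> x - ker_sum E' k' (entry x)) \<le> \<epsilon> * onorm x"
    by (rule ker_approxE)
  let ?G = "E \<union> E'"
  let ?k = "\<lambda>s t. (if s \<in> E' \<and> t \<in> E' then k' s t else 0) - (if s \<in> E \<and> t \<in> E then k s t else 0)"
  have "ker_sum ?G ?k a = ker_sum E' k' a - ker_sum E k a" for a
    unfolding left_diff_distrib sum_subtractf
    using ker_sum_extend[of ?G E' k' a] ker_sum_extend[of ?G E k a] E E'(1) by simp
  then have "\<forall>x\<in>bounded_ops. cmod (\<phi> x - ker_sum E k (entry x) - ker_sum ?G ?k (entry x)) \<le> \<epsilon> * onorm x"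
    using E'(2) by simp
  then show "\<exists>G k''. finite G \<and>
      (\<forall>x\<in>bounded_ops. cmod (\<phi> x - ker_sum E k (entry x) - ker_sum G k'' (entry x)) \<le> \<epsilon> * onorm x)"
    using E E'(1) by (intro exI[of _ ?G] exI[of _ ?k]) simp
qed

text \<open>A finite kernel within \<open>c / 4\<close> of \<open>\<phi>\<close> is factored by
  \<open>finite_trace_duality\<close> up to another \<open>c / 4\<close>, so the remainder has at
  most half the norm bound. The remainder is again a limit of finite kernels, which lets the step be
  repeated.\<close>

lemma ker_approx_step:
  assumes \<phi>: "ker_approx \<phi>" and c: "0 < c"
    and bound: "\<forall>x\<in>bounded_ops. cmod (\<phi> x) \<le> c * onorm x"
  shows "\<exists>N::nat. \<exists>\<alpha> \<beta>. (\<Sum>n<N. (norm (\<alpha> n))\<^sup>2) \<le> 2 * c \<and> (\<Sum>n<N. (norm (\<beta> n))\<^sup>2) \<le> 2 * c \<and>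
    ker_approx (\<lambda>x. \<phi> x - (\<Sum>n<N. cinner (x (\<alpha> n)) (\<beta> n))) \<and>
    (\<forall>x\<in>bounded_ops. cmod (\<phi> x - (\<Sum>n<N. cinner (x (\<alpha> n)) (\<beta> n))) \<le> c / 2 * onorm x)"
proof -
  have "0 < c / 4"
    using c by simp
  with \<phi> obtain E k where E: "finite E"
    and "\<forall>x\<in>bounded_ops. cmod (\<phi> x - ker_sum E k (entry x)) \<le> c / 4 * onorm x"
    by (rule ker_approxE)
  then have k: "cmod (\<phi> x - ker_sum E k (entry x)) \<le> c / 4 * onorm x" if "x \<in> bounded_ops" for x
    using that by blast
  \<comment> \<open>An entrywise error \<open>\<epsilon>\<close> costs
    \<open>\<epsilon> * onorm x\<close> at each pair of indices in \<open>E\<close>. The summand 1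
    avoids division by zero for empty \<open>E\<close>.\<close>
  define \<epsilon> where "\<epsilon> = c / 4 / (real (card E) * real (card E) + 1)"
  have card_pos: "real (card E) * real (card E) + 1 > 0"
    by (simp add: add_nonneg_pos)
  then have \<epsilon>: "0 < \<epsilon>"
    using c by (simp add: \<epsilon>_def)
  have "real (card E) * real (card E) * \<epsilon> \<le> (real (card E) * real (card E) + 1) * \<epsilon>"
    using \<epsilon> by (intro mult_right_mono) auto
  also have "\<dots> = c / 4"
    using card_pos unfolding \<epsilon>_def by (subst nonzero_mult_div_cancel_left[symmetric]) auto
  finally have \<epsilon>_le: "real (card E) * real (card E) * \<epsilon> \<le> c / 4" .
  \<comment> \<open>The kernel inherits the bound \<open>c + c / 4\<close>, which is rounded up to
    \<open>2 * c\<close>.\<close>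
  have dual: "cmod (ker_sum E k a) \<le> 2 * c * r" if a: "mat_bound a r" for a r
  proof -
    from op_of_mat[OF a] obtain A where A: "A \<in> bounded_ops" "entry A = a" "onorm A \<le> r"
      by blast
    have "cmod (ker_sum E k a) \<le> cmod (\<phi> A) + cmod (\<phi> A - ker_sum E k a)"
      unfolding norm_minus_commute[of "\<phi> A"] by (rule norm_triangle_sub)
    also have "\<dots> \<le> c * onorm A + c / 4 * onorm A"
      using bspec[OF bound A(1)] k[OF A(1)] A(2) by (intro add_mono) simp_all
    also have "\<dots> = (5 / 4 * c) * onorm A"
      by (simp add: algebra_simps)
    also have "\<dots> \<le> (2 * c) * r"
      using c A(3) bounded_ops_onorm_nonneg[OF A(1)] by (intro mult_mono) auto
    finally show ?thesis .
  qed
  obtain N :: nat and \<alpha>' \<beta>' where ab: "(\<Sum>n<N. (L2_set (\<lambda>t. cmod (\<alpha>' n t)) E)\<^sup>2) \<le> 2 * c"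
    "(\<Sum>n<N. (L2_set (\<lambda>t. cmod (\<beta>' n t)) E)\<^sup>2) \<le> 2 * c"
    and close: "\<And>s t. s \<in> E \<Longrightarrow> t \<in> E \<Longrightarrow> cmod (k s t - (\<Sum>n<N. \<alpha>' n t * cnj (\<beta>' n s))) < \<epsilon>"
    using finite_trace_duality[OF E _ \<epsilon> dual] c by (auto 0 3)
  define \<alpha> where "\<alpha> n = fvec E (\<alpha>' n)" for n
  define \<beta> where "\<beta> n = fvec E (\<beta>' n)" for n
  define k' where "k' s t = (\<Sum>n<N. \<alpha>' n t * cnj (\<beta>' n s))" for s t
  have k'_eq: "(\<Sum>n<N. cinner (x (\<alpha> n)) (\<beta> n)) = ker_sum E k' (entry x)" if x: "x \<in> bounded_ops" for x
  proof -
    have "(\<Sum>n<N. cinner (x (\<alpha> n)) (\<beta> n)) = (\<Sum>n<N. \<Sum>s\<in>E. \<Sum>t\<in>E. entry x s t * \<alpha>' n t * cnj (\<beta>' n s))"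
      by (simp add: \<alpha>_def \<beta>_def entry_cinner_fvec[OF x E E])
    also have "\<dots> = (\<Sum>s\<in>E. \<Sum>n<N. \<Sum>t\<in>E. entry x s t * \<alpha>' n t * cnj (\<beta>' n s))"
      by (rule sum.swap)
    also have "\<dots> = (\<Sum>s\<in>E. \<Sum>t\<in>E. \<Sum>n<N. entry x s t * \<alpha>' n t * cnj (\<beta>' n s))"
      by (intro sum.cong refl sum.swap)
    also have "\<dots> = ker_sum E k' (entry x)"
      unfolding k'_def sum_distrib_right by (simp only: mult_ac)
    finally show ?thesis .
  qed
  have kk': "cmod (ker_sum E k (entry x) - ker_sum E k' (entry x)) \<le> c / 4 * onorm x"
    if x: "x \<in> bounded_ops" for x
  proof -
    have "ker_sum E k (entry x) - ker_sum E k' (entry x) = (\<Sum>s\<in>E. \<Sum>t\<in>E. (k s t - k' s t) * entry x s t)"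
      by (simp add: sum_subtractf left_diff_distrib)
    also have "cmod \<dots> \<le> (\<Sum>s\<in>E. \<Sum>t\<in>E. \<epsilon> * onorm x)"
    proof (intro order_trans[OF norm_sum] sum_mono)
      fix s t assume st: "s \<in> E" "t \<in> E"
      have "cmod (entry x s t) \<le> onorm x"
        by (rule mat_bound_entry_le[OF mat_bound_of_op[OF x order_refl]])
      then show "cmod ((k s t - k' s t) * entry x s t) \<le> \<epsilon> * onorm x"
        unfolding norm_mult k'_def using close[OF st] \<epsilon> by (intro mult_mono) auto
    qed
    also have "\<dots> = real (card E) * real (card E) * \<epsilon> * onorm x"
      by simp
    also have "\<dots> \<le> c / 4 * onorm x"
      by (intro mult_right_mono \<epsilon>_le bounded_ops_onorm_nonneg x)
    finally show ?thesis .
  qed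
  have "cmod (\<phi> x - (\<Sum>n<N. cinner (x (\<alpha> n)) (\<beta> n))) \<le> c / 2 * onorm x"
    if x: "x \<in> bounded_ops" for x
    using norm_triangle_mono[OF k[OF x] kk'[OF x]] unfolding k'_eq[OF x] by simp
  moreover have "ker_approx (\<lambda>x. \<phi> x - (\<Sum>n<N. cinner (x (\<alpha> n)) (\<beta> n)))"
  proof -
    have "ker_approx (\<lambda>x. \<phi> x - ker_sum E k' (entry x))"
      by (rule ker_approx_diff[OF \<phi> E])
    then show ?thesis
      unfolding ker_approx_def by (simp add: k'_eq)
  qed
  moreover have "(\<Sum>n<N. (norm (\<alpha> n))\<^sup>2) \<le> 2 * c" "(\<Sum>n<N. (norm (\<beta> n))\<^sup>2) \<le> 2 * c"
    using ab by (simp_all add: \<alpha>_def \<beta>_def norm_fvec[OF E])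
  ultimately show ?thesis
    by blast
qed

section \<open>Series of vector functionals\<close>

lemma cinner_summable:
  fixes \<xi> \<eta> :: "nat \<Rightarrow> 'h::complex_hilbert"
  assumes "square_summable \<xi>" "square_summable \<eta>" and x: "x \<in> bounded_ops"
  shows "summable (\<lambda>n. norm (\<xi> n) * norm (\<eta> n))"
    and "summable (\<lambda>n. cinner (x (\<xi> n)) (\<eta> n))"
    and "cmod (cinner (x (\<xi> n)) (\<eta> n)) \<le> onorm x * (norm (\<xi> n) * norm (\<eta> n))"
proof -
  show s: "summable (\<lambda>n. norm (\<xi> n) * norm (\<eta> n))"
  proof (rule summable_comparison_test')
    show "summable (\<lambda>n. (norm (\<xi> n))\<^sup>2 + (norm (\<eta> n))\<^sup>2)"
      using assms(1,2) unfolding square_summable_def by (rule summable_add)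
    show "norm (norm (\<xi> n) * norm (\<eta> n)) \<le> (norm (\<xi> n))\<^sup>2 + (norm (\<eta> n))\<^sup>2" for n
      using sum_squares_bound[of "norm (\<xi> n)" "norm (\<eta> n)"]
        mult_nonneg_nonneg[OF norm_ge_zero[of "\<xi> n"] norm_ge_zero[of "\<eta> n"]]
      unfolding real_norm_def abs_mult abs_norm_cancel by linarith
  qed
  show b: "cmod (cinner (x (\<xi> n)) (\<eta> n)) \<le> onorm x * (norm (\<xi> n) * norm (\<eta> n))" for n
    unfolding mult.assoc[symmetric]
    by (rule order_trans[OF cinner_norm_le mult_right_mono[OF bounded_ops_norm_le[OF x] norm_ge_zero]])
  show "summable (\<lambda>n. cinner (x (\<xi> n)) (\<eta> n))"
    by (rule summable_comparison_test'[OF summable_mult[OF s, of "onorm x"]]) (rule b)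
qed

lemma ultraweak_functional_bound:
  fixes \<xi> \<eta> :: "nat \<Rightarrow> 'h::complex_hilbert"
  assumes "square_summable \<xi>" "square_summable \<eta>" and "x \<in> bounded_ops"
  shows "cmod (\<Sum>n. cinner (x (\<xi> n)) (\<eta> n)) \<le> (\<Sum>n. norm (\<xi> n) * norm (\<eta> n)) * onorm x"
proof -
  note s = cinner_summable[OF assms]
  have "cmod (\<Sum>n. cinner (x (\<xi> n)) (\<eta> n)) \<le> (\<Sum>n. onorm x * (norm (\<xi> n) * norm (\<eta> n)))"
    by (intro norm_suminf_le s summable_mult)
  then show ?thesis
    unfolding suminf_mult[OF s(1)] by (simp only: mult.commute)
qed

text \<open>The tail of the series is small in norm because the products of lengths are summable;
  the finitely many remaining vectors are truncated to a common finite set.\<close>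

lemma ultraweak_approx:
  fixes \<xi> \<eta> :: "nat \<Rightarrow> 'a ell2"
  assumes sq: "square_summable \<xi>" "square_summable \<eta>"
  shows "ker_approx (\<lambda>x. \<Sum>n. cinner (x (\<xi> n)) (\<eta> n))"
  unfolding ker_approx_def
proof (intro allI impI)
  fix \<epsilon> :: real assume \<epsilon>: "\<epsilon> > 0"
  have "(\<lambda>x. 0 :: 'a ell2) \<in> bounded_ops"
    by (rule bounded_opsI[where K = 0]) auto
  then have s1: "summable (\<lambda>n. norm (\<xi> n) * norm (\<eta> n))"
    by (rule cinner_summable(1)[OF sq])
  then obtain N where N: "norm (\<Sum>n. norm (\<xi> (n + N)) * norm (\<eta> (n + N))) < \<epsilon> / 2"
    using suminf_exist_split[of "\<epsilon> / 2"] \<epsilon> by fastforce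
  have "((\<lambda>E. \<Sum>n<N. norm (fvec E (coord (\<xi> n)) - \<xi> n) * norm (fvec E (coord (\<eta> n)))
      + norm (\<xi> n) * norm (fvec E (coord (\<eta> n)) - \<eta> n)) \<longlongrightarrow>
      (\<Sum>n<N. norm (\<xi> n - \<xi> n) * norm (\<eta> n) + norm (\<xi> n) * norm (\<eta> n - \<eta> n))) (finite_subsets_at_top UNIV)"
    by (intro tendsto_intros fvec_coord_tendsto)
  then have "eventually (\<lambda>E. (\<Sum>n<N. norm (fvec E (coord (\<xi> n)) - \<xi> n) * norm (fvec E (coord (\<eta> n)))
      + norm (\<xi> n) * norm (fvec E (coord (\<eta> n)) - \<eta> n)) < \<epsilon> / 2) (finite_subsets_at_top UNIV)"
    using \<epsilon> by (intro order_tendstoD) auto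
  then obtain E where E: "finite E"
    and le: "(\<Sum>n<N. norm (fvec E (coord (\<xi> n)) - \<xi> n) * norm (fvec E (coord (\<eta> n)))
      + norm (\<xi> n) * norm (fvec E (coord (\<eta> n)) - \<eta> n)) < \<epsilon> / 2"
    unfolding eventually_finite_subsets_at_top by auto
  let ?\<xi> = "\<lambda>n. fvec E (coord (\<xi> n))" and ?\<eta> = "\<lambda>n. fvec E (coord (\<eta> n))"
  define k where "k s t = (\<Sum>n<N. coord (\<xi> n) t * cnj (coord (\<eta> n) s))" for s t
  have "cmod ((\<Sum>n. cinner (x (\<xi> n)) (\<eta> n)) - ker_sum E k (entry x)) \<le> \<epsilon> * onorm x"
    if x: "x \<in> bounded_ops" for x
  proof -
    note s = cinner_summable[OF sq x]
    have x0: "0 \<le> onorm x"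
      by (rule bounded_ops_onorm_nonneg[OF x])
    have "ker_sum E k (entry x) = (\<Sum>s\<in>E. \<Sum>t\<in>E. \<Sum>n<N. entry x s t * coord (\<xi> n) t * cnj (coord (\<eta> n) s))"
      unfolding k_def sum_distrib_right by (simp only: mult_ac)
    also have "\<dots> = (\<Sum>s\<in>E. \<Sum>n<N. \<Sum>t\<in>E. entry x s t * coord (\<xi> n) t * cnj (coord (\<eta> n) s))"
      by (intro sum.cong refl sum.swap)
    also have "\<dots> = (\<Sum>n<N. \<Sum>s\<in>E. \<Sum>t\<in>E. entry x s t * coord (\<xi> n) t * cnj (coord (\<eta> n) s))"
      by (rule sum.swap)
    also have "\<dots> = (\<Sum>n<N. cinner (x (?\<xi> n)) (?\<eta> n))"
      by (simp add: entry_cinner_fvec[OF x E E])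
    finally have ker: "ker_sum E k (entry x) = (\<Sum>n<N. cinner (x (?\<xi> n)) (?\<eta> n))" .
    have "cmod ((\<Sum>n<N. cinner (x (?\<xi> n)) (?\<eta> n)) - (\<Sum>n<N. cinner (x (\<xi> n)) (\<eta> n)))
        \<le> (\<Sum>n<N. onorm x * (norm (?\<xi> n - \<xi> n) * norm (?\<eta> n) + norm (\<xi> n) * norm (?\<eta> n - \<eta> n)))"
      unfolding sum_subtractf[symmetric]
    proof (intro order_trans[OF norm_sum] sum_mono)
      fix n
      have "cinner (x (?\<xi> n)) (?\<eta> n) - cinner (x (\<xi> n)) (\<eta> n)
          = cinner (x (?\<xi> n - \<xi> n)) (?\<eta> n) + cinner (x (\<xi> n)) (?\<eta> n - \<eta> n)"
        using bounded_ops_linear[OF x] by (simp add: cinner_diff_left cinner_diff_right linear_simps)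
      also have "cmod \<dots> \<le> onorm x * norm (?\<xi> n - \<xi> n) * norm (?\<eta> n) + onorm x * norm (\<xi> n) * norm (?\<eta> n - \<eta> n)"
        by (intro norm_triangle_mono order_trans[OF cinner_norm_le] mult_right_mono
            bounded_ops_norm_le[OF x] norm_ge_zero)
      finally show "cmod (cinner (x (?\<xi> n)) (?\<eta> n) - cinner (x (\<xi> n)) (\<eta> n))
          \<le> onorm x * (norm (?\<xi> n - \<xi> n) * norm (?\<eta> n) + norm (\<xi> n) * norm (?\<eta> n - \<eta> n))"
        by (simp only: distrib_left mult.assoc)
    qed
    also have "\<dots> \<le> onorm x * (\<epsilon> / 2)"
      unfolding sum_distrib_left[symmetric] using le x0 by (intro mult_left_mono) auto
    finally have head: "cmod ((\<Sum>n<N. cinner (x (\<xi> n)) (\<eta> n)) - ker_sum E k (entry x)) \<le> onorm x * (\<epsilon> / 2)"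
      unfolding ker by (simp only: norm_minus_commute)
    have "cmod (\<Sum>n. cinner (x (\<xi> (n + N))) (\<eta> (n + N)))
        \<le> (\<Sum>n. onorm x * (norm (\<xi> (n + N)) * norm (\<eta> (n + N))))"
      using s1 by (intro norm_suminf_le s summable_mult summable_ignore_initial_segment)
    also have "\<dots> = onorm x * (\<Sum>n. norm (\<xi> (n + N)) * norm (\<eta> (n + N)))"
      using s1 by (intro suminf_mult summable_ignore_initial_segment)
    also have "\<dots> \<le> onorm x * (\<epsilon> / 2)"
      using N x0 by (intro mult_left_mono) auto
    finally have tail: "cmod (\<Sum>n. cinner (x (\<xi> (n + N))) (\<eta> (n + N))) \<le> onorm x * (\<epsilon> / 2)" .
    have "(\<Sum>n. cinner (x (\<xi> n)) (\<eta> n)) - ker_sum E k (entry x)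
        = (\<Sum>n. cinner (x (\<xi> (n + N))) (\<eta> (n + N))) + ((\<Sum>n<N. cinner (x (\<xi> n)) (\<eta> n)) - ker_sum E k (entry x))"
      using suminf_split_initial_segment[OF s(2), of N] by simp
    also have "cmod \<dots> \<le> onorm x * (\<epsilon> / 2) + onorm x * (\<epsilon> / 2)"
      by (rule norm_triangle_mono[OF tail head])
    finally show ?thesis
      by (simp add: mult.commute)
  qed
  with E show "\<exists>E k. finite E \<and> (\<forall>x\<in>bounded_ops.
      cmod ((\<Sum>n. cinner (x (\<xi> n)) (\<eta> n)) - ker_sum E k (entry x)) \<le> \<epsilon> * onorm x)"
    by blast
qed

text \<open>The geometric bounds on the blocks add up to \<open>2 * c\<close>. Blocks of different
  lengths are filled up with zeros so that \<open>prod_decode\<close> can enumerate all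
  pairs.\<close>

lemma square_summable_flatten:
  fixes \<alpha> :: "nat \<Rightarrow> nat \<Rightarrow> 'h::complex_hilbert"
  assumes le: "\<And>m. (\<Sum>n<N m. (norm (\<alpha> m n))\<^sup>2) \<le> c / 2 ^ m"
  shows "(\<lambda>(m, n). (norm (if n < N m then \<alpha> m n else 0))\<^sup>2) summable_on UNIV"
    and "square_summable (\<lambda>i. case prod_decode i of (m, n) \<Rightarrow> if n < N m then \<alpha> m n else 0)"
proof -
  let ?f = "\<lambda>(m, n). (norm (if n < N m then \<alpha> m n else 0))\<^sup>2"
  have c: "0 \<le> c"
    using order_trans[OF sum_nonneg le[of 0]] by simp
  show sm: "?f summable_on UNIV"
  proof (rule nonneg_bdd_above_summable_on)
    show "bdd_above (sum ?f ` {F. F \<subseteq> UNIV \<and> finite F})"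
    proof (rule bdd_aboveI2)
      fix F :: "(nat \<times> nat) set"
      assume "F \<in> {F. F \<subseteq> UNIV \<and> finite F}"
      then have F: "finite F"
        by simp
      then obtain M K where "fst ` F \<subseteq> {..<M}" "snd ` F \<subseteq> {..<K}"
        using finite_nat_iff_bounded by (metis finite_imageI)
      then have "F \<subseteq> {..<M} \<times> {..<K}"
        by (fastforce simp: subset_iff)
      then have "sum ?f F \<le> sum ?f ({..<M} \<times> {..<K})"
        by (intro sum_mono2) auto
      also have "\<dots> = (\<Sum>m<M. \<Sum>n<K. ?f (m, n))"
        by (simp add: sum.cartesian_product)
      also have "\<dots> \<le> (\<Sum>m<M. c / 2 ^ m)"
      proof (rule sum_mono)
        fix m
        have "(\<Sum>n<K. ?f (m, n)) = (\<Sum>n\<in>{..<K} \<inter> {..<N m}. (norm (\<alpha> m n))\<^sup>2)"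
          by (intro sum.mono_neutral_cong_right) auto
        also have "\<dots> \<le> (\<Sum>n<N m. (norm (\<alpha> m n))\<^sup>2)"
          by (intro sum_mono2) auto
        finally show "(\<Sum>n<K. ?f (m, n)) \<le> c / 2 ^ m"
          using le[of m] by linarith
      qed
      also have "\<dots> = c * (\<Sum>m<M. (1 / 2) ^ m)"
        by (simp add: sum_distrib_left power_divide)
      also have "\<dots> \<le> c * (\<Sum>m. (1 / 2) ^ m)"
        by (intro mult_left_mono[OF sum_le_suminf c] summable_geometric) auto
      finally show "sum ?f F \<le> c * 2"
        by (simp add: suminf_geometric)
    qed
  qed auto
  then have "(\<lambda>i. ?f (prod_decode i)) summable_on UNIV"
    by (subst summable_on_reindex_bij_betw[OF bij_prod_decode])
  then have "summable (\<lambda>i. ?f (prod_decode i))"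
    by (rule summable_on_imp_summable)
  then show "square_summable (\<lambda>i. case prod_decode i of (m, n) \<Rightarrow> if n < N m then \<alpha> m n else 0)"
    unfolding square_summable_def by (simp add: case_prod_unfold)
qed

text \<open>Iterating \<open>ker_approx_step\<close> makes the remainders tend to zero. The vectors
  split off at stage \<open>m\<close> have square sums at most \<open>2 * c / 2 ^ m\<close>, so
  those of all stages together form two square summable sequences.\<close>

lemma ker_approx_representation:
  fixes \<phi> :: "'a ell2 oper \<Rightarrow> complex"
  assumes \<phi>: "ker_approx \<phi>" and bound: "\<forall>x\<in>bounded_ops. cmod (\<phi> x) \<le> K * onorm x"
  shows "\<exists>\<xi> \<eta>. square_summable \<xi> \<and> square_summable \<eta> \<and>
    (\<forall>x\<in>bounded_ops. \<phi> x = (\<Sum>n. cinner (x (\<xi> n)) (\<eta> n)))"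
proof -
  \<comment> \<open>\<open>ker_approx_step\<close> asks for a positive constant, which
    \<open>K\<close> may fail to be.\<close>
  define c where "c = max K 1"
  have c: "c > 0"
    by (simp add: c_def)
  \<comment> \<open>The clause for \<open>m = 0\<close> ties the chosen sequence of remainders to
    \<open>\<phi>\<close>.\<close>
  define P where "P m \<psi> \<longleftrightarrow> ker_approx \<psi> \<and> (\<forall>x\<in>bounded_ops. cmod (\<psi> x) \<le> c / 2 ^ m * onorm x) \<and>
    (m = 0 \<longrightarrow> \<psi> = \<phi>)" for m :: nat and \<psi>
  define R where "R m \<psi> \<psi>' = (\<lambda>(N :: nat, \<alpha>, \<beta>). (\<Sum>n<N. (norm (\<alpha> n))\<^sup>2) \<le> 2 * c / 2 ^ m \<and>
    (\<Sum>n<N. (norm (\<beta> n))\<^sup>2) \<le> 2 * c / 2 ^ m \<and>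
    \<psi>' = (\<lambda>x. \<psi> x - (\<Sum>n<N. cinner (x (\<alpha> n)) (\<beta> n))))"
    for m :: nat and \<psi> \<psi>' :: "'a ell2 oper \<Rightarrow> complex"
  define Q where "Q m \<psi> \<psi>' \<longleftrightarrow> (\<exists>p. R m \<psi> \<psi>' p)" for m \<psi> \<psi>'
  have "\<exists>f. \<forall>m. P m (f m) \<and> Q m (f m) (f (Suc m))"
  proof (rule dependent_nat_choice)
    have "cmod (\<phi> x) \<le> c * onorm x" if "x \<in> bounded_ops" for x
      using order_trans[OF bspec[OF bound that] mult_right_mono[OF _ bounded_ops_onorm_nonneg[OF that]]]
      by (simp add: c_def)
    then show "\<exists>\<psi>. P 0 \<psi>"
      using \<phi> by (auto simp: P_def)
  next
    fix \<psi> m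
    assume \<psi>: "P m \<psi>"
    have cm: "0 < c / 2 ^ m"
      using c by simp
    have \<psi>': "ker_approx \<psi>" "\<forall>x\<in>bounded_ops. cmod (\<psi> x) \<le> c / 2 ^ m * onorm x"
      using \<psi> by (auto simp: P_def)
    obtain N :: nat and \<alpha> \<beta> where
      *: "(\<Sum>n<N. (norm (\<alpha> n))\<^sup>2) \<le> 2 * (c / 2 ^ m)" "(\<Sum>n<N. (norm (\<beta> n))\<^sup>2) \<le> 2 * (c / 2 ^ m)"
      "ker_approx (\<lambda>x. \<psi> x - (\<Sum>n<N. cinner (x (\<alpha> n)) (\<beta> n)))"
      "\<forall>x\<in>bounded_ops. cmod (\<psi> x - (\<Sum>n<N. cinner (x (\<alpha> n)) (\<beta> n))) \<le> c / 2 ^ m / 2 * onorm x"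
      using ker_approx_step[OF \<psi>'(1) cm \<psi>'(2)] by (elim exE conjE) (rule that)
    then have "P (Suc m) (\<lambda>x. \<psi> x - (\<Sum>n<N. cinner (x (\<alpha> n)) (\<beta> n)))"
      by (simp add: P_def mult.commute)
    moreover have "Q m \<psi> (\<lambda>x. \<psi> x - (\<Sum>n<N. cinner (x (\<alpha> n)) (\<beta> n)))"
      unfolding Q_def R_def using *(1,2) by (intro exI[of _ "(N, \<alpha>, \<beta>)"]) simp
    ultimately show "\<exists>\<psi>'. P (Suc m) \<psi>' \<and> Q m \<psi> \<psi>'"
      by blast
  qed
  then obtain f where f: "\<And>m. P m (f m)" "\<And>m. Q m (f m) (f (Suc m))"
    by blast
  then obtain p where p: "\<And>m. R m (f m) (f (Suc m)) (p m)"
    unfolding Q_def by metis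
  define N where "N m = fst (p m)" for m
  define \<alpha> where "\<alpha> m = fst (snd (p m))" for m
  define \<beta> where "\<beta> m = snd (snd (p m))" for m
  have ab: "(\<Sum>n<N m. (norm (\<alpha> m n))\<^sup>2) \<le> 2 * c / 2 ^ m"
      "(\<Sum>n<N m. (norm (\<beta> m n))\<^sup>2) \<le> 2 * c / 2 ^ m"
      "f (Suc m) = (\<lambda>x. f m x - (\<Sum>n<N m. cinner (x (\<alpha> m n)) (\<beta> m n)))" for m
    using p[of m] by (simp_all add: R_def N_def \<alpha>_def \<beta>_def case_prod_unfold)
  define \<alpha>' where "\<alpha>' = (\<lambda>(m, n). if n < N m then \<alpha> m n else 0)"
  define \<beta>' where "\<beta>' = (\<lambda>(m, n). if n < N m then \<beta> m n else 0)"
  note sm = square_summable_flatten[OF ab(1)] square_summable_flatten[OF ab(2)]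
  have "(\<Sum>i. cinner (x (\<alpha>' (prod_decode i))) (\<beta>' (prod_decode i))) = \<phi> x" if x: "x \<in> bounded_ops" for x
  proof -
    let ?g = "\<lambda>p. cinner (x (\<alpha>' p)) (\<beta>' p)"
    have "(\<lambda>p. onorm x * ((norm (\<alpha>' p))\<^sup>2 + (norm (\<beta>' p))\<^sup>2)) summable_on UNIV"
      using sm(1,3) unfolding \<alpha>'_def \<beta>'_def
      by (intro summable_on_cmult_right summable_on_add) (simp_all add: case_prod_unfold)
    then have "(\<lambda>p. norm (?g p)) summable_on UNIV"
    proof (rule summable_on_comparison_test)
      fix p
      have "cmod (?g p) \<le> onorm x * norm (\<alpha>' p) * norm (\<beta>' p)"
        by (intro order_trans[OF cinner_norm_le] mult_right_mono bounded_ops_norm_le[OF x]) simp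
      also have "\<dots> = onorm x * (norm (\<alpha>' p) * norm (\<beta>' p))"
        by simp
      also have "\<dots> \<le> onorm x * ((norm (\<alpha>' p))\<^sup>2 + (norm (\<beta>' p))\<^sup>2)"
      proof (rule mult_left_mono)
        show "norm (\<alpha>' p) * norm (\<beta>' p) \<le> (norm (\<alpha>' p))\<^sup>2 + (norm (\<beta>' p))\<^sup>2"
          using sum_squares_bound[of "norm (\<alpha>' p)" "norm (\<beta>' p)"]
            mult_nonneg_nonneg[OF norm_ge_zero[of "\<alpha>' p"] norm_ge_zero[of "\<beta>' p"]] by linarith
      qed (rule bounded_ops_onorm_nonneg[OF x])
      finally show "cmod (?g p) \<le> onorm x * ((norm (\<alpha>' p))\<^sup>2 + (norm (\<beta>' p))\<^sup>2)" .
    qed simp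
    then have g: "?g summable_on UNIV"
      by (rule abs_summable_summable)
    then have S: "(?g has_sum infsum ?g UNIV) (UNIV \<times> UNIV)"
      by simp
    have inner: "((\<lambda>n. ?g (m, n)) has_sum (\<Sum>n<N m. cinner (x (\<alpha> m n)) (\<beta> m n))) UNIV" for m
    proof -
      have "((\<lambda>n. ?g (m, n)) has_sum (\<Sum>n<N m. ?g (m, n))) {..<N m}"
        by (rule has_sum_finite) simp
      moreover have "(\<Sum>n<N m. ?g (m, n)) = (\<Sum>n<N m. cinner (x (\<alpha> m n)) (\<beta> m n))"
        by (simp add: \<alpha>'_def \<beta>'_def)
      moreover have "?g (m, n) = 0" if "n \<in> UNIV - {..<N m}" for n
        using that by (simp add: \<beta>'_def)
      ultimately show ?thesis
        using has_sum_cong_neutral[of UNIV "{..<N m}" "\<lambda>n. ?g (m, n)" "\<lambda>n. ?g (m, n)"] by simp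
    qed
    \<comment> \<open>The sum over all pairs is evaluated twice: row by row, where the partial sums
      telescope to \<open>\<phi> x - f M x\<close>, and along \<open>prod_decode\<close>, where it
      is the required series.\<close>
    have "((\<lambda>m. \<Sum>n<N m. cinner (x (\<alpha> m n)) (\<beta> m n)) has_sum infsum ?g UNIV) UNIV"
      by (rule has_sum_SigmaD[OF S]) (rule inner)
    then have "(\<lambda>m. \<Sum>n<N m. cinner (x (\<alpha> m n)) (\<beta> m n)) sums infsum ?g UNIV"
      by (rule has_sum_imp_sums)
    moreover have "(\<lambda>m. \<Sum>n<N m. cinner (x (\<alpha> m n)) (\<beta> m n)) sums \<phi> x"
    proof -
      have partial: "(\<Sum>m<M. \<Sum>n<N m. cinner (x (\<alpha> m n)) (\<beta> m n)) = \<phi> x - f M x" for M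
      proof (induction M)
        case 0
        then show ?case
          using f(1)[of 0] by (simp add: P_def)
      qed (simp add: ab(3))
      have "(\<lambda>M. c / 2 ^ M * onorm x) \<longlonglongrightarrow> 0"
      proof -
        have "(\<lambda>M. c * onorm x * (1 / 2) ^ M) \<longlonglongrightarrow> c * onorm x * 0"
          by (intro tendsto_intros LIMSEQ_power_zero) simp
        then show ?thesis
          by (simp add: power_divide)
      qed
      then have "(\<lambda>M. f M x) \<longlonglongrightarrow> 0"
        by (rule Lim_null_comparison[rotated]) (use f(1) x in \<open>simp add: P_def\<close>)
      then have "(\<lambda>M. \<phi> x - f M x) \<longlonglongrightarrow> \<phi> x - 0"
        by (intro tendsto_diff tendsto_const)
      then show ?thesis
        by (simp add: sums_def partial)
    qed
    ultimately have eq: "infsum ?g UNIV = \<phi> x"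
      by (rule sums_unique2)
    have "((\<lambda>i. ?g (prod_decode i)) has_sum infsum ?g UNIV) UNIV"
      using has_sum_reindex_bij_betw[OF bij_prod_decode, of ?g] has_sum_infsum[OF g] by simp
    from sums_unique[OF has_sum_imp_sums[OF this]] eq show ?thesis
      by simp
  qed
  moreover have "square_summable (\<lambda>i. \<alpha>' (prod_decode i))" "square_summable (\<lambda>i. \<beta>' (prod_decode i))"
    using sm(2,4) by (simp_all add: \<alpha>'_def \<beta>'_def)
  ultimately show ?thesis
    by (intro exI[of _ "\<lambda>i. \<alpha>' (prod_decode i)"] exI[of _ "\<lambda>i. \<beta>' (prod_decode i)"]) simp
qed

section \<open>The ultraweak topology\<close>

lemma openin_ultraweak:
  assumes "square_summable \<xi>" "square_summable \<eta>" "open U"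
  shows "openin ultraweak {x \<in> bounded_ops. (\<Sum>n. cinner (x (\<xi> n)) (\<eta> n)) \<in> U}"
  unfolding ultraweak_def using assms by (intro topology_generated_by_Basis) blast

lemma square_summable_zero: "square_summable (\<lambda>_. 0)"
  by (simp add: square_summable_def)

lemma topspace_ultraweak: "topspace ultraweak = bounded_ops"
proof
  show "topspace ultraweak \<subseteq> bounded_ops"
    unfolding ultraweak_def topology_generated_by_topspace by blast
  show "(bounded_ops :: 'a oper set) \<subseteq> topspace ultraweak"
    using openin_subset[OF openin_ultraweak[OF square_summable_zero square_summable_zero open_UNIV]]
    by simp
qed

text \<open>On norm bounded sets the functional is uniformly close to a finite kernel, and a finite
  kernel sees only finitely many entries.\<close>

lemma ultraweak_functional_tendsto:
  fixes x :: "'a ell2 oper"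
  assumes y: "\<forall>\<^sub>F i in F. y i \<in> bounded_ops \<and> onorm (y i) \<le> K" and x: "x \<in> bounded_ops"
    and entries: "\<And>s t. ((\<lambda>i. entry (y i) s t) \<longlongrightarrow> entry x s t) F"
    and sq: "square_summable \<xi>" "square_summable \<eta>"
  shows "((\<lambda>i. \<Sum>n. cinner (y i (\<xi> n)) (\<eta> n)) \<longlongrightarrow> (\<Sum>n. cinner (x (\<xi> n)) (\<eta> n))) F"
proof (rule tendstoI)
  fix e :: real assume e: "e > 0"
  \<comment> \<open>\<open>L\<close> bounds the norm of the difference \<open>D\<close> below; the
    summand 1 keeps it positive for the division.\<close>
  define L where "L = \<bar>K\<bar> + onorm x + 1"
  have L: "L > 0"
    using bounded_ops_onorm_nonneg[OF x] by (simp add: L_def)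
  then have "0 < e / (2 * L)"
    using e by simp
  with ultraweak_approx[OF sq] obtain E k where E: "finite E"
    and k: "\<forall>x\<in>bounded_ops. cmod ((\<Sum>n. cinner (x (\<xi> n)) (\<eta> n)) - ker_sum E k (entry x)) \<le> e / (2 * L) * onorm x"
    by (rule ker_approxE)
  have "((\<lambda>i. ker_sum E k (entry (y i)) - ker_sum E k (entry x)) \<longlongrightarrow>
      ker_sum E k (entry x) - ker_sum E k (entry x)) F"
    by (intro tendsto_diff tendsto_sum tendsto_mult tendsto_const entries)
  then have "\<forall>\<^sub>F i in F. cmod (ker_sum E k (entry (y i)) - ker_sum E k (entry x)) < e / 2"
    using e by (intro order_tendstoD(2)[of _ 0] tendsto_norm_zero) simp_all
  with y show "\<forall>\<^sub>F i in F. dist (\<Sum>n. cinner (y i (\<xi> n)) (\<eta> n)) (\<Sum>n. cinner (x (\<xi> n)) (\<eta> n)) < e"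
  proof eventually_elim
    case (elim i)
    define D where "D \<zeta> = y i \<zeta> - x \<zeta>" for \<zeta>
    have D: "D \<in> bounded_ops"
      unfolding D_def using elim x by (intro op_diff_bounded) auto
    have "onorm D \<le> L"
    proof (rule onorm_bound)
      fix \<zeta>
      have "norm (D \<zeta>) \<le> onorm (y i) * norm \<zeta> + onorm x * norm \<zeta>"
        unfolding D_def using elim x by (intro norm_triangle_le_diff add_mono bounded_ops_norm_le) auto
      also have "\<dots> = (onorm (y i) + onorm x) * norm \<zeta>"
        by (simp add: distrib_right)
      also have "\<dots> \<le> L * norm \<zeta>"
        using elim by (intro mult_right_mono) (auto simp: L_def)
      finally show "norm (D \<zeta>) \<le> L * norm \<zeta>" .
    qed (use L in simp)
    then have "e / (2 * L) * onorm D \<le> e / 2"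
      using mult_left_mono[of "onorm D" L "e / (2 * L)"] e L by simp
    then have 1: "cmod ((\<Sum>n. cinner (D (\<xi> n)) (\<eta> n)) - ker_sum E k (entry D)) \<le> e / 2"
      using bspec[OF k D] by linarith
    have sumD: "(\<Sum>n. cinner (D (\<xi> n)) (\<eta> n)) = (\<Sum>n. cinner (y i (\<xi> n)) (\<eta> n)) - (\<Sum>n. cinner (x (\<xi> n)) (\<eta> n))"
      unfolding D_def cinner_diff_left using elim x by (intro suminf_diff[symmetric] cinner_summable sq) auto
    have kerD: "ker_sum E k (entry D) = ker_sum E k (entry (y i)) - ker_sum E k (entry x)"
      by (simp add: D_def entry_eq_coord coord_minus right_diff_distrib sum_subtractf)
    have "cmod (ker_sum E k (entry D)) < e / 2"
      unfolding kerD using elim by simp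
    with 1 have "cmod (\<Sum>n. cinner (D (\<xi> n)) (\<eta> n)) < e"
      using norm_triangle_sub[of "(\<Sum>n. cinner (D (\<xi> n)) (\<eta> n))" "ker_sum E k (entry D)"] by linarith
    then show ?case
      unfolding dist_norm sumD .
  qed
qed

text \<open>Being eventually in an open set passes to finite intersections and to unions, so only
  subbasic sets have to be tested.\<close>

lemma limitin_ultraweak:
  fixes x :: "'a ell2 oper"
  assumes y: "\<forall>\<^sub>F i in F. y i \<in> bounded_ops \<and> onorm (y i) \<le> K" and x: "x \<in> bounded_ops"
    and entries: "\<And>s t. ((\<lambda>i. entry (y i) s t) \<longlongrightarrow> entry x s t) F"
  shows "limitin ultraweak y x F"
  unfolding limitin_def
proof (intro conjI allI impI)
  show "x \<in> topspace ultraweak"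
    by (simp add: topspace_ultraweak x)
  fix U :: "'a ell2 oper set"
  assume "openin ultraweak U \<and> x \<in> U"
  then have "generate_topology_on {{x \<in> bounded_ops. (\<Sum>n. cinner (x (\<xi> n)) (\<eta> n)) \<in> U} | \<xi> \<eta> U.
        square_summable \<xi> \<and> square_summable \<eta> \<and> open U} U" "x \<in> U"
    by (simp_all add: ultraweak_def openin_topology_generated_by_iff)
  then show "\<forall>\<^sub>F i in F. y i \<in> U"
  proof (induction rule: generate_topology_on.induct)
    case (Int a b)
    then show ?case
      by (auto intro: eventually_conj)
  next
    case (UN K)
    then obtain k where "k \<in> K" "x \<in> k"
      by blast
    with UN.IH[of k] show ?case
      by (auto elim: eventually_mono)
  next
    case (Basis s)
    then obtain \<xi> \<eta> V where s: "s = {x \<in> bounded_ops. (\<Sum>n. cinner (x (\<xi> n)) (\<eta> n)) \<in> V}"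
      and sq: "square_summable \<xi>" "square_summable \<eta>" and V: "open V"
      by blast
    have "\<forall>\<^sub>F i in F. (\<Sum>n. cinner (y i (\<xi> n)) (\<eta> n)) \<in> V"
      using Basis(2) s by (intro topological_tendstoD[OF ultraweak_functional_tendsto[OF y x entries sq] V]) simp
    with y show ?case
      by eventually_elim (simp add: s)
  qed simp
qed

lemma limitin_ultraweak_cinner:
  assumes "limitin ultraweak y x F"
  shows "((\<lambda>i. cinner (y i \<xi>) \<eta>) \<longlongrightarrow> cinner (x \<xi>) \<eta>) F"
proof (rule topological_tendstoI)
  fix U :: "complex set"
  assume U: "open U" "cinner (x \<xi>) \<eta> \<in> U"
  \<comment> \<open>Padding with zeros makes a single vector functional one of the series that
    define the topology.\<close>
  define X where "X \<zeta> n = (if n = 0 then \<zeta> else 0)" for \<zeta> :: 'a and n :: nat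
  have sq: "square_summable (X \<zeta>)" for \<zeta>
    unfolding square_summable_def by (rule summable_finite[of "{0}"]) (auto simp: X_def)
  have eq: "(\<Sum>n. cinner (z (X \<xi> n)) (X \<eta> n)) = cinner (z \<xi>) \<eta>" for z :: "'a oper"
    using suminf_finite[of "{0}" "\<lambda>n. cinner (z (X \<xi> n)) (X \<eta> n)"] by (simp add: X_def)
  have "x \<in> bounded_ops"
    using limitin_topspace[OF assms] by (simp add: topspace_ultraweak)
  then have "\<forall>\<^sub>F i in F. y i \<in> {x \<in> bounded_ops. cinner (x \<xi>) \<eta> \<in> U}"
    using assms openin_ultraweak[OF sq sq U(1), of \<xi> \<eta>] U(2) unfolding limitin_def eq by blast
  then show "\<forall>\<^sub>F i in F. cinner (y i \<xi>) \<eta> \<in> U"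
    by eventually_elim simp
qed

section \<open>Schur multipliers are completely bounded and normal\<close>

lemma linear_map_on_schur_op:
  assumes m: "schur_bound m C" and "M \<subseteq> bounded_ops"
  shows "linear_map_on M (schur_op m)"
  unfolding linear_map_on_def
proof (intro conjI ballI allI)
  fix x y c assume "x \<in> M" "y \<in> M"
  with assms(2) have b: "x \<in> bounded_ops" "y \<in> bounded_ops"
    by auto
  have e: "coord (schur_op m z (delta t)) s = m s t * coord (z (delta t)) s" if "z \<in> bounded_ops" for z s t
    using schur_op(2)[OF m that] by (simp add: entry_eq_coord)
  show "schur_op m (op_add x y) = op_add (schur_op m x) (schur_op m y)"
    by (rule schur_op_eqI)
      (auto intro: op_add_bounded schur_op(1)[OF m] b simp: entry_eq_coord coord_add e b distrib_left)
next
  fix c x assume "x \<in> M"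
  with assms(2) have b: "x \<in> bounded_ops"
    by auto
  have e: "coord (schur_op m x (delta t)) s = m s t * coord (x (delta t)) s" for s t
    using schur_op(2)[OF m b] by (simp add: entry_eq_coord)
  show "schur_op m (op_scale c x) = op_scale c (schur_op m x)"
    by (rule schur_op_eqI)
      (auto intro: op_scale_bounded schur_op(1)[OF m] b simp: entry_eq_coord coord_scaleC e)
qed

text \<open>The preimage of a subbasic set is cut out by the composed functional. This one is
  bounded and approximated by the kernels \<open>k s t * m s t\<close>, so it is given by a new pair
  of square summable sequences and the preimage is subbasic within \<open>M\<close>.\<close>

lemma normal_map_on_schur_op:
  fixes m :: "'a \<Rightarrow> 'a \<Rightarrow> complex"
  assumes m: "schur_bound m C" and M: "M \<subseteq> bounded_ops" and TM: "schur_op m ` M \<subseteq> M"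
  shows "normal_map_on M (schur_op m)"
proof -
  let ?T = "schur_op m"
  have top: "topspace (subtopology ultraweak M) = M"
    using M by (auto simp: topspace_ultraweak)
  have "continuous_map (subtopology ultraweak M) ultraweak ?T"
    unfolding ultraweak_def
  proof (subst ultraweak_def[symmetric], rule continuous_on_generated_topo)
    fix U :: "'a ell2 oper set"
    assume "U \<in> {{x \<in> bounded_ops. (\<Sum>n. cinner (x (\<xi> n)) (\<eta> n)) \<in> U} | \<xi> \<eta> U.
        square_summable \<xi> \<and> square_summable \<eta> \<and> open (U :: complex set)}"
    then obtain \<xi> \<eta> V where U: "U = {x \<in> bounded_ops. (\<Sum>n. cinner (x (\<xi> n)) (\<eta> n)) \<in> V}"
      and sq: "square_summable \<xi>" "square_summable \<eta>" and V: "open V"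
      by blast
    let ?\<phi> = "\<lambda>x. \<Sum>n. cinner (?T x (\<xi> n)) (\<eta> n)"
    let ?K = "\<Sum>n. norm (\<xi> n) * norm (\<eta> n)"
    have C: "0 \<le> C"
      by (rule schur_bound_nonneg[OF m])
    have K: "0 \<le> ?K"
      using cinner_summable(1)[OF sq] schur_op(1)[OF m] M bounded_opsI[of "\<lambda>_. 0" 0]
      by (intro suminf_nonneg) auto
    have bound: "cmod (?\<phi> x) \<le> (?K * C) * onorm x" if x: "x \<in> bounded_ops" for x
    proof -
      have "cmod (?\<phi> x) \<le> ?K * onorm (?T x)"
        by (rule ultraweak_functional_bound[OF sq schur_op(1)[OF m x]])
      also have "\<dots> \<le> ?K * (C * onorm x)"
        by (intro mult_left_mono K schur_op(3)[OF m x])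
      finally show ?thesis
        by (simp only: mult.assoc)
    qed
    have approx: "ker_approx ?\<phi>"
      unfolding ker_approx_def
    proof (intro allI impI)
      fix \<epsilon> :: real assume \<epsilon>: "\<epsilon> > 0"
      \<comment> \<open>\<open>C\<close> may be zero, hence the division by
        \<open>C + 1\<close>.\<close>
      then have "0 < \<epsilon> / (C + 1)"
        using C by simp
      with ultraweak_approx[OF sq] obtain E k where E: "finite E" and k: "\<forall>x\<in>bounded_ops.
          cmod ((\<Sum>n. cinner (x (\<xi> n)) (\<eta> n)) - ker_sum E k (entry x)) \<le> \<epsilon> / (C + 1) * onorm x"
        by (rule ker_approxE)
      have "cmod (?\<phi> x - ker_sum E (\<lambda>s t. k s t * m s t) (entry x)) \<le> \<epsilon> * onorm x"
        if x: "x \<in> bounded_ops" for x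
      proof -
        have "ker_sum E (\<lambda>s t. k s t * m s t) (entry x) = ker_sum E k (entry (?T x))"
          by (simp add: schur_op(2)[OF m x] mult.assoc)
        then have "cmod (?\<phi> x - ker_sum E (\<lambda>s t. k s t * m s t) (entry x)) \<le> \<epsilon> / (C + 1) * onorm (?T x)"
          using bspec[OF k schur_op(1)[OF m x]] by simp
        also have "\<dots> \<le> \<epsilon> / (C + 1) * ((C + 1) * onorm x)"
          using schur_op(3)[OF m x] bounded_ops_onorm_nonneg[OF x] \<epsilon> C
          by (intro mult_left_mono) (auto simp: distrib_right)
        finally show ?thesis
          using C by simp
      qed
      with E show "\<exists>E k. finite E \<and> (\<forall>x\<in>bounded_ops. cmod (?\<phi> x - ker_sum E k (entry x)) \<le> \<epsilon> * onorm x)"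
        by (intro exI[of _ E] exI[of _ "\<lambda>s t. k s t * m s t"]) simp
    qed
    have "\<forall>x\<in>bounded_ops. cmod (?\<phi> x) \<le> (?K * C) * onorm x"
      using bound by (rule ballI)
    from ker_approx_representation[OF approx this] obtain \<xi>' \<eta>' where
      sq': "square_summable \<xi>'" "square_summable \<eta>'"
      and rep: "\<forall>x\<in>bounded_ops. ?\<phi> x = (\<Sum>n. cinner (x (\<xi>' n)) (\<eta>' n))"
      by (elim exE conjE) (rule that)
    have "?T -` U \<inter> topspace (subtopology ultraweak M)
        = {x \<in> bounded_ops. (\<Sum>n. cinner (x (\<xi>' n)) (\<eta>' n)) \<in> V} \<inter> M"
      unfolding top U using rep M schur_op(1)[OF m] by auto
    then show "openin (subtopology ultraweak M) (?T -` U \<inter> topspace (subtopology ultraweak M))"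
      using openin_ultraweak[OF sq' V] by (auto simp: openin_subtopology)
  next
    show "?T ` topspace (subtopology ultraweak M) \<subseteq> \<Union> {{x \<in> bounded_ops. (\<Sum>n. cinner (x (\<xi> n)) (\<eta> n)) \<in> U} | \<xi> \<eta> U.
        square_summable \<xi> \<and> square_summable \<eta> \<and> open (U :: complex set)}"
      unfolding top topspace_ultraweak[unfolded ultraweak_def topology_generated_by_topspace]
      by (rule order_trans[OF TM M])
  qed
  then show ?thesis
    unfolding normal_map_on_def continuous_map_in_subtopology using top TM by auto
qed

section \<open>Matrix norms and complete boundedness\<close>

lemma matrix_norm_leI:
  assumes "\<And>\<xi>. L2_set (\<lambda>j. norm (\<xi> j)) {..<n} \<le> 1 \<Longrightarrow>
    L2_set (\<lambda>i. norm (\<Sum>j<n. a i j (\<xi> j))) {..<n} \<le> K"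
  shows "matrix_norm n a \<le> K"
  unfolding matrix_norm_def
proof (rule cSUP_least)
  have "L2_set (\<lambda>j. norm (0::'a)) {..<n} \<le> 1"
    by (simp add: L2_set_0')
  then show "{\<xi> :: nat \<Rightarrow> 'a. L2_set (\<lambda>j. norm (\<xi> j)) {..<n} \<le> 1} \<noteq> {}"
    by (auto intro: exI[of _ "\<lambda>_. 0"])
qed (use assms in auto)

text \<open>A real supremum is an upper bound only for a bounded set; here the sum of the norms of
  all entries bounds it. Homogeneity extends the estimate beyond the unit ball.\<close>

lemma matrix_norm_apply:
  assumes a: "\<And>i j. i < n \<Longrightarrow> j < n \<Longrightarrow> a i j \<in> bounded_ops"
  shows "L2_set (\<lambda>i. norm (\<Sum>j<n. a i j (\<xi> j))) {..<n} \<le> matrix_norm n a * L2_set (\<lambda>j. norm (\<xi> j)) {..<n}"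
proof -
  let ?l = "\<lambda>\<xi>. L2_set (\<lambda>i. norm (\<Sum>j<n. a i j (\<xi> j))) {..<n}"
  have unit: "?l \<xi> \<le> matrix_norm n a" if "L2_set (\<lambda>j. norm (\<xi> j)) {..<n} \<le> 1" for \<xi>
    unfolding matrix_norm_def
  proof (rule cSUP_upper)
    show "bdd_above (?l ` {\<xi>. L2_set (\<lambda>j. norm (\<xi> j)) {..<n} \<le> 1})"
    proof (rule bdd_aboveI2)
      fix \<xi> :: "nat \<Rightarrow> 'a"
      assume "\<xi> \<in> {\<xi>. L2_set (\<lambda>j. norm (\<xi> j)) {..<n} \<le> 1}"
      then have le: "norm (\<xi> j) \<le> 1" if "j < n" for j
        using member_le_L2_set[of "{..<n}" j "\<lambda>j. norm (\<xi> j)"] that by auto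
      have "?l \<xi> \<le> (\<Sum>i<n. norm (\<Sum>j<n. a i j (\<xi> j)))"
        by (rule L2_set_le_sum) simp
      also have "\<dots> \<le> (\<Sum>i<n. \<Sum>j<n. onorm (a i j))"
      proof (intro sum_mono order_trans[OF norm_sum])
        fix i j assume ij: "i \<in> {..<n}" "j \<in> {..<n}"
        then have "norm (a i j (\<xi> j)) \<le> onorm (a i j) * norm (\<xi> j)"
          by (intro bounded_ops_norm_le a) auto
        also have "\<dots> \<le> onorm (a i j) * 1"
          using ij by (intro mult_left_mono le bounded_ops_onorm_nonneg a) auto
        finally show "norm (a i j (\<xi> j)) \<le> onorm (a i j)"
          by simp
      qed
      finally show "?l \<xi> \<le> (\<Sum>i<n. \<Sum>j<n. onorm (a i j))" .
    qed
  qed (use that in simp)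
  let ?r = "L2_set (\<lambda>j. norm (\<xi> j)) {..<n}"
  show ?thesis
  proof (cases "?r = 0")
    case True
    then have "\<xi> j = 0" if "j < n" for j
      using that by (simp add: L2_set_eq_0_iff)
    then have "(\<Sum>j<n. a i j (\<xi> j)) = 0" if "i < n" for i
      using that a by (simp add: bounded_ops_zero)
    then have "?l \<xi> = 0"
      by (intro L2_set_0') simp
    with True show ?thesis
      by simp
  next
    case False
    then have r: "?r > 0"
      using L2_set_nonneg[of "\<lambda>j. norm (\<xi> j)" "{..<n}"] by linarith
    define \<zeta> where "\<zeta> j = complex_of_real (1 / ?r) *\<^sub>C \<xi> j" for j
    have "L2_set (\<lambda>j. norm (\<zeta> j)) {..<n} = 1 / ?r * ?r"
      using r L2_set_right_distrib[of "1 / ?r" "\<lambda>j. norm (\<xi> j)" "{..<n}"]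
      by (simp add: \<zeta>_def norm_scaleC norm_divide)
    then have "?l \<zeta> \<le> matrix_norm n a"
      using r by (intro unit) simp
    moreover have "?l \<zeta> = 1 / ?r * ?l \<xi>"
    proof -
      have "norm (\<Sum>j<n. a i j (\<zeta> j)) = 1 / ?r * norm (\<Sum>j<n. a i j (\<xi> j))" if i: "i < n" for i
      proof -
        have "(\<Sum>j<n. a i j (\<zeta> j)) = complex_of_real (1 / ?r) *\<^sub>C (\<Sum>j<n. a i j (\<xi> j))"
          unfolding scaleC_sum_right \<zeta>_def using i a by (intro sum.cong refl bounded_ops_scale) auto
        then show ?thesis
          using r by (simp add: norm_scaleC norm_divide)
      qed
      then have "?l \<zeta> = L2_set (\<lambda>i. 1 / ?r * norm (\<Sum>j<n. a i j (\<xi> j))) {..<n}"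
        by (intro L2_set_cong) auto
      also have "\<dots> = 1 / ?r * ?l \<xi>"
        using r by (intro L2_set_right_distrib[symmetric]) simp
      finally show ?thesis .
    qed
    ultimately show ?thesis
      using r by (simp add: field_simps)
  qed
qed

lemma matrix_norm_bilinear:
  assumes a: "\<And>i j. i < n \<Longrightarrow> j < n \<Longrightarrow> a i j \<in> bounded_ops"
  shows "cmod (\<Sum>i<n. \<Sum>j<n. cinner (a i j (\<xi> j)) (\<eta> i))
    \<le> matrix_norm n a * L2_set (\<lambda>j. norm (\<xi> j)) {..<n} * L2_set (\<lambda>i. norm (\<eta> i)) {..<n}"
proof -
  have "cmod (\<Sum>i<n. cinner (\<Sum>j<n. a i j (\<xi> j)) (\<eta> i))
      \<le> (\<Sum>i<n. \<bar>norm (\<Sum>j<n. a i j (\<xi> j))\<bar> * \<bar>norm (\<eta> i)\<bar>)"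
    by (intro order_trans[OF norm_sum] sum_mono order_trans[OF cinner_norm_le]) simp
  also have "\<dots> \<le> L2_set (\<lambda>i. norm (\<Sum>j<n. a i j (\<xi> j))) {..<n} * L2_set (\<lambda>i. norm (\<eta> i)) {..<n}"
    by (rule L2_set_mult_ineq)
  also have "\<dots> \<le> matrix_norm n a * L2_set (\<lambda>j. norm (\<xi> j)) {..<n} * L2_set (\<lambda>i. norm (\<eta> i)) {..<n}"
    by (intro mult_right_mono matrix_norm_apply a L2_set_nonneg)
  finally show ?thesis
    by (simp add: cinner_sum_left)
qed

lemma L2_set_swap:
  "L2_set (\<lambda>j. L2_set (\<lambda>t. f j t) E) J = L2_set (\<lambda>t. L2_set (\<lambda>j. f j t) J) E"
  by (simp add: L2_set_def sum_nonneg) (rule sum.swap)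

text \<open>Smith's trick: writing \<open>\<xi> j t = c j t * d t\<close> with \<open>d t\<close> the length of \<open>(\<xi> j t)\<^sub>j\<close>, and similarly
  for \<open>\<eta>\<close>, the diagonal contractions \<open>c j\<close> can be moved through the Schur multiplier, which is then
  applied to a single contraction \<open>b\<close> and evaluated at the single vector \<open>d\<close>.\<close>

lemma schur_matrix_bilinear:
  fixes m :: "'a \<Rightarrow> 'a \<Rightarrow> complex" and a :: "nat \<Rightarrow> nat \<Rightarrow> 'a ell2 oper"
  assumes m: "schur_bound m C" and a: "\<And>i j. i < n \<Longrightarrow> j < n \<Longrightarrow> a i j \<in> bounded_ops"
    and norm: "matrix_norm n a \<le> 1" and E: "finite E"
  shows "cmod (\<Sum>i<n. \<Sum>j<n. \<Sum>s\<in>E. \<Sum>t\<in>E. m s t * entry (a i j) s t * coord (\<xi> j) t * cnj (coord (\<eta> i) s))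
    \<le> C * L2_set (\<lambda>j. norm (\<xi> j)) {..<n} * L2_set (\<lambda>i. norm (\<eta> i)) {..<n}"
proof -
  define len where "len \<zeta> t = L2_set (\<lambda>j. cmod (coord (\<zeta> j) t)) {..<n}" for \<zeta> :: "nat \<Rightarrow> 'a ell2" and t
  define dir where "dir \<zeta> j t = coord (\<zeta> j) t / complex_of_real (len \<zeta> t)" for \<zeta> :: "nat \<Rightarrow> 'a ell2" and j t
  \<comment> \<open>When \<open>len \<zeta> t = 0\<close> all coordinates at \<open>t\<close> vanish
    and the quotient defining \<open>dir\<close> is 0, so the identity persists.\<close>
  have dir: "dir \<zeta> j t * complex_of_real (len \<zeta> t) = coord (\<zeta> j) t" if "j < n" for \<zeta> j t
  proof (cases "len \<zeta> t = 0")
    case True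
    then have "coord (\<zeta> j) t = 0"
      using that by (simp add: len_def L2_set_eq_0_iff)
    then show ?thesis
      by (simp add: dir_def)
  qed (simp add: dir_def)
  have dir_le: "L2_set (\<lambda>j. cmod (dir \<zeta> j t)) {..<n} \<le> 1" for \<zeta> t
  proof -
    have "L2_set (\<lambda>j. cmod (dir \<zeta> j t)) {..<n} = L2_set (\<lambda>j. inverse (len \<zeta> t) * cmod (coord (\<zeta> j) t)) {..<n}"
      by (intro L2_set_cong refl)
        (simp add: dir_def norm_mult norm_inverse len_def L2_set_nonneg divide_inverse mult.commute)
    also have "\<dots> = inverse (len \<zeta> t) * len \<zeta> t"
      unfolding len_def by (intro L2_set_right_distrib[symmetric]) (simp add: L2_set_nonneg)
    finally show ?thesis
      by (cases "len \<zeta> t = 0") simp_all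
  qed
  \<comment> \<open>The diagonal operators with entries \<open>dir \<zeta> j t\<close> form a
    contraction of \<open>ell2\<close> into the direct sum, because the directions at each
    \<open>t\<close> have length at most 1. Compressing \<open>a\<close> by two such columns will
    give \<open>b\<close>.\<close>
  have dir_vec: "L2_set (\<lambda>j. norm (fvec F (\<lambda>t. dir \<zeta> j t * x t))) {..<n} \<le> L2_set (\<lambda>t. cmod (x t)) F"
    if F: "finite F" for F \<zeta> x
  proof -
    have "L2_set (\<lambda>j. norm (fvec F (\<lambda>t. dir \<zeta> j t * x t))) {..<n}
        = L2_set (\<lambda>t. L2_set (\<lambda>j. cmod (x t) * cmod (dir \<zeta> j t)) {..<n}) F"
      unfolding norm_fvec[OF F] by (subst L2_set_swap) (simp add: norm_mult mult.commute)
    also have "\<dots> = L2_set (\<lambda>t. cmod (x t) * L2_set (\<lambda>j. cmod (dir \<zeta> j t)) {..<n}) F"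
      by (simp add: L2_set_right_distrib)
    also have "\<dots> \<le> L2_set (\<lambda>t. cmod (x t) * 1) F"
      by (intro L2_set_mono mult_left_mono dir_le) (auto simp: L2_set_nonneg)
    finally show ?thesis
      by simp
  qed
  have len_le: "L2_set (\<lambda>t. cmod (complex_of_real (len \<zeta> t))) E \<le> L2_set (\<lambda>j. norm (\<zeta> j)) {..<n}" for \<zeta>
  proof -
    have "L2_set (\<lambda>t. cmod (complex_of_real (len \<zeta> t))) E = L2_set (\<lambda>t. len \<zeta> t) E"
      by (simp add: len_def L2_set_nonneg)
    also have "\<dots> = L2_set (\<lambda>j. L2_set (\<lambda>t. cmod (coord (\<zeta> j) t)) E) {..<n}"
      unfolding len_def by (rule L2_set_swap[symmetric])
    also have "\<dots> \<le> L2_set (\<lambda>j. norm (\<zeta> j)) {..<n}"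
      using E by (intro L2_set_mono L2_coord_le L2_set_nonneg) auto
    finally show ?thesis .
  qed
  define b where "b s t = (\<Sum>i<n. \<Sum>j<n. cnj (dir \<eta> i s) * entry (a i j) s t * dir \<xi> j t)" for s t
  have swap4: "(\<Sum>i<n. \<Sum>j<n. \<Sum>s\<in>F. \<Sum>t\<in>F. f i j s t) = (\<Sum>s\<in>F. \<Sum>t\<in>F. \<Sum>i<n. \<Sum>j<n. f i j s t)"
    for F :: "'a set" and f :: "nat \<Rightarrow> nat \<Rightarrow> 'a \<Rightarrow> 'a \<Rightarrow> complex"
  proof -
    have "(\<Sum>i<n. \<Sum>j<n. \<Sum>s\<in>F. \<Sum>t\<in>F. f i j s t) = (\<Sum>i<n. \<Sum>s\<in>F. \<Sum>j<n. \<Sum>t\<in>F. f i j s t)"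
      by (intro sum.cong refl sum.swap)
    also have "\<dots> = (\<Sum>s\<in>F. \<Sum>i<n. \<Sum>j<n. \<Sum>t\<in>F. f i j s t)"
      by (rule sum.swap)
    also have "\<dots> = (\<Sum>s\<in>F. \<Sum>i<n. \<Sum>t\<in>F. \<Sum>j<n. f i j s t)"
      by (intro sum.cong refl sum.swap)
    also have "\<dots> = (\<Sum>s\<in>F. \<Sum>t\<in>F. \<Sum>i<n. \<Sum>j<n. f i j s t)"
      by (intro sum.cong refl sum.swap)
    finally show ?thesis .
  qed
  have "mat_bound b 1"
  proof (rule mat_boundI_bilinear)
    fix F :: "'a set" and x y :: "'a \<Rightarrow> complex"
    assume F: "finite F"
    let ?x = "\<lambda>j. fvec F (\<lambda>t. dir \<xi> j t * x t)" and ?y = "\<lambda>i. fvec F (\<lambda>s. dir \<eta> i s * y s)"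
    have "(\<Sum>s\<in>F. \<Sum>t\<in>F. b s t * x t * cnj (y s))
        = (\<Sum>s\<in>F. \<Sum>t\<in>F. \<Sum>i<n. \<Sum>j<n. entry (a i j) s t * (dir \<xi> j t * x t) * cnj (dir \<eta> i s * y s))"
      unfolding b_def sum_distrib_right by (simp only: complex_cnj_mult mult_ac)
    also have "\<dots> = (\<Sum>i<n. \<Sum>j<n. \<Sum>s\<in>F. \<Sum>t\<in>F. entry (a i j) s t * (dir \<xi> j t * x t) * cnj (dir \<eta> i s * y s))"
      by (rule swap4[symmetric])
    also have "\<dots> = (\<Sum>i<n. \<Sum>j<n. cinner (a i j (?x j)) (?y i))"
      by (intro sum.cong refl entry_cinner_fvec[symmetric] a F) auto
    also have "cmod \<dots> \<le> matrix_norm n a * L2_set (\<lambda>j. norm (?x j)) {..<n} * L2_set (\<lambda>i. norm (?y i)) {..<n}"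
      by (rule matrix_norm_bilinear[OF a])
    also have "\<dots> \<le> 1 * L2_set (\<lambda>t. cmod (x t)) F * L2_set (\<lambda>s. cmod (y s)) F"
      by (intro mult_mono norm dir_vec F) (auto simp: L2_set_nonneg)
    finally show "cmod (\<Sum>s\<in>F. \<Sum>t\<in>F. b s t * x t * cnj (y s))
      \<le> 1 * L2_set (\<lambda>t. cmod (x t)) F * L2_set (\<lambda>s. cmod (y s)) F" .
  qed simp
  with m have mb: "mat_bound (\<lambda>s t. m s t * b s t) C"
    by (simp add: schur_bound_def)
  have "(\<Sum>i<n. \<Sum>j<n. \<Sum>s\<in>E. \<Sum>t\<in>E. m s t * entry (a i j) s t * coord (\<xi> j) t * cnj (coord (\<eta> i) s))
      = (\<Sum>i<n. \<Sum>j<n. \<Sum>s\<in>E. \<Sum>t\<in>E. m s t * entry (a i j) s t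
          * (dir \<xi> j t * complex_of_real (len \<xi> t)) * cnj (dir \<eta> i s * complex_of_real (len \<eta> s)))"
    by (intro sum.cong refl) (simp only: dir lessThan_iff)
  also have "\<dots> = (\<Sum>s\<in>E. \<Sum>t\<in>E. \<Sum>i<n. \<Sum>j<n. m s t * entry (a i j) s t
          * (dir \<xi> j t * complex_of_real (len \<xi> t)) * cnj (dir \<eta> i s * complex_of_real (len \<eta> s)))"
    by (rule swap4)
  also have "\<dots> = (\<Sum>s\<in>E. \<Sum>t\<in>E. (m s t * b s t) * complex_of_real (len \<xi> t) * cnj (complex_of_real (len \<eta> s)))"
    unfolding b_def sum_distrib_right sum_distrib_left
    by (simp only: complex_cnj_mult complex_cnj_complex_of_real mult_ac)
  also have "cmod \<dots> \<le> C * L2_set (\<lambda>t. cmod (complex_of_real (len \<xi> t))) E * L2_set (\<lambda>s. cmod (complex_of_real (len \<eta> s))) E"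
    by (rule mat_bound_bilinear[OF mb E E])
  also have "\<dots> \<le> C * L2_set (\<lambda>j. norm (\<xi> j)) {..<n} * L2_set (\<lambda>i. norm (\<eta> i)) {..<n}"
    by (intro mult_mono len_le schur_bound_nonneg[OF m] order_refl mult_nonneg_nonneg L2_set_nonneg)
  finally show ?thesis .
qed

text \<open>The bilinear estimate is uniform in the finite section, so it survives the limit.
  Testing it against the image vector and cancelling one factor gives the norm.\<close>

lemma matrix_norm_schur_op_le:
  fixes m :: "'a \<Rightarrow> 'a \<Rightarrow> complex" and a :: "nat \<Rightarrow> nat \<Rightarrow> 'a ell2 oper"
  assumes m: "schur_bound m C" and a: "\<And>i j. i < n \<Longrightarrow> j < n \<Longrightarrow> a i j \<in> bounded_ops"
    and norm: "matrix_norm n a \<le> 1"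
  shows "matrix_norm n (\<lambda>i j. schur_op m (a i j)) \<le> C"
proof (rule matrix_norm_leI)
  fix \<xi> :: "nat \<Rightarrow> 'a ell2"
  assume \<xi>: "L2_set (\<lambda>j. norm (\<xi> j)) {..<n} \<le> 1"
  define \<eta> where "\<eta> i = (\<Sum>j<n. schur_op m (a i j) (\<xi> j))" for i
  let ?Y = "L2_set (\<lambda>i. norm (\<eta> i)) {..<n}"
  have C: "0 \<le> C"
    by (rule schur_bound_nonneg[OF m])
  have "((\<lambda>E. cmod (\<Sum>i<n. \<Sum>j<n. \<Sum>s\<in>E. \<Sum>t\<in>E. entry (schur_op m (a i j)) s t * coord (\<xi> j) t * cnj (coord (\<eta> i) s)))
      \<longlongrightarrow> cmod (\<Sum>i<n. \<Sum>j<n. cinner (schur_op m (a i j) (\<xi> j)) (\<eta> i))) (finite_subsets_at_top UNIV)"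
    by (intro tendsto_norm tendsto_sum entry_cinner_tendsto schur_op(1)[OF m] a) auto
  then have "cmod (\<Sum>i<n. \<Sum>j<n. cinner (schur_op m (a i j) (\<xi> j)) (\<eta> i))
      \<le> C * L2_set (\<lambda>j. norm (\<xi> j)) {..<n} * ?Y"
  proof (rule tendsto_upperbound)
    have "(\<Sum>i<n. \<Sum>j<n. \<Sum>s\<in>E. \<Sum>t\<in>E. entry (schur_op m (a i j)) s t * coord (\<xi> j) t * cnj (coord (\<eta> i) s))
        = (\<Sum>i<n. \<Sum>j<n. \<Sum>s\<in>E. \<Sum>t\<in>E. m s t * entry (a i j) s t * coord (\<xi> j) t * cnj (coord (\<eta> i) s))" for E
      by (intro sum.cong refl) (simp add: schur_op(2)[OF m] a)
    then show "\<forall>\<^sub>F E in finite_subsets_at_top UNIV.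
        cmod (\<Sum>i<n. \<Sum>j<n. \<Sum>s\<in>E. \<Sum>t\<in>E. entry (schur_op m (a i j)) s t * coord (\<xi> j) t * cnj (coord (\<eta> i) s))
        \<le> C * L2_set (\<lambda>j. norm (\<xi> j)) {..<n} * ?Y"
      by (intro eventually_finite_subsets_at_top_weakI) (simp only: schur_matrix_bilinear[OF m a norm])
  qed simp
  also have "(\<Sum>i<n. \<Sum>j<n. cinner (schur_op m (a i j) (\<xi> j)) (\<eta> i)) = complex_of_real (?Y\<^sup>2)"
    by (simp add: cinner_sum_left[symmetric] \<eta>_def[symmetric] cinner_self L2_set_def sum_nonneg)
  finally have "?Y\<^sup>2 \<le> C * L2_set (\<lambda>j. norm (\<xi> j)) {..<n} * ?Y"
    unfolding norm_of_real by simp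
  also have "\<dots> \<le> (C * 1) * ?Y"
    by (intro mult_right_mono mult_left_mono \<xi> C L2_set_nonneg)
  finally have "?Y \<le> C"
    using le_of_square_le_mult[of ?Y C] C by (simp add: L2_set_nonneg)
  then show "L2_set (\<lambda>i. norm (\<Sum>j<n. schur_op m (a i j) (\<xi> j))) {..<n} \<le> C"
    by (simp add: \<eta>_def)
qed

lemma cb_norm_schur_op_le:
  assumes "schur_bound m C" "M \<subseteq> bounded_ops"
  shows "cb_norm M (schur_op m) \<le> ereal C"
  unfolding cb_norm_def using assms by (intro SUP_least) (auto intro!: matrix_norm_schur_op_le)

section \<open>Compact diagonal operators\<close>

text \<open>Adding a coordinate to \<open>F\<close> gives a continuous image of the product of a
  disc with the previous box.\<close>

lemma compact_box:
  assumes "finite F"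
  shows "compact {w :: 'b ell2. (\<forall>i. i \<notin> F \<longrightarrow> coord w i = 0) \<and> (\<forall>i\<in>F. cmod (coord w i) \<le> K)}"
  using assms
proof (induction F)
  case empty
  have "{w :: 'b ell2. (\<forall>i. i \<notin> {} \<longrightarrow> coord w i = 0) \<and> (\<forall>i\<in>{}. cmod (coord w i) \<le> K)} \<subseteq> {0}"
    by (auto intro!: ell2_eqI simp: coord_zero)
  then show ?case
    by (rule finite_imp_compact[OF finite_subset]) simp
next
  case (insert j F)
  let ?B = "\<lambda>F. {w :: 'b ell2. (\<forall>i. i \<notin> F \<longrightarrow> coord w i = 0) \<and> (\<forall>i\<in>F. cmod (coord w i) \<le> K)}"
  let ?h = "\<lambda>p :: complex \<times> 'b ell2. fst p *\<^sub>C delta j + snd p"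
  have "bounded_linear (\<lambda>z. z *\<^sub>C (delta j :: 'b ell2))"
    by (rule bounded_linear_intro[where K = 1])
      (simp_all add: scaleC_add_left norm_scaleC scaleC_scaleC scaleR_conv_of_real flip: scaleC_of_real)
  then have "continuous_on S (\<lambda>p :: complex \<times> 'b ell2. fst p *\<^sub>C delta j)" for S
    by (rule bounded_linear.continuous_on) (intro continuous_intros)
  then have cont: "continuous_on S ?h" for S
    by (intro continuous_intros)
  have "compact (?h ` (cball 0 K \<times> ?B F))"
    by (intro compact_continuous_image cont compact_Times insert.IH compact_cball)
  moreover have "?h ` (cball 0 K \<times> ?B F) = ?B (insert j F)"
  proof (intro equalityI subsetI)
    fix w assume "w \<in> ?h ` (cball 0 K \<times> ?B F)"
    then show "w \<in> ?B (insert j F)"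
      using insert.hyps(2) by (auto simp: coord_add coord_scaleC coord_delta)
  next
    fix w assume w: "w \<in> ?B (insert j F)"
    let ?v = "w - coord w j *\<^sub>C delta j"
    have "?v \<in> ?B F"
      using w insert.hyps(2) by (auto simp: coord_minus coord_scaleC coord_delta)
    moreover have "coord w j \<in> cball 0 K"
      using w by simp
    moreover have "w = ?h (coord w j, ?v)"
      by simp
    ultimately show "w \<in> ?h ` (cball 0 K \<times> ?B F)"
      by blast
  qed
  ultimately show ?case
    by simp
qed

text \<open>Truncations of finite rank converge in norm: outside the finitely many coordinates with
  large coefficient the operator is small, and on those coordinates the image of the unit ball lies
  in a compact box. The set \<open>V\<close> is arbitrary because compactness is asked on the
  closure of an embedded algebra.\<close>

lemma diagonal_operator:
  fixes \<mu> :: "'b \<Rightarrow> complex"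
  assumes \<mu>: "\<And>\<epsilon>. \<epsilon> > 0 \<Longrightarrow> finite {i. \<epsilon> \<le> cmod (\<mu> i)}"
  shows "\<exists>S\<in>bounded_ops. (\<forall>w i. coord (S w) i = \<mu> i * coord w i) \<and>
    (\<forall>V. compact (closure (S ` (V \<inter> cball 0 1))))"
proof -
  have "bounded (\<mu> ` UNIV)"
  proof -
    have "\<mu> ` UNIV \<subseteq> cball 0 1 \<union> \<mu> ` {i. 1 \<le> cmod (\<mu> i)}"
      by force
    then show ?thesis
      by (rule bounded_subset[rotated]) (simp add: \<mu> finite_imp_bounded)
  qed
  then obtain K where K: "K > 0" "\<And>i. cmod (\<mu> i) \<le> K"
    by (auto simp: bounded_pos)
  have bound: "\<exists>y. coord y = (\<lambda>i. \<nu> i * coord w i) \<and> norm y \<le> L * norm w"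
    if L: "\<And>i. cmod (\<nu> i) \<le> L" for \<nu> :: "'b \<Rightarrow> complex" and w and L :: real
  proof (rule ell2I)
    fix E :: "'b set" assume E: "finite E"
    have L0: "0 \<le> L"
      using order_trans[OF norm_ge_zero L] .
    have "L2_set (\<lambda>i. cmod (\<nu> i * coord w i)) E \<le> L2_set (\<lambda>i. L * cmod (coord w i)) E"
      unfolding norm_mult by (intro L2_set_mono mult_right_mono L) auto
    also have "\<dots> = L * L2_set (\<lambda>i. cmod (coord w i)) E"
      by (rule L2_set_right_distrib[symmetric]) (rule L0)
    also have "\<dots> \<le> L * norm w"
      by (intro mult_left_mono L2_coord_le E L0)
    finally show "L2_set (\<lambda>i. cmod (\<nu> i * coord w i)) E \<le> L * norm w" .
  qed
  have "\<forall>w. \<exists>y. coord y = (\<lambda>i. \<mu> i * coord w i) \<and> norm y \<le> K * norm w"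
    using bound[of \<mu> K] K(2) by blast
  then obtain S where S: "\<And>w. coord (S w) = (\<lambda>i. \<mu> i * coord w i)" "\<And>w. norm (S w) \<le> K * norm w"
    by metis
  have "S \<in> bounded_ops"
    by (rule bounded_opsI[where K = K])
      (auto intro!: ell2_eqI simp: S coord_add coord_scaleC algebra_simps)
  moreover have "compact (closure (S ` (V \<inter> cball 0 1)))" for V
    unfolding compact_eq_totally_bounded
  proof (intro conjI allI impI)
    show "complete (closure (S ` (V \<inter> cball 0 1)))"
      by (simp add: complete_eq_closed)
    fix e :: real assume e: "e > 0"
    \<comment> \<open>Balls of radius \<open>e / 4\<close> covering the box and a remainder of norm
      at most \<open>e / 4\<close> yield closed balls of radius \<open>e / 2\<close>. Finitely many
      of these form a closed set, so they cover the closure as well.\<close>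
    define F where "F = {i. e / 4 \<le> cmod (\<mu> i)}"
    have F: "finite F"
      unfolding F_def using e by (intro \<mu>) simp
    let ?B = "{w :: 'b ell2. (\<forall>i. i \<notin> F \<longrightarrow> coord w i = 0) \<and> (\<forall>i\<in>F. cmod (coord w i) \<le> K)}"
    have "0 < e / 4"
      using e by simp
    then obtain k where k: "finite k" "?B \<subseteq> (\<Union>x\<in>k. ball x (e / 4))"
      using compact_box[OF F, of K] unfolding compact_eq_totally_bounded by blast
    have "S ` (V \<inter> cball 0 1) \<subseteq> (\<Union>x\<in>k. cball x (e / 2))"
    proof
      fix z assume "z \<in> S ` (V \<inter> cball 0 1)"
      then obtain w where w: "norm w \<le> 1" "z = S w"
        by auto
      let ?v = "fvec F (coord z)"
      have "cmod (coord z i) \<le> K" for i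
      proof -
        have "cmod (coord z i) \<le> norm z"
          by (rule cmod_coord_le)
        also have "\<dots> \<le> K * norm w"
          unfolding w(2) by (rule S(2))
        also have "\<dots> \<le> K"
          using mult_left_mono[OF w(1), of K] K(1) by simp
        finally show ?thesis .
      qed
      then have "?v \<in> ?B"
        by (simp add: coord_fvec[OF F])
      with k(2) obtain x where x: "x \<in> k" "dist x ?v < e / 4"
        by auto
      define \<nu> where "\<nu> i = (if i \<in> F then 0 else \<mu> i)" for i
      have "cmod (\<nu> i) \<le> e / 4" for i
        using e by (auto simp: \<nu>_def F_def)
      from bound[of \<nu> "e / 4" w, OF this] obtain y
        where y: "coord y = (\<lambda>i. \<nu> i * coord w i)" "norm y \<le> e / 4 * norm w"
        by blast
      have "y = z - ?v"
        by (rule ell2_eqI) (simp add: y(1) w(2) S(1) coord_minus coord_fvec[OF F] \<nu>_def)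
      moreover have "e / 4 * norm w \<le> e / 4"
        using mult_left_mono[OF w(1), of "e / 4"] e by simp
      ultimately have "dist z ?v \<le> e / 4"
        using y(2) by (simp add: dist_norm)
      then have "dist x z \<le> e / 2"
        using x(2) dist_triangle2[of x z ?v] by linarith
      with x(1) show "z \<in> (\<Union>x\<in>k. cball x (e / 2))"
        by auto
    qed
    then have "closure (S ` (V \<inter> cball 0 1)) \<subseteq> (\<Union>x\<in>k. cball x (e / 2))"
      using k(1) by (intro closure_minimal) auto
    also have "\<dots> \<subseteq> (\<Union>x\<in>k. ball x e)"
      using e by (intro UN_mono) auto
    finally show "\<exists>k. finite k \<and> closure (S ` (V \<inter> cball 0 1)) \<subseteq> (\<Union>x\<in>k. ball x e)"
      using k(1) by blast
  qed
  ultimately show ?thesis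
    using S(1) by (intro bexI[of _ S]) simp_all
qed

section \<open>From multipliers to maps on the group von Neumann algebra\<close>

text \<open>Evaluation at \<open>delta 0\<close> is isometric for the trace inner product, so
  \<open>ell2\<close> over the group serves as a model of the completion.\<close>

lemma trace_inner_group_trace:
  assumes "y \<in> bounded_ops"
  shows "trace_inner group_trace x y = cinner (x (delta 0)) (y (delta 0))"
proof -
  have "cinner (adjoint y (x (delta 0))) (delta 0) = cnj (cinner (delta 0) (adjoint y (x (delta 0))))"
    by (rule cinner_commute)
  also have "\<dots> = cnj (cinner (y (delta 0)) (x (delta 0)))"
    by (simp only: adjoint_op(2)[OF assms])
  also have "\<dots> = cinner (x (delta 0)) (y (delta 0))"
    by (rule cinner_commute[symmetric])
  finally show ?thesis
    by (simp only: trace_inner_def group_trace_def o_apply)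
qed

text \<open>\<open>extends_to_compact_on_L2\<close> prescribes the type \<open>'h oper ell2\<close>
  for the model, so \<open>ell2\<close> over the group has to be carried there along an injection of
  the index types.\<close>

lemma embed_ell2:
  fixes f :: "'a \<Rightarrow> 'b"
  assumes f: "inj f"
  shows "\<exists>e. (\<forall>x i. coord (e x) (f i) = coord x i) \<and> (\<forall>x j. j \<notin> range f \<longrightarrow> coord (e x) j = 0) \<and>
    (\<forall>x y. cinner (e x) (e y) = cinner x y)"
proof -
  have "\<exists>y. coord y = (\<lambda>j. if j \<in> range f then coord x (inv f j) else 0) \<and> norm y \<le> norm x" for x
  proof (rule ell2I)
    fix E :: "'b set" assume E: "finite E"
    have fin: "finite (f -` E)"
      by (rule finite_vimageI[OF E f])
    have "(\<Sum>j\<in>E. (cmod (if j \<in> range f then coord x (inv f j) else 0))\<^sup>2)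
        = (\<Sum>j\<in>f ` (f -` E). (cmod (coord x (inv f j)))\<^sup>2)"
      using E by (intro sum.mono_neutral_cong_right) auto
    also have "\<dots> = (\<Sum>i\<in>f -` E. (cmod (coord x i))\<^sup>2)"
      by (subst sum.reindex[OF inj_on_subset[OF f subset_UNIV]]) (simp add: inv_f_f[OF f])
    also have "sqrt \<dots> \<le> norm x"
      using L2_coord_le[OF fin, of x] by (simp add: L2_set_def)
    finally show "L2_set (\<lambda>j. cmod (if j \<in> range f then coord x (inv f j) else 0)) E \<le> norm x"
      by (simp add: L2_set_def)
  qed
  then obtain e where e: "\<And>x. coord (e x) = (\<lambda>j. if j \<in> range f then coord x (inv f j) else 0)"
    by metis
  have "cinner (e x) (e y) = cinner x y" for x y
  proof -
    have "cinner (e x) (e y) = (\<Sum>\<^sub>\<infinity>j\<in>range f. coord (e x) j * cnj (coord (e y) j))"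
      unfolding cinner_ell2 by (rule infsum_cong_neutral) (auto simp: e)
    also have "\<dots> = cinner x y"
      unfolding cinner_ell2 by (subst infsum_reindex[OF f]) (simp add: e o_def inv_f_f[OF f])
    finally show ?thesis .
  qed
  then show ?thesis
    by (intro exI[of _ e]) (simp add: e inv_f_f[OF f])
qed

text \<open>In the model given by evaluation at \<open>delta 0\<close>, transported along
  \<open>left_regular\<close>, the map is diagonal. The diagonal operator preserves the closure of
  the embedded algebra by continuity.\<close>

lemma extends_to_compact_on_L2_diagonal:
  fixes M :: "'g::group_add ell2 oper set"
  assumes M: "M \<subseteq> bounded_ops" "T ` M \<subseteq> M"
    and diag: "\<And>x g. x \<in> M \<Longrightarrow> coord (T x (delta 0)) g = \<mu> g * coord (x (delta 0)) g"
    and \<mu>: "\<And>\<epsilon>. \<epsilon> > 0 \<Longrightarrow> finite {g. \<epsilon> \<le> cmod (\<mu> g)}"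
  shows "extends_to_compact_on_L2 M group_trace T"
proof -
  let ?\<iota> = "left_regular :: 'g \<Rightarrow> 'g ell2 oper"
  have inj: "inj ?\<iota>"
  proof (rule injI)
    fix g h :: 'g
    assume "left_regular g = left_regular h"
    then have "delta (g + 0) = delta (h + 0)"
      by (metis left_regular_delta)
    then have "coord (delta g) g = coord (delta h) g"
      by simp
    then show "g = h"
      by (simp add: coord_delta split: if_splits)
  qed
  obtain e :: "'g ell2 \<Rightarrow> 'g ell2 oper ell2" where e: "\<And>x g. coord (e x) (?\<iota> g) = coord x g"
      "\<And>x j. j \<notin> range ?\<iota> \<Longrightarrow> coord (e x) j = 0" "\<And>x y. cinner (e x) (e y) = cinner x y"
    using embed_ell2[OF inj] by blast
  define J where "J x = e (x (delta 0))" for x :: "'g ell2 oper"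
  have e_eqI: "v = e x" if "\<And>g. coord v (?\<iota> g) = coord x g" "\<And>j. j \<notin> range ?\<iota> \<Longrightarrow> coord v j = 0" for v x
  proof (rule ell2_eqI)
    fix j
    show "coord v j = coord (e x) j"
      by (cases "j \<in> range ?\<iota>") (auto simp: that e)
  qed
  have J: "L2_embedding M group_trace J"
    unfolding L2_embedding_def
  proof (intro conjI ballI allI)
    fix x y assume "x \<in> M" "y \<in> M"
    show "J (op_add x y) = J x + J y"
      unfolding J_def by (rule e_eqI[symmetric]) (simp_all add: coord_add e)
    show "cinner (J x) (J y) = trace_inner group_trace x y"
      using \<open>y \<in> M\<close> M(1) by (simp add: J_def e(3) trace_inner_group_trace subset_iff)
  next
    fix c x
    show "J (op_scale c x) = c *\<^sub>C J x"
      unfolding J_def by (rule e_eqI[symmetric]) (simp_all add: coord_scaleC e)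
  qed
  \<comment> \<open>Coefficients outside the copy of the group are zero, so the sets where they
    exceed a positive bound stay finite.\<close>
  define \<nu> where "\<nu> j = (if j \<in> range ?\<iota> then \<mu> (inv ?\<iota> j) else 0)" for j
  have \<nu>_\<iota>: "\<nu> (?\<iota> g) = \<mu> g" for g
    by (simp add: \<nu>_def inv_f_f[OF inj])
  have "finite {j. \<epsilon> \<le> cmod (\<nu> j)}" if "\<epsilon> > 0" for \<epsilon>
  proof (rule finite_subset)
    show "{j. \<epsilon> \<le> cmod (\<nu> j)} \<subseteq> ?\<iota> ` {g. \<epsilon> \<le> cmod (\<mu> g)}"
      using that by (auto simp: \<nu>_def inv_f_f[OF inj] split: if_splits)
  qed (simp add: \<mu>[OF that])
  from diagonal_operator[of \<nu>, OF this] obtain S where S: "S \<in> bounded_ops"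
      "\<And>w i. coord (S w) i = \<nu> i * coord w i" "\<And>V. compact (closure (S ` (V \<inter> cball 0 1)))"
    by blast
  have SJ: "S (J x) = J (T x)" if "x \<in> M" for x
    unfolding J_def by (rule e_eqI) (simp_all add: S(2) e diag[OF that] \<nu>_\<iota>)
  have "compact_operator_on (closure (J ` M)) S"
    unfolding compact_operator_on_def
  proof (intro conjI ballI allI)
    show "S ` closure (J ` M) \<subseteq> closure (J ` M)"
    proof (rule image_closure_subset)
      show "continuous_on (closure (J ` M)) S"
        by (rule linear_continuous_on[OF bounded_ops_linear[OF S(1)]])
      show "S ` J ` M \<subseteq> closure (J ` M)"
        using M(2) SJ closure_subset[of "J ` M"] by (auto simp: subset_iff)
    qed simp
  qed (auto simp: bounded_ops_add[OF S(1)] bounded_ops_scale[OF S(1)] S(3))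
  with J SJ show ?thesis
    unfolding extends_to_compact_on_L2_def by blast
qed

text \<open>The resulting Schur map multiplies \<open>left_regular g\<close> by the scalar
  \<open>Re (u (- g))\<close>.\<close>

definition group_multiplier :: "('g::group_add \<Rightarrow> complex) \<Rightarrow> 'g \<Rightarrow> 'g \<Rightarrow> complex" where
  "group_multiplier u s t = complex_of_real (Re (u (t - s)))"

text \<open>Inversion of both indices turns \<open>- y + x\<close> into \<open>y - x\<close>, and
  passing to the real part keeps the bound.\<close>

lemma group_multiplier_bound:
  assumes "schur_bound (\<lambda>x y. u (- y + x)) C"
  shows "schur_bound (group_multiplier u) C"
proof -
  have "schur_bound (\<lambda>x y. u (- (- y) + - x)) C"
    by (rule schur_bound_reindex[OF assms]) simp
  then have "schur_bound (\<lambda>x y. u (y - x)) C"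
    by simp
  from schur_bound_Re[OF this] show ?thesis
    by (simp add: group_multiplier_def[abs_def])
qed

lemma group_multiplier_invariant: "group_multiplier u (s + r) (t + r) = group_multiplier u s t"
  by (simp only: group_multiplier_def group_cancel_simps)

lemma schur_op_right_invariant:
  fixes x :: "'g::group_add ell2 oper"
  assumes "schur_bound (group_multiplier u) C" "x \<in> right_invariant"
  shows "schur_op (group_multiplier u) x \<in> right_invariant"
  using assms by (simp add: right_invariant_def schur_op group_multiplier_invariant)

text \<open>On the column at \<open>delta 0\<close> the map multiplies by the numbers
  \<open>Re (u (- g))\<close>. That they are real gives symmetry for the trace; that they tend to
  zero gives compactness.\<close>

lemma WH_map_schur_op:
  fixes u :: "'g::group_add \<Rightarrow> complex"
  assumes u: "schur_bound (\<lambda>x y. u (- y + x)) C" and u0: "u \<in> vanishing_at_infinity"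
  shows "WH_map group_vna group_trace C (schur_op (group_multiplier u))"
proof -
  note m = group_multiplier_bound[OF u]
  let ?T = "schur_op (group_multiplier u)"
  have M: "(right_invariant :: 'g ell2 oper set) \<subseteq> bounded_ops"
    by (auto simp: right_invariant_def)
  have TM: "?T ` right_invariant \<subseteq> right_invariant"
    using schur_op_right_invariant[OF m] by blast
  have coordT: "coord (?T x (delta 0)) g = complex_of_real (Re (u (- g))) * coord (x (delta 0)) g"
    if "x \<in> right_invariant" for x g
  proof -
    have "x \<in> bounded_ops"
      using that by (rule right_invariant_bounded)
    from schur_op(2)[OF m this, of g 0] show ?thesis
      by (simp add: entry_eq_coord group_multiplier_def)
  qed
  have "trace_inner group_trace (?T x) y = trace_inner group_trace x (?T y)"
    if "x \<in> right_invariant" "y \<in> right_invariant" for x y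
  proof -
    have "y \<in> bounded_ops" "?T y \<in> bounded_ops"
      using that(2) schur_op_right_invariant[OF m that(2)] by (simp_all add: right_invariant_bounded)
    then show ?thesis
      by (simp add: trace_inner_group_trace cinner_ell2 coordT that mult_ac)
  qed
  moreover have "extends_to_compact_on_L2 right_invariant group_trace ?T"
  proof (rule extends_to_compact_on_L2_diagonal[OF M TM coordT])
    fix \<epsilon> :: real assume \<epsilon>: "\<epsilon> > 0"
    have "\<forall>\<^sub>F g in cofinite. dist (u g) 0 < \<epsilon>"
      using u0 \<epsilon> by (intro tendstoD) (simp_all add: vanishing_at_infinity_def)
    then have "finite {g. \<epsilon> \<le> cmod (u g)}"
      by (simp add: eventually_cofinite not_less)
    then have "finite (uminus ` {g. \<epsilon> \<le> cmod (u g)})"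
      by simp
    moreover have "{g. \<epsilon> \<le> cmod (complex_of_real (Re (u (- g))))} \<subseteq> uminus ` {g. \<epsilon> \<le> cmod (u g)}"
    proof
      fix g assume "g \<in> {g. \<epsilon> \<le> cmod (complex_of_real (Re (u (- g))))}"
      then have "- g \<in> {g. \<epsilon> \<le> cmod (u g)}"
        using abs_Re_le_cmod[of "u (- g)"] by simp
      then show "g \<in> uminus ` {g. \<epsilon> \<le> cmod (u g)}"
        by (rule rev_image_eqI) simp
    qed
    ultimately show "finite {g. \<epsilon> \<le> cmod (complex_of_real (Re (u (- g))))}"
      by (rule rev_finite_subset)
  qed
  ultimately show ?thesis
    unfolding WH_map_def group_vna_eq
    using linear_map_on_schur_op[OF m M] normal_map_on_schur_op[OF m M TM] cb_norm_schur_op_le[OF m M]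
    by blast
qed

text \<open>The filter is pushed forward along the construction. The uniform bound
  \<open>C * onorm x\<close> reduces ultraweak convergence to that of the entries, which are those
  of \<open>x\<close> times values of \<open>Re u\<close> tending to 1.\<close>

lemma WH_group_imp_vna:
  assumes "WH_group_bound TYPE('g::group_add) C"
  shows "WH_vna_bound (group_vna :: 'g ell2 oper set) group_trace C"
proof -
  from assms obtain F :: "('g \<Rightarrow> complex) filter" where C: "C > 0" and F: "F \<noteq> bot"
    "F \<le> principal {u \<in> herz_schur \<inter> vanishing_at_infinity. herz_schur_norm u \<le> ereal C}"
    and lim: "\<And>g. ((\<lambda>u. u g) \<longlongrightarrow> 1) F"
    unfolding WH_group_bound_def by blast
  let ?T = "\<lambda>u :: 'g \<Rightarrow> complex. schur_op (group_multiplier u)"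
  have ev: "\<forall>\<^sub>F u in F. schur_bound (\<lambda>x y. u (- y + x)) C \<and> u \<in> vanishing_at_infinity"
  proof -
    have "\<forall>\<^sub>F u in F. u \<in> {u \<in> herz_schur \<inter> vanishing_at_infinity. herz_schur_norm u \<le> ereal C}"
      using F(2) by (simp only: le_principal)
    then show ?thesis
      by eventually_elim (auto simp flip: herz_schur_iff)
  qed
  have "filtermap ?T F \<noteq> bot"
    using F(1) by (simp add: filtermap_bot_iff)
  moreover have "filtermap ?T F \<le> principal {T. WH_map group_vna group_trace C T}"
    unfolding le_principal eventually_filtermap using ev
    by eventually_elim (simp add: WH_map_schur_op)
  moreover have "limitin ultraweak (\<lambda>T. T x) x (filtermap ?T F)" if x: "x \<in> group_vna" for x
  proof -
    have xb: "x \<in> bounded_ops"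
      using x by (simp add: group_vna_eq right_invariant_bounded)
    have "limitin ultraweak (\<lambda>u. ?T u x) x F"
    proof (rule limitin_ultraweak[OF _ xb])
      show "\<forall>\<^sub>F u in F. ?T u x \<in> bounded_ops \<and> onorm (?T u x) \<le> C * onorm x"
        using ev by eventually_elim (auto intro: schur_op[OF group_multiplier_bound xb])
      fix s t
      have "((\<lambda>u. complex_of_real (Re (u (t - s))) * entry x s t) \<longlongrightarrow> complex_of_real (Re 1) * entry x s t) F"
        by (intro tendsto_intros lim)
      moreover have "\<forall>\<^sub>F u in F. complex_of_real (Re (u (t - s))) * entry x s t = entry (?T u x) s t"
        using ev
      proof eventually_elim
        case (elim u)
        then show ?case
          using schur_op(2)[OF group_multiplier_bound[of u C] xb, of s t] by (simp add: group_multiplier_def)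
      qed
      ultimately show "((\<lambda>u. entry (?T u x) s t) \<longlongrightarrow> entry x s t) F"
        by (auto dest: Lim_transform_eventually)
    qed
    then show ?thesis
      by (simp add: limitin_def eventually_filtermap)
  qed
  ultimately show ?thesis
    unfolding WH_vna_bound_def using C by blast
qed

section \<open>From maps on the group von Neumann algebra to multipliers\<close>

text \<open>As \<open>delta (- g)\<close> is \<open>left_regular (- g) (delta 0)\<close>, this is
  the diagonal coefficient of \<open>T\<close>, in the trace inner product, at the unitary
  \<open>left_regular (- g)\<close>.\<close>

definition symbol :: "('g::group_add ell2 oper \<Rightarrow> 'g ell2 oper) \<Rightarrow> 'g \<Rightarrow> complex" where
  "symbol T g = cinner (T (left_regular (- g)) (delta 0)) (delta (- g))"

text \<open>The matrix \<open>b\<close> has norm at most 1, and its image under \<open>T\<close> is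
  evaluated at multiples of the vectors \<open>delta (- e j)\<close>. Right invariance identifies
  the resulting entries with values of the symbol.\<close>

lemma schur_bound_symbol:
  fixes T :: "'g::group_add ell2 oper \<Rightarrow> 'g ell2 oper"
  assumes T: "linear_map_on right_invariant T" "T ` right_invariant \<subseteq> right_invariant"
    and cb: "cb_norm right_invariant T \<le> ereal C" and C: "0 \<le> C"
  shows "schur_bound (\<lambda>x y. symbol T (- y + x)) C"
  unfolding schur_bound_def
proof (intro allI impI)
  fix a :: "'g \<Rightarrow> 'g \<Rightarrow> complex"
  assume a: "mat_bound a 1"
  show "mat_bound (\<lambda>s t. symbol T (- t + s) * a s t) C"
  proof (rule mat_boundI_bilinear[OF C])
    fix E :: "'g set" and x y :: "'g \<Rightarrow> complex"
    assume E: "finite E"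
    define n where "n = card E"
    obtain e where e: "bij_betw e {..<n} E"
      using ex_bij_betw_nat_finite[OF E] by (auto simp: n_def atLeast0LessThan)
    have sum_e: "(\<Sum>i<n. f (e i)) = sum f E" for f :: "'g \<Rightarrow> 'z::comm_monoid_add"
      by (rule sum.reindex_bij_betw[OF e])
    have L2_e: "L2_set (\<lambda>i. f (e i)) {..<n} = L2_set f E" for f
      unfolding L2_set_def using sum_e[of "\<lambda>s. (f s)\<^sup>2"] by simp
    define b where "b i j = op_scale (a (e i) (e j)) (left_regular (- e i + e j))" for i j
    have bM: "b i j \<in> right_invariant" for i j
      using left_regular_right_invariant[of "- e i + e j"]
      by (simp add: b_def right_invariant_def op_scale_bounded entry_eq_coord coord_scaleC)
    have "matrix_norm n b \<le> 1"
    proof (rule matrix_norm_leI)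
      fix \<xi> :: "nat \<Rightarrow> 'g ell2"
      assume \<xi>: "L2_set (\<lambda>j. norm (\<xi> j)) {..<n} \<le> 1"
      \<comment> \<open>The diagonal unitary with entries \<open>left_regular (e j)\<close> turns
        \<open>b\<close> into the scalar matrix \<open>a\<close> acting on the index
        \<open>j\<close> alone.\<close>
      define \<zeta> where "\<zeta> j = left_regular (e j) (\<xi> j)" for j
      define \<eta> where "\<eta> i = (\<Sum>j<n. a (e i) (e j) *\<^sub>C \<zeta> j)" for i
      have "norm (\<Sum>j<n. b i j (\<xi> j)) = norm (\<eta> i)" for i
      proof -
        have "(\<Sum>j<n. b i j (\<xi> j)) = left_regular (- e i) (\<eta> i)"
          unfolding \<eta>_def b_def \<zeta>_def left_regular_add bounded_ops_sum[OF left_regular_bounded]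
            bounded_ops_scale[OF left_regular_bounded] ..
        then show ?thesis
          by (simp add: norm_left_regular)
      qed
      moreover have "L2_set (\<lambda>i. norm (\<eta> i)) {..<n} \<le> L2_set (\<lambda>j. norm (\<zeta> j)) {..<n}"
      proof (rule tendsto_le)
        let ?F = "finite_subsets_at_top UNIV :: 'g set filter"
        have lim: "((\<lambda>G. L2_set (\<lambda>i. L2_set (\<lambda>t. cmod (coord (\<theta> i) t)) G) {..<n}) \<longlongrightarrow>
            L2_set (\<lambda>i. norm (\<theta> i)) {..<n}) ?F" for \<theta> :: "nat \<Rightarrow> 'g ell2"
        proof -
          have "((\<lambda>G. \<Sum>t\<in>G. (cmod (coord v t))\<^sup>2) \<longlongrightarrow> (norm v)\<^sup>2) ?F" for v :: "'g ell2"
            using has_sum_infsum[OF coord_summable[of v]] by (simp add: norm_ell2_sq has_sum_def)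
          then have "((\<lambda>G. sqrt (\<Sum>i<n. \<Sum>t\<in>G. (cmod (coord (\<theta> i) t))\<^sup>2)) \<longlongrightarrow> sqrt (\<Sum>i<n. (norm (\<theta> i))\<^sup>2)) ?F"
            by (intro tendsto_real_sqrt tendsto_sum)
          then show ?thesis
            by (simp add: L2_set_def sum_nonneg)
        qed
        show "((\<lambda>G. L2_set (\<lambda>i. L2_set (\<lambda>t. cmod (coord (\<eta> i) t)) G) {..<n}) \<longlongrightarrow>
            L2_set (\<lambda>i. norm (\<eta> i)) {..<n}) ?F"
          "((\<lambda>G. L2_set (\<lambda>i. L2_set (\<lambda>t. cmod (coord (\<zeta> i) t)) G) {..<n}) \<longlongrightarrow>
            L2_set (\<lambda>j. norm (\<zeta> j)) {..<n}) ?F"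
          by (rule lim)+
        \<comment> \<open>At a fixed group coordinate \<open>t\<close> the two families of
          coordinates are related by the scalar matrix \<open>a\<close>, so its bound applies.
          Summing the squares over \<open>t\<close> gives the estimate for vectors.\<close>
        have "L2_set (\<lambda>i. cmod (coord (\<eta> i) t)) {..<n} \<le> L2_set (\<lambda>j. cmod (coord (\<zeta> j) t)) {..<n}" for t
        proof -
          define w where "w s = coord (\<zeta> (inv_into {..<n} e s)) t" for s
          have w: "w (e j) = coord (\<zeta> j) t" if "j < n" for j
            using e that by (simp add: w_def bij_betw_inv_into_left)
          have "coord (\<eta> i) t = (\<Sum>s\<in>E. a (e i) s * w s)" for i
            unfolding sum_e[symmetric] \<eta>_def coord_sum coord_scaleC by (intro sum.cong refl) (simp add: w)
          then have "L2_set (\<lambda>i. cmod (coord (\<eta> i) t)) {..<n} = L2_set (\<lambda>r. cmod (\<Sum>s\<in>E. a r s * w s)) E"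
            using L2_e[of "\<lambda>r. cmod (\<Sum>s\<in>E. a r s * w s)"] by simp
          also have "\<dots> \<le> 1 * L2_set (\<lambda>s. cmod (w s)) E"
            by (rule mat_boundD[OF a E E])
          also have "L2_set (\<lambda>s. cmod (w s)) E = L2_set (\<lambda>j. cmod (coord (\<zeta> j) t)) {..<n}"
            unfolding L2_e[symmetric] by (intro L2_set_cong refl) (simp add: w)
          finally show ?thesis
            by simp
        qed
        then have "L2_set (\<lambda>i. L2_set (\<lambda>t. cmod (coord (\<eta> i) t)) G) {..<n}
            \<le> L2_set (\<lambda>i. L2_set (\<lambda>t. cmod (coord (\<zeta> i) t)) G) {..<n}" for G
          unfolding L2_set_swap[of "\<lambda>i t. cmod (coord (\<eta> i) t)" G "{..<n}"]
            L2_set_swap[of "\<lambda>i t. cmod (coord (\<zeta> i) t)" G "{..<n}"]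
          by - (rule L2_set_mono, auto simp: L2_set_nonneg)
        then show "\<forall>\<^sub>F G in ?F. L2_set (\<lambda>i. L2_set (\<lambda>t. cmod (coord (\<eta> i) t)) G) {..<n}
            \<le> L2_set (\<lambda>i. L2_set (\<lambda>t. cmod (coord (\<zeta> i) t)) G) {..<n}"
          by (intro always_eventually allI)
      qed simp
      ultimately show "L2_set (\<lambda>i. norm (\<Sum>j<n. b i j (\<xi> j))) {..<n} \<le> 1"
        using \<xi> by (simp add: \<zeta>_def norm_left_regular)
    qed
    then have "ereal (matrix_norm n (\<lambda>i j. T (b i j))) \<le> cb_norm right_invariant T"
      unfolding cb_norm_def using bM by (intro SUP_upper2[of n] SUP_upper) auto
    then have TC: "matrix_norm n (\<lambda>i j. T (b i j)) \<le> C"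
      using cb by (metis ereal_less_eq(3) order_trans)
    \<comment> \<open>These vectors select row \<open>- e i\<close> and column \<open>- e j\<close>
      of \<open>T (left_regular (- e i + e j))\<close>. Translation by \<open>e j\<close> moves this
      to row \<open>- e i + e j\<close> and column 0, which is the value of the symbol at
      \<open>- e j + e i\<close>.\<close>
    define \<xi> where "\<xi> j = x (e j) *\<^sub>C delta (- e j)" for j
    define \<eta> where "\<eta> i = y (e i) *\<^sub>C delta (- e i)" for i
    have Tb: "T (b i j) \<in> bounded_ops" for i j
      using T(2) bM[of i j] right_invariant_bounded by blast
    have "cinner (T (b i j) (\<xi> j)) (\<eta> i) = symbol T (- e j + e i) * a (e i) (e j) * x (e j) * cnj (y (e i))" for i j
    proof -
      let ?g = "- e i + e j"
      have L: "left_regular ?g \<in> right_invariant"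
        by (rule left_regular_right_invariant)
      then have TL: "T (left_regular ?g) \<in> right_invariant"
        using T(2) by blast
      have "entry (T (left_regular ?g)) (- e i) (- e j) = entry (T (left_regular ?g)) (?g + - e j) (0 + - e j)"
        by (simp only: group_cancel_simps)
      also have "\<dots> = entry (T (left_regular ?g)) ?g 0"
        using TL unfolding right_invariant_def by blast
      also have "\<dots> = symbol T (- e j + e i)"
        unfolding symbol_def entry_def by (simp only: group_cancel_simps)
      finally have ent: "cinner (T (left_regular ?g) (delta (- e j))) (delta (- e i)) = symbol T (- e j + e i)"
        by (simp only: entry_def)
      have "T (b i j) = op_scale (a (e i) (e j)) (T (left_regular ?g))"
        unfolding b_def using T(1) L unfolding linear_map_on_def by blast
      then show ?thesis
        unfolding \<xi>_def \<eta>_def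
        by (simp only: bounded_ops_scale[OF Tb[of i j]] bounded_ops_scale[OF right_invariant_bounded[OF TL]]
            cinner_scaleC_left cinner_scaleC_right ent mult_ac)
    qed
    then have "(\<Sum>s\<in>E. \<Sum>t\<in>E. symbol T (- t + s) * a s t * x t * cnj (y s))
        = (\<Sum>i<n. \<Sum>j<n. cinner (T (b i j) (\<xi> j)) (\<eta> i))"
      by (simp add: sum_e[symmetric])
    also have "cmod \<dots> \<le> matrix_norm n (\<lambda>i j. T (b i j)) * L2_set (\<lambda>j. norm (\<xi> j)) {..<n} * L2_set (\<lambda>i. norm (\<eta> i)) {..<n}"
      by (rule matrix_norm_bilinear[OF Tb])
    also have "\<dots> \<le> C * L2_set (\<lambda>j. norm (\<xi> j)) {..<n} * L2_set (\<lambda>i. norm (\<eta> i)) {..<n}"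
      by (intro mult_right_mono TC L2_set_nonneg)
    also have "\<dots> = C * L2_set (\<lambda>t. cmod (x t)) E * L2_set (\<lambda>s. cmod (y s)) E"
      by (simp add: \<xi>_def \<eta>_def norm_scaleC L2_e[of "\<lambda>t. cmod (x t)"] L2_e[of "\<lambda>t. cmod (y t)"])
    finally show "cmod (\<Sum>s\<in>E. \<Sum>t\<in>E. symbol T (- t + s) * a s t * x t * cnj (y s))
        \<le> C * L2_set (\<lambda>t. cmod (x t)) E * L2_set (\<lambda>s. cmod (y s)) E" .
  qed
qed

text \<open>Bessel's inequality makes the squares of the coefficients summable.\<close>

lemma orthonormal_cinner_tendsto_0:
  fixes v :: "nat \<Rightarrow> 'h::complex_hilbert"
  assumes orth: "\<And>i j. cinner (v i) (v j) = (if i = j then 1 else 0)"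
  shows "(\<lambda>n. cinner w (v n)) \<longlonglongrightarrow> 0"
proof -
  have "(\<Sum>i<n. (cmod (cinner w (v i)))\<^sup>2) \<le> (norm w)\<^sup>2" for n
  proof -
    let ?p = "\<Sum>i<n. cinner w (v i) *\<^sub>C v i"
    have pv: "cinner ?p (v j) = cinner w (v j)" if "j < n" for j
    proof -
      have "cinner ?p (v j) = (\<Sum>i<n. if i = j then cinner w (v i) else 0)"
        unfolding cinner_sum_left cinner_scaleC_left orth by (intro sum.cong) auto
      then show ?thesis
        using that by simp
    qed
    have up: "cinner u ?p = (\<Sum>i<n. cnj (cinner w (v i)) * cinner u (v i))" for u
      unfolding cinner_sum_right cinner_scaleC_right ..
    have "cinner w ?p = (\<Sum>i<n. cnj (cinner w (v i)) * cinner w (v i))"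
      by (rule up)
    also have "\<dots> = complex_of_real (\<Sum>i<n. (cmod (cinner w (v i)))\<^sup>2)"
      unfolding of_real_sum complex_norm_square by (simp only: mult.commute)
    finally have wp: "cinner w ?p = complex_of_real (\<Sum>i<n. (cmod (cinner w (v i)))\<^sup>2)" .
    have "cinner ?p ?p = cinner w ?p"
      unfolding up[of ?p] up[of w] by (intro sum.cong refl) (simp only: pv lessThan_iff)
    then have pp: "inner ?p ?p = (\<Sum>i<n. (cmod (cinner w (v i)))\<^sup>2)"
      using wp by (metis Re_cinner Re_complex_of_real)
    have ip: "inner w ?p = (\<Sum>i<n. (cmod (cinner w (v i)))\<^sup>2)"
      using wp by (metis Re_cinner Re_complex_of_real)
    have "0 \<le> inner (w - ?p) (w - ?p)"
      by simp
    also have "\<dots> = inner w w - 2 * inner w ?p + inner ?p ?p"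
      by (simp only: inner_diff_left inner_diff_right inner_commute[of ?p w])
    finally show ?thesis
      unfolding pp ip power2_norm_eq_inner by simp
  qed
  then have "summable (\<lambda>i. (cmod (cinner w (v i)))\<^sup>2)"
    by (intro summableI_nonneg_bounded) auto
  then have "(\<lambda>i. (cmod (cinner w (v i)))\<^sup>2) \<longlonglongrightarrow> 0"
    by (rule summable_LIMSEQ_zero)
  then have "(\<lambda>i. sqrt ((cmod (cinner w (v i)))\<^sup>2)) \<longlonglongrightarrow> sqrt 0"
    by (rule tendsto_real_sqrt)
  then show ?thesis
    by (simp add: tendsto_norm_zero_iff)
qed

text \<open>If the symbol stayed above \<open>\<epsilon>\<close> in absolute value on an infinite
  set, there would be an orthonormal sequence whose images under the compact operator converge along
  a subsequence to some \<open>w\<close>. The diagonal coefficients would then approach the inner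
  products of \<open>w\<close> with that subsequence, which tend to zero.\<close>

lemma symbol_vanishing:
  fixes T :: "'g::group_add ell2 oper \<Rightarrow> 'g ell2 oper"
  assumes TM: "T ` right_invariant \<subseteq> right_invariant"
    and ext: "extends_to_compact_on_L2 right_invariant group_trace T"
  shows "symbol T \<in> vanishing_at_infinity"
proof -
  let ?M = "right_invariant :: 'g ell2 oper set"
  from ext obtain J :: "'g ell2 oper \<Rightarrow> 'g ell2 oper ell2" and S where J: "L2_embedding ?M group_trace J"
    and S: "compact_operator_on (closure (J ` ?M)) S" "\<And>x. x \<in> ?M \<Longrightarrow> S (J x) = J (T x)"
    unfolding extends_to_compact_on_L2_def by blast
  define v where "v g = J (left_regular (- g))" for g :: 'g
  have cinJ: "cinner (J x) (J y) = cinner (x (delta 0)) (y (delta 0))" if "x \<in> ?M" "y \<in> ?M" for x y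
    using J that by (simp add: L2_embedding_def trace_inner_group_trace right_invariant_bounded)
  have orth: "cinner (v g) (v h) = (if g = h then 1 else 0)" for g h
    by (auto simp: v_def cinJ left_regular_right_invariant left_regular_delta coord_delta)
  have Sv: "cinner (S (v g)) (v g) = symbol T g" for g
    using TM by (simp add: v_def S(2) cinJ left_regular_right_invariant image_subset_iff left_regular_delta symbol_def)
  have norm_v: "norm (v g) = 1" for g
  proof -
    have "complex_of_real ((norm (v g))\<^sup>2) = 1"
      using orth[of g g] by (simp only: cinner_self simp_thms if_True)
    then have "(norm (v g))\<^sup>2 = 1"
      using of_real_eq_1_iff by blast
    then show ?thesis
      by (simp add: power2_eq_1_iff) (metis norm_ge_zero neg_0_le_iff_le not_one_le_zero)
  qed
  have "finite {g. \<epsilon> \<le> cmod (symbol T g)}" if \<epsilon>: "\<epsilon> > 0" for \<epsilon>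
  proof (rule ccontr)
    assume "infinite {g. \<epsilon> \<le> cmod (symbol T g)}"
    then obtain q :: "nat \<Rightarrow> 'g" where q: "inj q" "range q \<subseteq> {g. \<epsilon> \<le> cmod (symbol T g)}"
      using infinite_countable_subset by blast
    have in_cl: "v g \<in> closure (J ` ?M)" for g
      using closure_subset[of "J ` ?M"] left_regular_right_invariant by (auto simp: v_def)
    have "v g \<in> closure (J ` ?M) \<inter> cball 0 1" for g
      using in_cl norm_v by simp
    then have "\<forall>n. S (v (q n)) \<in> closure (S ` (closure (J ` ?M) \<inter> cball 0 1))"
      by (intro allI subsetD[OF closure_subset] imageI)
    moreover have "seq_compact (closure (S ` (closure (J ` ?M) \<inter> cball 0 1)))"
      using S(1) by (simp add: compact_operator_on_def compact_eq_seq_compact_metric)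
    ultimately obtain w r where r: "strict_mono (r :: nat \<Rightarrow> nat)" "((\<lambda>n. S (v (q n))) \<circ> r) \<longlonglongrightarrow> w"
      unfolding seq_compact_def by metis
    have inj: "q (r i) = q (r j) \<longleftrightarrow> i = j" for i j
      using q(1) strict_mono_eq[OF r(1)] by (simp add: inj_eq)
    have "(\<lambda>n. cinner w (v (q (r n)))) \<longlonglongrightarrow> 0"
      by (rule orthonormal_cinner_tendsto_0) (simp add: orth inj)
    then have "(\<lambda>n. cmod (cinner w (v (q (r n))))) \<longlonglongrightarrow> 0"
      by (rule tendsto_norm_zero)
    moreover have "(\<lambda>n. norm (S (v (q (r n))) - w)) \<longlonglongrightarrow> 0"
      using tendsto_norm_zero[OF LIM_zero[OF r(2)]] by (simp add: o_def)
    ultimately have "(\<lambda>n. norm (S (v (q (r n))) - w) + cmod (cinner w (v (q (r n))))) \<longlonglongrightarrow> 0 + 0"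
      by (intro tendsto_add)
    then have "\<forall>\<^sub>F n in sequentially. norm (S (v (q (r n))) - w) + cmod (cinner w (v (q (r n)))) < \<epsilon>"
      using \<epsilon> by (intro order_tendstoD(2)) simp_all
    then obtain n where n: "norm (S (v (q (r n))) - w) + cmod (cinner w (v (q (r n)))) < \<epsilon>"
      by (auto simp: eventually_sequentially)
    let ?v = "v (q (r n))"
    have "cinner (S ?v) ?v = cinner (S ?v - w) ?v + cinner w ?v"
      by (simp add: cinner_diff_left)
    then have "cmod (symbol T (q (r n))) \<le> cmod (cinner (S ?v - w) ?v) + cmod (cinner w ?v)"
      unfolding Sv by (simp only: norm_triangle_ineq)
    also have "cmod (cinner (S ?v - w) ?v) \<le> norm (S ?v - w)"
      using cinner_norm_le[of "S ?v - w" ?v] by (simp add: norm_v)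
    finally have "cmod (symbol T (q (r n))) < \<epsilon>"
      using n by simp
    moreover have "\<epsilon> \<le> cmod (symbol T (q (r n)))"
      using q(2) by blast
    ultimately show False
      by simp
  qed
  then show ?thesis
    unfolding vanishing_at_infinity_def by (auto simp: tendsto_iff eventually_cofinite not_less)
qed

lemma WH_vna_imp_group:
  assumes "WH_vna_bound (group_vna :: 'g::group_add ell2 oper set) group_trace C"
  shows "WH_group_bound TYPE('g) C"
proof -
  let ?M = "right_invariant :: 'g ell2 oper set"
  from assms obtain F :: "('g ell2 oper \<Rightarrow> 'g ell2 oper) filter" where C: "C > 0" and F: "F \<noteq> bot"
    "F \<le> principal {T. WH_map ?M group_trace C T}"
    and lim: "\<And>x. x \<in> ?M \<Longrightarrow> limitin ultraweak (\<lambda>T. T x) x F"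
    unfolding WH_vna_bound_def group_vna_eq by blast
  have "symbol T \<in> {u \<in> herz_schur \<inter> vanishing_at_infinity. herz_schur_norm u \<le> ereal C}"
    if T: "WH_map ?M group_trace C T" for T
  proof -
    have "?M \<subseteq> bounded_ops"
      by (auto simp: right_invariant_def)
    \<comment> \<open>Invariance of the algebra under \<open>T\<close> is contained in normality: a
      continuous map sends one topspace into the other.\<close>
    then have TM: "T ` ?M \<subseteq> ?M"
      using T continuous_map_image_subset_topspace[of "subtopology ultraweak ?M" "subtopology ultraweak ?M" T]
      by (simp add: WH_map_def normal_map_on_def topspace_ultraweak Int_absorb1)
    have "schur_bound (\<lambda>x y. symbol T (- y + x)) C"
      using T C by (intro schur_bound_symbol TM) (simp_all add: WH_map_def)
    moreover have "symbol T \<in> vanishing_at_infinity"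
      using T by (intro symbol_vanishing TM) (simp add: WH_map_def)
    ultimately show ?thesis
      using herz_schur_iff[of "symbol T" C] by simp
  qed
  then have "filtermap symbol F \<le> principal {u \<in> herz_schur \<inter> vanishing_at_infinity. herz_schur_norm u \<le> ereal C}"
    unfolding le_principal eventually_filtermap using F(2)[unfolded le_principal]
    by (rule eventually_mono[rotated]) simp
  moreover have "filtermap symbol F \<noteq> bot"
    using F(1) by (simp add: filtermap_bot_iff)
  moreover have "((\<lambda>u. u g) \<longlongrightarrow> 1) (filtermap symbol F)" for g
  proof -
    \<comment> \<open>The limit is the coefficient of the identity map, whose symbol is constantly
      1.\<close>
    have "((\<lambda>T. symbol T g) \<longlongrightarrow> cinner (left_regular (- g) (delta 0)) (delta (- g))) F"
      unfolding symbol_def by (intro limitin_ultraweak_cinner lim left_regular_right_invariant)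
    then show ?thesis
      by (simp add: filterlim_filtermap left_regular_delta coord_delta)
  qed
  ultimately show ?thesis
    unfolding WH_group_bound_def using C by blast
qed

theorem theorem2:
  shows "(weak_Haagerup_group TYPE('g::group_add) \<longleftrightarrow>
            weak_Haagerup_vna (group_vna :: 'g ell2 oper set) group_trace) \<and>
         Lambda_WH_group TYPE('g) = Lambda_WH_vna (group_vna :: 'g ell2 oper set) group_trace"
proof -
  have "WH_group_bound TYPE('g) C \<longleftrightarrow> WH_vna_bound (group_vna :: 'g ell2 oper set) group_trace C" for C
    using WH_group_imp_vna WH_vna_imp_group by blast
  then show ?thesis
    by (simp add: weak_Haagerup_group_def weak_Haagerup_vna_def Lambda_WH_group_def Lambda_WH_vna_def)
qed

end
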